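(* For every fixed integer $d\ge 2$, there is an explicit infinite family of weighted $d$-dimensional Cayley complexes $(X,\mu_d)$ over groups $\mathbb{F}_2^n$, with $n\to\infty$ along the family, such that each complex in the family has the following properties: it is simple, pure, and translation invariant, and its top-face probability distribution $\mu_d$ has full support; its one-skeleton and all of its positive-dimensional links are connected; on every codimension-two link (the link $X_F$ of a face $F\in X(d-2)$), the random-walk operator has norm at most $1/d$ on the orthogonal complement of the constants (with respect to the stationary measure of that link); and its Cayley degree is $\Theta_d(n)$, with implied constants depending only on $d$.
   Context: A finite pure $d$-dimensional simplicial complex is a downward-closed collection $X=X(-1)\sqcup X(0)\sqcup\cdots\sqcup X(d)$ of finite sets whose $i$-faces (elements of $X(i)$) have cardinality $i+1$, with $X(-1)=\{\varnothing\}$, in which every face is contained in a $d$-face. A weighted simplicial complex is a pair $(X,\mu_d)$ with $\mu_d$ a probability distribution of full support on $X(d)$. It induces $\mu_i(\sigma)=\binom{d+1}{i+1}^{-1}\sum_{\tau\in X(d),\,\sigma\subseteq\tau}\mu_d(\tau)$ on $X(i)$. Simple means that faces occur without multiplicity. The link of a face $F$ is $X_F=\{T\setminus F:T\in X,\ F\subseteq T\}$, with top-face distribution obtained by conditioning $\mu_d$ on $F\subseteq T$. For $F\in X(d-2)$ the link $X_F$ is a weighted graph. A complex of positive dimension is connected if its one-skeleton is connected. For a finite graph without isolated vertices and with positive symmetric edge weights $w_{uv}$, put $d(u)=\sum_v w_{uv}$; the random-walk operator is $P(u,v)=w_{uv}/d(u)$ on edges, with stationary measure $\pi(u)=d(u)/\sum_v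 d(v)$, and $P$ is self-adjoint for $\langle f,g\rangle_\pi=\sum_u\pi(u)f(u)g(u)$; norms and orthogonality are with respect to this inner product. For $W=\mathbb{F}_2^n$ and $S\subseteq W\setminus\{0\}$, $\operatorname{Cay}(W,S)$ is the graph on $W$ with edges $\{x,x+s\}$, $x\in W$, $s\in S$. A pure weighted simplicial complex is a Cayley complex over $W$ if its one-skeleton is $\operatorname{Cay}(W,S)$ for some such $S$ and its induced edge weights depend only on the generator label $s$; its Cayley degree is $|S|$. It is translation invariant if its top-face distribution is invariant under translations by $W$. An indexed family of translation-invariant Cayley complexes is explicit if a deterministic algorithm, given the family index, outputs the ambient dimension $n$, the generators in $\mathbb{F}_2^n$, one representative of each top-face translation orbit, and the exact rational weight of each face in that orbit, in time polynomial in $n$ for fixed parameters (here $d$ is the fixed parameter). Rational weights are encoded in binary. *)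

theory Defs
  imports
    "HOL-Probability.Probability"
    "HOL-Computational_Algebra.Polynomial"
    "HOL-Library.Function_Algebras"
    "HOL-Library.Log_Nat"
    "HOL-Library.Z2"
begin

section \<open>Weighted simplicial complexes\<close>

text \<open>
  A complex is the set of its faces, so faces carry no multiplicity: every complex
  below is simple.
\<close>

definition faces :: "'v set set \<Rightarrow> nat \<Rightarrow> 'v set set" where
  "faces X i = {\<sigma> \<in> X. card \<sigma> = i + 1}"

definition vertices :: "'v set set \<Rightarrow> 'v set" where
  "vertices X = {v. {v} \<in> X}"

definition pure_complex :: "nat \<Rightarrow> 'v set set \<Rightarrow> bool" where
  "pure_complex d X \<longleftrightarrow>
     finite X \<and> {} \<in> X \<and>
     (\<forall>\<sigma>\<in>X. finite \<sigma> \<and> card \<sigma> \<le> d + 1) \<and>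
     (\<forall>\<sigma>\<in>X. \<forall>\<rho>. \<rho> \<subseteq> \<sigma> \<longrightarrow> \<rho> \<in> X) \<and>
     (\<forall>\<sigma>\<in>X. \<exists>\<tau>\<in>faces X d. \<sigma> \<subseteq> \<tau>)"

definition weighted_complex :: "nat \<Rightarrow> 'v set set \<Rightarrow> 'v set pmf \<Rightarrow> bool" where
  "weighted_complex d X \<mu> \<longleftrightarrow> pure_complex d X \<and> set_pmf \<mu> = faces X d"

definition induced_weight :: "nat \<Rightarrow> 'v set set \<Rightarrow> 'v set pmf \<Rightarrow> nat \<Rightarrow> 'v set \<Rightarrow> real" where
  "induced_weight d X \<mu> i \<sigma> =
     (\<Sum>\<tau> | \<tau> \<in> faces X d \<and> \<sigma> \<subseteq> \<tau>. pmf \<mu> \<tau>) / real ((d + 1) choose (i + 1))"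

definition link :: "'v set set \<Rightarrow> 'v set \<Rightarrow> 'v set set" where
  "link X F = {T - F | T. T \<in> X \<and> F \<subseteq> T}"

definition link_pmf :: "'v set pmf \<Rightarrow> 'v set \<Rightarrow> 'v set pmf" where
  "link_pmf \<mu> F = map_pmf (\<lambda>T. T - F) (cond_pmf \<mu> {T. F \<subseteq> T})"

type_synonym 'v graph = "'v set \<times> 'v set set"

definition one_skeleton :: "'v set set \<Rightarrow> 'v graph" where
  "one_skeleton X = (vertices X, faces X 1)"

definition connected_graph :: "'v graph \<Rightarrow> bool" where
  "connected_graph G \<longleftrightarrow>
     (\<forall>u\<in>fst G. \<forall>v\<in>fst G. (u, v) \<in> {(a, b). {a, b} \<in> snd G}\<^sup>*)"

definition connected_complex :: "'v set set \<Rightarrow> bool" where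
  "connected_complex X \<longleftrightarrow> connected_graph (one_skeleton X)"


section \<open>Random walks on weighted graphs\<close>

text \<open>
  A weighted graph is a finite vertex set \<open>V\<close> with a symmetric weight function
  \<open>w\<close> that vanishes off the edges.
\<close>

definition wdeg :: "'v set \<Rightarrow> ('v \<Rightarrow> 'v \<Rightarrow> real) \<Rightarrow> 'v \<Rightarrow> real" where
  "wdeg V w u = (\<Sum>v\<in>V. w u v)"

definition walk_op :: "'v set \<Rightarrow> ('v \<Rightarrow> 'v \<Rightarrow> real) \<Rightarrow> ('v \<Rightarrow> real) \<Rightarrow> 'v \<Rightarrow> real" where
  "walk_op V w f u = (\<Sum>v\<in>V. w u v / wdeg V w u * f v)"

definition stat :: "'v set \<Rightarrow> ('v \<Rightarrow> 'v \<Rightarrow> real) \<Rightarrow> 'v \<Rightarrow> real" where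
  "stat V w u = wdeg V w u / (\<Sum>v\<in>V. wdeg V w v)"

definition stat_inner ::
    "'v set \<Rightarrow> ('v \<Rightarrow> 'v \<Rightarrow> real) \<Rightarrow> ('v \<Rightarrow> real) \<Rightarrow> ('v \<Rightarrow> real) \<Rightarrow> real" where
  "stat_inner V w f g = (\<Sum>u\<in>V. stat V w u * f u * g u)"

definition stat_norm :: "'v set \<Rightarrow> ('v \<Rightarrow> 'v \<Rightarrow> real) \<Rightarrow> ('v \<Rightarrow> real) \<Rightarrow> real" where
  "stat_norm V w f = sqrt (stat_inner V w f f)"

text \<open>
  The operator norm of the walk on the orthogonal complement of the constants. The
  supremum is over a nonempty set, which is bounded for a finite graph with positive
  edge weights and no isolated vertices.
\<close>

definition walk_norm :: "'v set \<Rightarrow> ('v \<Rightarrow> 'v \<Rightarrow> real) \<Rightarrow> real" where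
  "walk_norm V w =
     Sup {stat_norm V w (walk_op V w f) | f.
            stat_inner V w f (\<lambda>_. 1) = 0 \<and> stat_norm V w f \<le> 1}"

text \<open>
  The link of a codimension-two face is a graph whose edges are its top faces; the
  weight of an edge is its probability. Non-edges, including loops
  \<open>{u, u} = {u}\<close>, lie outside the support.
\<close>

definition link_walk_norm :: "'v set set \<Rightarrow> 'v set pmf \<Rightarrow> 'v set \<Rightarrow> real" where
  "link_walk_norm X \<mu> F =
     walk_norm (vertices (link X F)) (\<lambda>u v. pmf (link_pmf \<mu> F) {u, v})"


section \<open>Cayley complexes\<close>

text \<open>
  The group \<open>\<bbbF>\<^sub>2\<^sup>n\<close>, as the sequences over the two-element field
  that vanish from position \<open>n\<close> on, under pointwise addition.
\<close>

definition F2 :: "nat \<Rightarrow> (nat \<Rightarrow> bit) set" where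
  "F2 n = {x. \<forall>i\<ge>n. x i = 0}"

definition Cay :: "'a::ab_group_add set \<Rightarrow> 'a set \<Rightarrow> 'a graph" where
  "Cay W S = (W, {{x, x + s} | x s. x \<in> W \<and> s \<in> S})"

definition cayley_complex ::
    "'a::ab_group_add set \<Rightarrow> 'a set \<Rightarrow> nat \<Rightarrow> 'a set set \<Rightarrow> 'a set pmf \<Rightarrow> bool" where
  "cayley_complex W S d X \<mu> \<longleftrightarrow>
     weighted_complex d X \<mu> \<and> S \<subseteq> W - {0} \<and> one_skeleton X = Cay W S \<and>
     (\<forall>s\<in>S. \<exists>c. \<forall>x\<in>W. induced_weight d X \<mu> 1 {x, x + s} = c)"

definition translation_invariant :: "'a::ab_group_add set \<Rightarrow> 'a set pmf \<Rightarrow> bool" where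
  "translation_invariant W \<mu> \<longleftrightarrow> (\<forall>x\<in>W. map_pmf (\<lambda>\<sigma>. (+) x ` \<sigma>) \<mu> = \<mu>)"


section \<open>Deterministic algorithms and their running time\<close>

text \<open>
  Algorithms are programs of a random access machine with the logarithmic cost
  criterion (Aho, Hopcroft and Ullman, The Design and Analysis of Computer Algorithms,
  Section 1.3), which is polynomially equivalent to deterministic Turing machines. The
  memory is a sequence of natural-number registers with indirect addressing, and there
  is a write-only output tape of natural numbers. An operation is charged the lengths
  in binary of the numbers it handles; in particular, writing a number costs at least
  its binary length. Subtraction truncates at zero.
\<close>

datatype aexp =
    Const nat
  | Reg aexp
  | Plus aexp aexp
  | Minus aexp aexp
  | Times aexp aexp
  | Div aexp aexp
  | Mod aexp aexp

datatype com =
    Skip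
  | Assign aexp aexp
  | Write aexp
  | Seq com com
  | If aexp com com
  | While aexp com

type_synonym memory = "nat \<Rightarrow> nat"

fun aval :: "memory \<Rightarrow> aexp \<Rightarrow> nat" where
  "aval r (Const k) = k"
| "aval r (Reg a) = r (aval r a)"
| "aval r (Plus a b) = aval r a + aval r b"
| "aval r (Minus a b) = aval r a - aval r b"
| "aval r (Times a b) = aval r a * aval r b"
| "aval r (Div a b) = aval r a div aval r b"
| "aval r (Mod a b) = aval r a mod aval r b"

text \<open>\<open>floorlog 2 k\<close> is the number of binary digits of \<open>k\<close>.\<close>

fun acost :: "memory \<Rightarrow> aexp \<Rightarrow> nat" where
  "acost r (Const k) = 1 + floorlog 2 k"
| "acost r (Reg a) = acost r a + 1 + floorlog 2 (r (aval r a))"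
| "acost r (Plus a b) = acost r a + acost r b + 1 + floorlog 2 (aval r a + aval r b)"
| "acost r (Minus a b) = acost r a + acost r b + 1 + floorlog 2 (aval r a - aval r b)"
| "acost r (Times a b) = acost r a + acost r b + 1 + floorlog 2 (aval r a * aval r b)"
| "acost r (Div a b) = acost r a + acost r b + 1 + floorlog 2 (aval r a div aval r b)"
| "acost r (Mod a b) = acost r a + acost r b + 1 + floorlog 2 (aval r a mod aval r b)"

text \<open>
  \<open>exec c s t s'\<close>: started in the configuration \<open>s\<close> (memory and output
  written so far), the program \<open>c\<close> halts in \<open>s'\<close> at cost \<open>t\<close>. In
  \<open>Assign a b\<close>, the value of \<open>a\<close> is the address of the register that
  receives the value of \<open>b\<close>. Tests are for being nonzero.
\<close>

inductive exec :: "com \<Rightarrow> memory \<times> nat list \<Rightarrow> nat \<Rightarrow> memory \<times> nat list \<Rightarrow> bool" where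
  Skip: "exec Skip s 1 s"
| Assign: "exec (Assign a b) (r, out) (acost r a + acost r b + 1)
             (r(aval r a := aval r b), out)"
| Write: "exec (Write a) (r, out) (acost r a + 1) (r, out @ [aval r a])"
| Seq: "exec c s t s' \<Longrightarrow> exec c' s' t' s'' \<Longrightarrow> exec (Seq c c') s (t + t') s''"
| IfTrue: "aval (fst s) a \<noteq> 0 \<Longrightarrow> exec c s t s' \<Longrightarrow>
             exec (If a c c') s (acost (fst s) a + 1 + t) s'"
| IfFalse: "aval (fst s) a = 0 \<Longrightarrow> exec c' s t s' \<Longrightarrow>
             exec (If a c c') s (acost (fst s) a + 1 + t) s'"
| WhileTrue: "aval (fst s) a \<noteq> 0 \<Longrightarrow> exec c s t s' \<Longrightarrow> exec (While a c) s' t' s'' \<Longrightarrow>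
             exec (While a c) s (acost (fst s) a + 1 + t + t') s''"
| WhileFalse: "aval (fst s) a = 0 \<Longrightarrow> exec (While a c) s (acost (fst s) a + 1) s"

inductive_cases exec_SkipE: "exec Skip s t s'"
inductive_cases exec_AssignE: "exec (Assign a b) s t s'"
inductive_cases exec_WriteE: "exec (Write a) s t s'"
inductive_cases exec_SeqE: "exec (Seq c c') s t s'"
inductive_cases exec_IfE: "exec (If a c c') s t s'"
inductive_cases exec_WhileE: "exec (While a c) s t s'"

lemma exec_deterministic:
  "exec c s t s1 \<Longrightarrow> exec c s t' s2 \<Longrightarrow> t = t' \<and> s1 = s2"
proof (induction arbitrary: t' s2 rule: exec.induct)
  case (Skip s)
  then show ?case by (rule exec_SkipE) simp
next
  case (Assign a b r out)
  then show ?case by (rule exec_AssignE) simp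
next
  case (Write a r out)
  then show ?case by (rule exec_WriteE) simp
next
  case (Seq c s t s' c' t1 s'')
  from Seq.prems show ?case by (rule exec_SeqE) (metis Seq.IH)
next
  case (IfTrue s a c t s' c')
  from IfTrue.prems show ?case by (rule exec_IfE) (use IfTrue.hyps(1) in \<open>auto dest: IfTrue.IH\<close>)
next
  case (IfFalse s a c' t s' c)
  from IfFalse.prems show ?case by (rule exec_IfE) (use IfFalse.hyps(1) in \<open>auto dest: IfFalse.IH\<close>)
next
  case (WhileTrue s a c t s' t1 s'')
  from WhileTrue.prems WhileTrue.hyps(1) obtain t2 t3 s3 where
    "exec c s t2 s3" "exec (While a c) s3 t3 s2" "t' = acost (fst s) a + 1 + t2 + t3"
    by (auto elim: exec_WhileE)
  with WhileTrue.IH show ?case by simp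
next
  case (WhileFalse s a c)
  from WhileFalse.prems show ?case by (rule exec_WhileE) (use WhileFalse.hyps in auto)
qed

text \<open>The input is placed in register 0; all other registers start at 0.\<close>

definition init_config :: "nat \<Rightarrow> memory \<times> nat list" where
  "init_config m = ((\<lambda>_. 0)(0 := m), [])"


section \<open>Explicit families\<close>

text \<open>
  An entry \<open>(vs, a, b)\<close> of the list of orbits stands for the translation orbit of
  the top face \<open>set vs\<close>, all of whose members have weight \<open>a / b\<close>.
\<close>

type_synonym orbit_entry = "(nat \<Rightarrow> bit) list \<times> nat \<times> nat"

definition lists_orbits ::
    "nat \<Rightarrow> nat \<Rightarrow> (nat \<Rightarrow> bit) set set \<Rightarrow> (nat \<Rightarrow> bit) set pmf \<Rightarrow> orbit_entry list \<Rightarrow> bool"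
where
  "lists_orbits n d X \<mu> os \<longleftrightarrow>
     (\<forall>(vs, a, b)\<in>set os. distinct vs \<and> set vs \<in> faces X d \<and> b > 0 \<and>
        (\<forall>x\<in>F2 n. pmf \<mu> ((+) x ` set vs) = real a / real b)) \<and>
     (\<forall>\<tau>\<in>faces X d. \<exists>!j. j < length os \<and> (\<exists>x\<in>F2 n. \<tau> = (+) x ` set (fst (os ! j))))"

definition vec_code :: "nat \<Rightarrow> (nat \<Rightarrow> bit) \<Rightarrow> nat list" where
  "vec_code n x = map (\<lambda>i. if x i = 1 then 1 else 0) [0..<n]"

definition orbit_code :: "nat \<Rightarrow> orbit_entry \<Rightarrow> nat list" where
  "orbit_code n = (\<lambda>(vs, a, b). concat (map (vec_code n) vs) @ [a, b])"

definition output_code :: "nat \<Rightarrow> (nat \<Rightarrow> bit) list \<Rightarrow> orbit_entry list \<Rightarrow> nat list" where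
  "output_code n gs os =
     n # length gs # concat (map (vec_code n) gs) @
     length os # concat (map (orbit_code n) os)"

definition explicit_family ::
    "nat \<Rightarrow> (nat \<Rightarrow> nat) \<Rightarrow> (nat \<Rightarrow> (nat \<Rightarrow> bit) set) \<Rightarrow> (nat \<Rightarrow> (nat \<Rightarrow> bit) set set) \<Rightarrow>
     (nat \<Rightarrow> (nat \<Rightarrow> bit) set pmf) \<Rightarrow> bool" where
  "explicit_family d n S X \<mu> \<longleftrightarrow>
     (\<exists>(c :: com) (q :: nat poly). \<forall>m. \<exists>gs os r t.
        distinct gs \<and> set gs = S m \<and> lists_orbits (n m) d (X m) (\<mu> m) os \<and>
        exec c (init_config m) t (r, output_code (n m) gs os) \<and> t \<le> poly q (n m))"

end

(*
Take the cube on the last M coordinates of F_2^(t+M) and blow every vertex up to a fibre, a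
coset of F_2^t, where 2^t >= 2d. The complex consists of the sets of at most d+1 points that
lie in the union of two adjacent fibres, so its generators are the nonzero vectors of F_2^t and
the vectors e_i + F_2^t, a number linear in M.

The link of a codimension-two face is a complete graph on two parts, or, if the face lies in one
fibre, a star of cliques: the rest of the fibre is joined to M petals, one for each adjacent
fibre. On such a graph the walk splits into functions of mean zero on a part (tiny eigenvalues),
functions that are constant on petals and sum to zero (eigenvalue: the probability pB of
staying in a petal) and a two-state chain (eigenvalue pC + pB - 1, where pC is the probability
of staying in the centre). Let a top face have weight A_k / ((q)_k (q)_(d+1-k)) if it splits
as (k, d+1-k), where q = 2^t and (q)_k is the falling factorial. Then the probabilities only
depend on the ratios A_(k+1) / A_k. Making all of these eigenvalues at most 1/d forces
A_(k+1) / A_k = k / (d-k) for 0 < k < d, and A_0 = A_(d+1) = (d-1) A_1 makes the two-state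
eigenvalue vanish for faces in one fibre.
*)

theory Submission
  imports Defs
begin

section \<open>Random walks on a star of cliques\<close>

text \<open>The cube has no triangles: the fibres supply the high-dimensional faces, the cube the
  growing dimension. The ratios are forced as follows. Let s_k = A_(k+1) / (A_k + A_(k+1)).
  Translations exchange the two fibres, so A_k = A_(d+1-k) and s_(d-k) = 1 - s_k. A face with d - 1
  points in one fibre has pB = 1 - s_(d-1), and pB <= 1/d is needed as soon as there are two petals;
  thus s_(d-1) >= 1 - 1/d and, by symmetry, s_1 <= 1/d. A face split as (j, d-1-j) has pC = s_(j+1)
  and pB = 1 - s_j, so its two-state eigenvalue s_(j+1) - s_j must be at most 1/d. The d - 2 steps
  from s_1 to s_(d-1) have to cover at least (d-2)/d. Hence all these inequalities are equalities
  and s_k = k/d. The number of petals grows with n and must not enter pC; this is why a face within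
  a fibre is weighted once per direction. Explicitness rests on the product structure: up to
  translation, top faces are finitely many patterns that depend only on d, copied into each of the n
  - t directions, and all weights have a common denominator in closed form.\<close>

lemma sum_square_affine:
  fixes h :: "'a \<Rightarrow> real"
  assumes "real (card A) * m = sum h A"
  shows "(\<Sum>x\<in>A. (y + s * (h x - m))\<^sup>2) = real (card A) * y\<^sup>2 + s\<^sup>2 * (\<Sum>x\<in>A. (h x - m)\<^sup>2)"
proof -
  have z: "(\<Sum>x\<in>A. h x - m) = 0"
    using assms by (simp add: sum_subtractf)
  have "(\<Sum>x\<in>A. (y + s * (h x - m))\<^sup>2) =
      (\<Sum>x\<in>A. y\<^sup>2 + s\<^sup>2 * (h x - m)\<^sup>2 + 2 * y * s * (h x - m))"
    by (intro sum.cong) (auto simp: power2_eq_square algebra_simps)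
  also have "\<dots> = real (card A) * y\<^sup>2 + s\<^sup>2 * (\<Sum>x\<in>A. (h x - m)\<^sup>2)"
    by (simp add: sum.distrib z flip: sum_distrib_left)
  finally show ?thesis .
qed

lemma walk_norm_le:
  fixes w :: "'v \<Rightarrow> 'v \<Rightarrow> real"
  assumes "finite V" and pos: "\<And>u. u \<in> V \<Longrightarrow> 0 \<le> wdeg V w u" and "0 \<le> L"
    and contr: "\<And>f. (\<Sum>u\<in>V. wdeg V w u * f u) = 0 \<Longrightarrow>
      (\<Sum>u\<in>V. wdeg V w u * (walk_op V w f u)\<^sup>2) \<le> L\<^sup>2 * (\<Sum>u\<in>V. wdeg V w u * (f u)\<^sup>2)"
  shows "walk_norm V w \<le> L"
proof -
  define T where "T = (\<Sum>v\<in>V. wdeg V w v)"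
  have T: "0 \<le> T" unfolding T_def by (intro sum_nonneg pos)
  have inner: "stat_inner V w f g = (\<Sum>u\<in>V. wdeg V w u * (f u * g u)) / T" for f g
    by (simp add: stat_inner_def stat_def T_def sum_divide_distrib mult.assoc)
  have le: "stat_norm V w (walk_op V w f) \<le> L"
    if f: "stat_inner V w f (\<lambda>_. 1) = 0" "stat_norm V w f \<le> 1" for f
  proof (cases "T = 0")
    \<comment> \<open>If all degrees vanish, the inner products are divisions by zero and therefore
      0.\<close>
    case True
    then show ?thesis using \<open>0 \<le> L\<close> by (simp add: stat_norm_def inner)
  next
    case False
    then have "(\<Sum>u\<in>V. wdeg V w u * f u) = 0" using f(1) by (simp add: inner)
    from contr[OF this] have "stat_inner V w (walk_op V w f) (walk_op V w f) \<le> L\<^sup>2 * stat_inner V w f f"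
      using T False by (simp add: inner power2_eq_square divide_right_mono)
    also have "\<dots> \<le> L\<^sup>2 * 1"
      using f(2) by (intro mult_left_mono) (auto simp: stat_norm_def)
    finally show ?thesis
      using \<open>0 \<le> L\<close> unfolding stat_norm_def by (simp add: real_le_lsqrt)
  qed
  \<comment> \<open>The zero function is admissible, so the supremum is over a nonempty set, as
    \<open>cSup_least\<close> requires.\<close>
  have "stat_norm V w (walk_op V w (\<lambda>_. 0)) \<in>
      {stat_norm V w (walk_op V w f) | f. stat_inner V w f (\<lambda>_. 1) = 0 \<and> stat_norm V w f \<le> 1}"
    by (intro CollectI exI[of _ "\<lambda>_. 0"]) (simp add: stat_norm_def inner)
  then show ?thesis
    unfolding walk_norm_def by (intro cSup_least) (use le in auto)
qed

text \<open>Both types of links have this form: one petal per direction for a face within a fibre, a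
  single petal otherwise. \<open>DC\<close> and \<open>DB\<close> are the degrees, and
  \<open>stay\<close> makes \<open>pC\<close> and \<open>pB\<close> the probabilities of staying.
  The last hypotheses follow the eigenspaces. \<open>small\<close> treats deviations from the mean
  of a part, with eigenvalues \<open>- pC / (c - 1)\<close> and \<open>- pB / (b - 1)\<close>;
  \<open>petals\<close> treats deviations of the petal means from their average, which vanish for a
  single petal; \<open>blocks\<close> treats the averages over the centre and over all
  petals.\<close>

lemma walk_norm_star_of_cliques:
  fixes w :: "'v \<Rightarrow> 'v \<Rightarrow> real" and C :: "'v set" and I :: "'i set" and B :: "'i \<Rightarrow> 'v set"
    and \<alpha> \<beta> \<gamma> b c pC pB :: real
  defines "V \<equiv> C \<union> (\<Union>i\<in>I. B i)"
    and "DC \<equiv> (c - 1) * \<alpha> + real (card I) * b * \<beta>"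
    and "DB \<equiv> c * \<beta> + (b - 1) * \<gamma>"
  assumes fin: "finite C" "finite I" "\<And>i. i \<in> I \<Longrightarrow> finite (B i)"
    and I: "I \<noteq> {}"
    and card: "real (card C) = c" "\<And>i. i \<in> I \<Longrightarrow> real (card (B i)) = b"
    and ge: "c > 1" "b > 1"
    and disj: "disjoint_family_on B I" "\<And>i. i \<in> I \<Longrightarrow> C \<inter> B i = {}"
    and CC: "\<And>u v. u \<in> C \<Longrightarrow> v \<in> C \<Longrightarrow> w u v = (if u = v then 0 else \<alpha>)"
    and CB: "\<And>u i v. u \<in> C \<Longrightarrow> i \<in> I \<Longrightarrow> v \<in> B i \<Longrightarrow> w u v = \<beta>"
    and BC: "\<And>u i v. u \<in> C \<Longrightarrow> i \<in> I \<Longrightarrow> v \<in> B i \<Longrightarrow> w v u = \<beta>"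
    and BB: "\<And>u i v. i \<in> I \<Longrightarrow> u \<in> B i \<Longrightarrow> v \<in> B i \<Longrightarrow> w u v = (if u = v then 0 else \<gamma>)"
    and BB': "\<And>u i v j. i \<in> I \<Longrightarrow> j \<in> I \<Longrightarrow> i \<noteq> j \<Longrightarrow> u \<in> B i \<Longrightarrow> v \<in> B j \<Longrightarrow> w u v = 0"
    and nonneg: "0 \<le> \<alpha>" "0 < \<beta>" "0 \<le> \<gamma>" "0 \<le> L"
    and stay: "(c - 1) * \<alpha> = pC * DC" "(b - 1) * \<gamma> = pB * DB"
    and small: "pC \<le> L * (c - 1)" "pB \<le> L * (b - 1)"
    and petals: "card I = 1 \<or> pB \<le> L"
    and blocks: "\<bar>pC + pB - 1\<bar> \<le> L"
  shows "walk_norm V w \<le> L"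
proof -
  define N where "N = real (card I)"
  have N: "N > 0" using I fin by (simp add: N_def card_gt_0_iff)
  have DC: "DC > 0" unfolding DC_def using N ge nonneg N_def
    by (intro add_nonneg_pos mult_nonneg_nonneg mult_pos_pos) auto
  have DB: "DB > 0" unfolding DB_def using ge nonneg
    by (intro add_pos_nonneg mult_nonneg_nonneg mult_pos_pos) auto
  have centre: "\<alpha> \<le> L * DC"
  proof -
    have "(c - 1) * \<alpha> \<le> L * (c - 1) * DC"
      unfolding stay using small(1) DC by (intro mult_right_mono) auto
    also have "\<dots> = (c - 1) * (L * DC)" by simp
    finally show ?thesis using ge by simp
  qed
  have petal: "\<gamma> \<le> L * DB"
  proof -
    have "(b - 1) * \<gamma> \<le> L * (b - 1) * DB"
      unfolding stay using small(2) DB by (intro mult_right_mono) auto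
    also have "\<dots> = (b - 1) * (L * DB)" by simp
    finally show ?thesis using ge by simp
  qed
  have petals': "card I = 1 \<or> (b - 1) * \<gamma> \<le> L * DB"
    using petals DB by (auto simp: stay)
  have blocks': "\<bar>(c - 1) * \<alpha> / DC + (b - 1) * \<gamma> / DB - 1\<bar> \<le> L"
    using blocks DC DB by (simp add: stay)
  have finV: "finite V" using fin by (auto simp: V_def)
  have sumV: "sum h V = sum h C + (\<Sum>i\<in>I. sum h (B i))" for h :: "'v \<Rightarrow> real"
  proof -
    have "sum h V = sum h C + sum h (\<Union>i\<in>I. B i)"
      unfolding V_def using fin disj(2) by (intro sum.union_disjoint) auto
    also have "sum h (\<Union>i\<in>I. B i) = (\<Sum>i\<in>I. sum h (B i))"
      using fin disj(1) by (intro sum.UNION_disjoint) (auto simp: disjoint_family_on_def)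
    finally show ?thesis .
  qed
  have rowC: "(\<Sum>v\<in>V. w u v * h v) = \<alpha> * (sum h C - h u) + \<beta> * (\<Sum>i\<in>I. sum h (B i))"
    if u: "u \<in> C" for u h
  proof -
    have "(\<Sum>v\<in>C. w u v * h v) = (\<Sum>v\<in>C. \<alpha> * h v - (if u = v then \<alpha> * h u else 0))"
      using u by (intro sum.cong) (auto simp: CC)
    also have "\<dots> = \<alpha> * (sum h C - h u)"
      using u fin by (simp add: sum_subtractf sum_distrib_left algebra_simps)
    finally have 1: "(\<Sum>v\<in>C. w u v * h v) = \<alpha> * (sum h C - h u)" .
    have "(\<Sum>i\<in>I. \<Sum>v\<in>B i. w u v * h v) = (\<Sum>i\<in>I. \<Sum>v\<in>B i. \<beta> * h v)"
      using u by (intro sum.cong) (auto simp: CB)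
    also have "\<dots> = \<beta> * (\<Sum>i\<in>I. sum h (B i))"
      by (simp add: sum_distrib_left)
    finally show ?thesis unfolding sumV 1 by simp
  qed
  have rowB: "(\<Sum>v\<in>V. w u v * h v) = \<beta> * sum h C + \<gamma> * (sum h (B i) - h u)"
    if u: "i \<in> I" "u \<in> B i" for u h i
  proof -
    have 1: "(\<Sum>v\<in>C. w u v * h v) = \<beta> * sum h C"
      using u by (auto simp: sum_distrib_left BC)
    have "(\<Sum>v\<in>B i. w u v * h v) = (\<Sum>v\<in>B i. \<gamma> * h v - (if u = v then \<gamma> * h u else 0))"
      using u by (intro sum.cong) (auto simp: BB)
    also have "\<dots> = \<gamma> * (sum h (B i) - h u)"
      using u fin by (simp add: sum_subtractf sum_distrib_left algebra_simps)
    finally have 2: "(\<Sum>v\<in>B i. w u v * h v) = \<gamma> * (sum h (B i) - h u)" .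
    have "(\<Sum>j\<in>I. \<Sum>v\<in>B j. w u v * h v) = (\<Sum>j\<in>I. if j = i then \<Sum>v\<in>B i. w u v * h v else 0)"
      using u BB' by (intro sum.cong) auto
    also have "\<dots> = (\<Sum>v\<in>B i. w u v * h v)"
      using u fin by simp
    finally show ?thesis unfolding sumV 1 2 by simp
  qed
  have degC: "wdeg V w u = DC" if "u \<in> C" for u
    using rowC[OF that, of "\<lambda>_. 1"] card by (simp add: wdeg_def DC_def algebra_simps)
  have degB: "wdeg V w u = DB" if "i \<in> I" "u \<in> B i" for u i
    using rowB[OF that, of "\<lambda>_. 1"] card that by (simp add: wdeg_def DB_def algebra_simps)
  \<comment> \<open>A two-state chain has eigenvalues 1 and trace minus 1.\<close>
  define \<theta> where "\<theta> = (c - 1) * \<alpha> / DC + (b - 1) * \<gamma> / DB - 1"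
  have \<theta>2: "\<theta>\<^sup>2 \<le> L\<^sup>2" using blocks' unfolding \<theta>_def[symmetric]
    by (metis abs_ge_zero power2_abs power_mono)
  show ?thesis
  proof (rule walk_norm_le[OF finV])
    show "0 \<le> wdeg V w u" if "u \<in> V" for u
      using that degC degB DC DB unfolding V_def by (auto simp: less_imp_le)
    show "0 \<le> L" by fact
    fix f :: "'v \<Rightarrow> real"
    assume f0: "(\<Sum>u\<in>V. wdeg V w u * f u) = 0"
    define SC where "SC = sum f C"
    define SS where "SS i = sum f (B i)" for i
    define SB where "SB = sum SS I"
    define mC where "mC = SC / c"
    define mm where "mm i = SS i / b" for i
    define mB where "mB = SB / (N * b)"
    have SC: "SC = c * mC" using ge by (simp add: mC_def)
    have SS: "SS i = b * mm i" for i using ge by (simp add: mm_def)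
    have SB: "SB = N * b * mB" using ge N by (simp add: mB_def)
    have smm: "N * mB = sum mm I" using ge N by (simp add: mm_def SB_def mB_def flip: sum_divide_distrib)
    have wsum: "(\<Sum>u\<in>V. wdeg V w u * h u) = DC * sum h C + DB * (\<Sum>i\<in>I. sum h (B i))" for h
      unfolding sumV by (simp add: degC degB sum_distrib_left)
    \<comment> \<open>Orthogonality to the constants ties \<open>mB\<close> to \<open>mC\<close>, so
      the two averages form an eigenvector of the two-state chain. Eliminating one of them below
      leaves the factor \<open>\<theta>\<close>.\<close>
    have zero: "DC * (c * mC) + DB * (N * b * mB) = 0"
      using f0 unfolding wsum by (simp add: SC[symmetric] SB[symmetric]) (simp add: SC_def SB_def SS_def)
    have PC: "walk_op V w f u = \<theta> * mC + (- \<alpha> / DC) * (f u - mC)" if "u \<in> C" for u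
    proof -
      have "walk_op V w f u = (\<Sum>v\<in>V. w u v * f v) / DC"
        by (simp add: walk_op_def degC[OF that] sum_divide_distrib)
      also have "\<dots> = (\<alpha> * (c * mC - f u) + \<beta> * (N * b * mB)) / DC"
        unfolding rowC[OF that] by (simp add: SC[symmetric] SB[symmetric]) (simp add: SC_def SB_def SS_def)
      also have "N * b * mB = - (DC * (c * mC)) / DB" using zero DB by (simp add: field_simps)
      also have "(\<alpha> * (c * mC - f u) + \<beta> * (- (DC * (c * mC)) / DB)) / DC =
          ((c - 1) * \<alpha> / DC - c * \<beta> / DB) * mC + (- \<alpha> / DC) * (f u - mC)"
        using DC DB by (simp add: field_simps)
      also have "(c - 1) * \<alpha> / DC - c * \<beta> / DB = \<theta>"
        unfolding \<theta>_def using DB by (simp add: field_simps) (simp add: DB_def algebra_simps)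
      finally show ?thesis .
    qed
    have PB: "walk_op V w f u = (\<theta> * mB + (b - 1) * \<gamma> / DB * (mm i - mB)) + (- \<gamma> / DB) * (f u - mm i)"
      if "i \<in> I" "u \<in> B i" for u i
    proof -
      have "walk_op V w f u = (\<Sum>v\<in>V. w u v * f v) / DB"
        by (simp add: walk_op_def degB[OF that] sum_divide_distrib)
      also have "\<dots> = (\<beta> * (c * mC) + \<gamma> * (b * mm i - f u)) / DB"
        unfolding rowB[OF that] by (simp add: SC[symmetric] SS[symmetric]) (simp add: SC_def SS_def)
      also have "c * mC = - (DB * (N * b * mB)) / DC" using zero DC by (simp add: field_simps)
      also have "(\<beta> * (- (DB * (N * b * mB)) / DC) + \<gamma> * (b * mm i - f u)) / DB =
          - (N * b * \<beta> / DC) * mB + (b - 1) * \<gamma> / DB * mm i + (- \<gamma> / DB) * (f u - mm i)"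
        using DC DB by (simp add: field_simps)
      also have "N * b * \<beta> / DC = 1 - (c - 1) * \<alpha> / DC"
        using DC by (simp add: field_simps) (simp add: DC_def N_def algebra_simps)
      finally show ?thesis by (simp add: \<theta>_def algebra_simps add_divide_distrib diff_divide_distrib)
    qed
    have sqL: "s\<^sup>2 \<le> L\<^sup>2" if "0 \<le> s" "s \<le> L" for s :: real
      using that by (intro power_mono) auto
    have sC: "(\<alpha> / DC)\<^sup>2 \<le> L\<^sup>2" using centre nonneg DC by (intro sqL) (auto simp: field_simps)
    have sB: "(\<gamma> / DB)\<^sup>2 \<le> L\<^sup>2" using petal nonneg DB by (intro sqL) (auto simp: field_simps)
    have C: "(\<Sum>u\<in>C. (walk_op V w f u)\<^sup>2) \<le> L\<^sup>2 * (\<Sum>u\<in>C. (f u)\<^sup>2)"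
    proof -
      have m: "real (card C) * mC = sum f C" using card SC SC_def by simp
      have "(\<Sum>u\<in>C. (walk_op V w f u)\<^sup>2) = (\<Sum>u\<in>C. (\<theta> * mC + (- \<alpha> / DC) * (f u - mC))\<^sup>2)"
        by (intro sum.cong) (auto simp: PC)
      also have "\<dots> = c * (\<theta>\<^sup>2 * mC\<^sup>2) + (\<alpha> / DC)\<^sup>2 * (\<Sum>u\<in>C. (f u - mC)\<^sup>2)"
        unfolding sum_square_affine[OF m] card by (simp add: power_mult_distrib power_divide)
      also have "\<dots> \<le> c * (L\<^sup>2 * mC\<^sup>2) + L\<^sup>2 * (\<Sum>u\<in>C. (f u - mC)\<^sup>2)"
        using \<theta>2 sC ge by (intro add_mono mult_left_mono mult_right_mono sum_nonneg) auto
      also have "\<dots> = L\<^sup>2 * (\<Sum>u\<in>C. (f u)\<^sup>2)"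
        using sum_square_affine[OF m, of mC 1] card by (simp add: algebra_simps)
      finally show ?thesis .
    qed
    \<comment> \<open>The mean of the image over a petal is kept unestimated here: it varies with
      the petal, and its sum over the petals is split once more, into the average and the deviations
      from it.\<close>
    have Bi: "(\<Sum>u\<in>B i. (walk_op V w f u)\<^sup>2) \<le>
        b * (\<theta> * mB + (b - 1) * \<gamma> / DB * (mm i - mB))\<^sup>2 + L\<^sup>2 * ((\<Sum>u\<in>B i. (f u)\<^sup>2) - b * (mm i)\<^sup>2)"
      if i: "i \<in> I" for i
    proof -
      have m: "real (card (B i)) * mm i = sum f (B i)" using card i SS SS_def by simp
      have "(\<Sum>u\<in>B i. (walk_op V w f u)\<^sup>2) =
          (\<Sum>u\<in>B i. ((\<theta> * mB + (b - 1) * \<gamma> / DB * (mm i - mB)) + (- \<gamma> / DB) * (f u - mm i))\<^sup>2)"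
        using i by (intro sum.cong) (auto simp: PB)
      also have "\<dots> = b * (\<theta> * mB + (b - 1) * \<gamma> / DB * (mm i - mB))\<^sup>2 + (\<gamma> / DB)\<^sup>2 * (\<Sum>u\<in>B i. (f u - mm i)\<^sup>2)"
        unfolding sum_square_affine[OF m] card(2)[OF i] by (simp add: power_mult_distrib power_divide)
      also have "(\<gamma> / DB)\<^sup>2 * (\<Sum>u\<in>B i. (f u - mm i)\<^sup>2) \<le> L\<^sup>2 * (\<Sum>u\<in>B i. (f u - mm i)\<^sup>2)"
        using sB by (intro mult_right_mono sum_nonneg) auto
      also have "(\<Sum>u\<in>B i. (f u - mm i)\<^sup>2) = (\<Sum>u\<in>B i. (f u)\<^sup>2) - b * (mm i)\<^sup>2"
        using sum_square_affine[OF m, of "mm i" 1] card i by (simp add: algebra_simps)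
      finally show ?thesis by simp
    qed
    have means: "(\<Sum>i\<in>I. (\<theta> * mB + (b - 1) * \<gamma> / DB * (mm i - mB))\<^sup>2) \<le> L\<^sup>2 * (\<Sum>i\<in>I. (mm i)\<^sup>2)"
    proof -
      have m: "real (card I) * mB = sum mm I" using smm N_def by simp
      have dev: "((b - 1) * \<gamma> / DB)\<^sup>2 * (\<Sum>i\<in>I. (mm i - mB)\<^sup>2) \<le> L\<^sup>2 * (\<Sum>i\<in>I. (mm i - mB)\<^sup>2)"
        using petals'
      proof
        assume "card I = 1"
        \<comment> \<open>The mean of the only petal is the average, so there is no
          deviation.\<close>
        then obtain i where "I = {i}" by (auto simp: card_1_singleton_iff)
        then show ?thesis using smm N_def by simp
      next
        assume "(b - 1) * \<gamma> \<le> L * DB"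
        then have "(b - 1) * \<gamma> / DB \<le> L" "0 \<le> (b - 1) * \<gamma> / DB"
          using ge nonneg DB by (auto simp: pos_divide_le_eq)
        then show ?thesis
          by (intro mult_right_mono sum_nonneg sqL) auto
      qed
      have "(\<Sum>i\<in>I. (\<theta> * mB + (b - 1) * \<gamma> / DB * (mm i - mB))\<^sup>2) =
          N * (\<theta>\<^sup>2 * mB\<^sup>2) + ((b - 1) * \<gamma> / DB)\<^sup>2 * (\<Sum>i\<in>I. (mm i - mB)\<^sup>2)"
        unfolding sum_square_affine[OF m] N_def by (simp add: power_mult_distrib)
      also have "\<dots> \<le> N * (L\<^sup>2 * mB\<^sup>2) + L\<^sup>2 * (\<Sum>i\<in>I. (mm i - mB)\<^sup>2)"
        using \<theta>2 N by (intro add_mono dev mult_left_mono mult_right_mono) auto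
      also have "\<dots> = L\<^sup>2 * (\<Sum>i\<in>I. (mm i)\<^sup>2)"
        using sum_square_affine[OF m, of mB 1] by (simp add: N_def algebra_simps)
      finally show ?thesis .
    qed
    have "(\<Sum>i\<in>I. \<Sum>u\<in>B i. (walk_op V w f u)\<^sup>2) \<le>
        (\<Sum>i\<in>I. b * (\<theta> * mB + (b - 1) * \<gamma> / DB * (mm i - mB))\<^sup>2 + L\<^sup>2 * ((\<Sum>u\<in>B i. (f u)\<^sup>2) - b * (mm i)\<^sup>2))"
      by (intro sum_mono Bi)
    also have "\<dots> = b * (\<Sum>i\<in>I. (\<theta> * mB + (b - 1) * \<gamma> / DB * (mm i - mB))\<^sup>2) +
        L\<^sup>2 * ((\<Sum>i\<in>I. \<Sum>u\<in>B i. (f u)\<^sup>2) - b * (\<Sum>i\<in>I. (mm i)\<^sup>2))"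
      by (simp add: sum.distrib sum_subtractf sum_distrib_left right_diff_distrib)
    also have "\<dots> \<le> b * (L\<^sup>2 * (\<Sum>i\<in>I. (mm i)\<^sup>2)) + L\<^sup>2 * ((\<Sum>i\<in>I. \<Sum>u\<in>B i. (f u)\<^sup>2) - b * (\<Sum>i\<in>I. (mm i)\<^sup>2))"
      using means ge by (intro add_right_mono mult_left_mono) auto
    also have "\<dots> = L\<^sup>2 * (\<Sum>i\<in>I. \<Sum>u\<in>B i. (f u)\<^sup>2)"
      by (simp add: algebra_simps)
    finally have B: "(\<Sum>i\<in>I. \<Sum>u\<in>B i. (walk_op V w f u)\<^sup>2) \<le> L\<^sup>2 * (\<Sum>i\<in>I. \<Sum>u\<in>B i. (f u)\<^sup>2)" .
    have "DC * (\<Sum>u\<in>C. (walk_op V w f u)\<^sup>2) + DB * (\<Sum>i\<in>I. \<Sum>u\<in>B i. (walk_op V w f u)\<^sup>2) \<le>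
        DC * (L\<^sup>2 * (\<Sum>u\<in>C. (f u)\<^sup>2)) + DB * (L\<^sup>2 * (\<Sum>i\<in>I. \<Sum>u\<in>B i. (f u)\<^sup>2))"
      using DC DB by (intro add_mono mult_left_mono B C) auto
    then show "(\<Sum>u\<in>V. wdeg V w u * (walk_op V w f u)\<^sup>2) \<le> L\<^sup>2 * (\<Sum>u\<in>V. wdeg V w u * (f u)\<^sup>2)"
      unfolding wsum by (simp add: algebra_simps)
  qed
qed

section \<open>The edge blow-up of the cube\<close>

text \<open>This simplification rule hides addition on \<open>bit\<close> from the rules for abelian groups.\<close>

declare add_bit_eq_xor [simp del]

lemma bit_add_self_eq_0: "(b::bit) + b = 0"
  by (cases b) auto

lemma vec_add_self: "(x :: nat \<Rightarrow> bit) + x = 0"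
  by (simp add: fun_eq_iff bit_add_self_eq_0)

lemma vec_add_cancel: "(x :: nat \<Rightarrow> bit) + (x + y) = y"
  by (simp add: vec_add_self flip: add.assoc)

lemma vec_image_cancel: "(+) (x :: nat \<Rightarrow> bit) ` ((+) x ` A) = A"
  by (simp add: image_image vec_add_cancel)

lemma F2_add: "x \<in> F2 n \<Longrightarrow> y \<in> F2 n \<Longrightarrow> x + y \<in> F2 n"
  by (simp add: F2_def)

lemma zero_in_F2: "0 \<in> F2 n"
  by (simp add: F2_def)

lemma F2_bij: "bij_betw (\<lambda>x. {i. x i = 1}) (F2 n) (Pow {..<n})"
proof (rule bij_betwI[where g = "\<lambda>A i. if i \<in> A then 1 else 0"])
  show "(\<lambda>x. {i. x i = 1}) \<in> F2 n \<rightarrow> Pow {..<n}"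
  proof (intro Pi_I PowI subsetI)
    fix x i assume "x \<in> F2 n" "i \<in> {i. x i = 1}"
    then show "i \<in> {..<n}"
      by (cases "n \<le> i") (auto simp: F2_def)
  qed
  show "(\<lambda>i. if i \<in> {i. x i = 1} then 1 else 0) = x" if "x \<in> F2 n" for x
    by (auto simp: fun_eq_iff)
qed (auto simp: F2_def)

lemma finite_F2: "finite (F2 n)"
  using bij_betw_finite[OF F2_bij] by simp

lemma card_F2: "card (F2 n) = 2 ^ n"
  using bij_betw_same_card[OF F2_bij, of n] by (simp add: card_Pow)

lemma F2_mono: "m \<le> n \<Longrightarrow> F2 m \<subseteq> F2 n"
  by (auto simp: F2_def)

definition basis_vec :: "nat \<Rightarrow> nat \<Rightarrow> bit" where
  "basis_vec i = (\<lambda>k. if k = i then 1 else 0)"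

text \<open>
  In \<open>F2 n\<close> the coordinates below \<open>t\<close> are those within a fibre, and the others are
  those of the cube.
\<close>

definition const_off :: "nat \<Rightarrow> nat \<Rightarrow> (nat \<Rightarrow> bit) set \<Rightarrow> bool" where
  "const_off t i \<sigma> \<longleftrightarrow> (\<forall>x\<in>\<sigma>. \<forall>y\<in>\<sigma>. \<forall>k\<ge>t. k \<noteq> i \<longrightarrow> x k = y k)"

definition edge_blowup :: "nat \<Rightarrow> nat \<Rightarrow> nat \<Rightarrow> (nat \<Rightarrow> bit) set set" where
  "edge_blowup d t n = {\<sigma>. \<sigma> \<subseteq> F2 n \<and> card \<sigma> \<le> d + 1 \<and> (\<exists>i\<in>{t..<n}. const_off t i \<sigma>)}"

text \<open>
  Up to a common factor, \<open>A\<^sub>k / ((q)\<^sub>k (q)\<^bsub>d+1-k\<^esub>)\<close> with \<open>A\<^sub>k = (k-1)! (d-k)!\<close> for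
  \<open>1 \<le> k \<le> d\<close> and \<open>A\<^sub>0 = A\<^bsub>d+1\<^esub> = (d-1) A\<^sub>1\<close>.
\<close>

definition split_weight :: "nat \<Rightarrow> nat \<Rightarrow> nat \<Rightarrow> nat" where
  "split_weight d q k =
     (if k = 0 \<or> k = d + 1 then (d - 1) * fact (d - 1) * fact q * fact (q - d - 1)
      else fact (k - 1) * fact (d - k) * fact (q - k) * fact (q - (d + 1 - k)))"

text \<open>
  A face within one fibre belongs to all \<open>n - t\<close> directions, and is weighted once for each;
  any other face of positive dimension belongs to one direction only.
\<close>

definition face_weight :: "nat \<Rightarrow> nat \<Rightarrow> nat \<Rightarrow> (nat \<Rightarrow> bit) set \<Rightarrow> nat" where
  "face_weight d t n \<tau> =
     (\<Sum>i | i \<in> {t..<n} \<and> const_off t i \<tau>. split_weight d (2 ^ t) (card {x \<in> \<tau>. x i = 1}))"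

definition total_weight :: "nat \<Rightarrow> nat \<Rightarrow> nat \<Rightarrow> nat" where
  "total_weight d t n = sum (face_weight d t n) (faces (edge_blowup d t n) d)"

definition blowup_pmf :: "nat \<Rightarrow> nat \<Rightarrow> nat \<Rightarrow> (nat \<Rightarrow> bit) set pmf" where
  "blowup_pmf d t n = embed_pmf (\<lambda>\<tau>. if \<tau> \<in> faces (edge_blowup d t n) d
     then real (face_weight d t n \<tau>) / real (total_weight d t n) else 0)"

text \<open>This makes the weights translation invariant: a translation that flips coordinate
  \<open>i\<close> exchanges the two fibres, and with them \<open>k\<close> and
  \<open>d + 1 - k\<close>.\<close>

lemma split_weight_sym:
  assumes "k \<le> d + 1" shows "split_weight d q (d + 1 - k) = split_weight d q k"
  using assms by (auto simp: split_weight_def ac_simps Suc_diff_le)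

lemma split_weight_pos: "d \<ge> 2 \<Longrightarrow> split_weight d q k > 0"
  by (simp add: split_weight_def)

lemma const_off_image_add: "const_off t i ((+) x ` \<sigma>) \<longleftrightarrow> const_off t i \<sigma>"
  by (simp add: const_off_def)

lemma const_off_mono: "const_off t i \<tau> \<Longrightarrow> \<sigma> \<subseteq> \<tau> \<Longrightarrow> const_off t i \<sigma>"
  by (auto simp: const_off_def)

text \<open>The bound on \<open>2 ^ t\<close> leaves at least \<open>d + 1\<close> points of a fibre
  outside a face with \<open>d - 1\<close> points. So top faces fit into a fibre, and the
  eigenvalues for deviations within a part of a link, a probability divided by the size of the part
  minus 1, are at most 1/d in absolute value.\<close>

locale blowup =
  fixes d t n :: nat
  assumes d: "d \<ge> 2" and q: "2 * d \<le> 2 ^ t" and n: "t < n"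
begin

abbreviation "X \<equiv> edge_blowup d t n"
abbreviation "wt \<equiv> face_weight d t n"
abbreviation "om \<equiv> split_weight d (2 ^ t)"
abbreviation "\<mu> \<equiv> blowup_pmf d t n"
abbreviation "Z \<equiv> total_weight d t n"

definition fib :: "(nat \<Rightarrow> bit) \<Rightarrow> (nat \<Rightarrow> bit) set" where
  "fib y = {x \<in> F2 n. \<forall>k\<ge>t. x k = y k}"

lemma finite_X: "finite X"
  by (rule finite_subset[of _ "Pow (F2 n)"]) (auto simp: edge_blowup_def finite_F2)

lemma X_finite: "\<sigma> \<in> X \<Longrightarrow> finite \<sigma>"
  by (rule finite_subset[OF _ finite_F2[of n]]) (simp add: edge_blowup_def)

lemma finite_faces: "finite (faces X k)"
  using finite_X by (simp add: faces_def)

lemma fib_subset: "fib y \<subseteq> F2 n"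
  by (auto simp: fib_def)

lemma finite_fib: "finite (fib y)"
  using fib_subset finite_F2 by (rule finite_subset)

lemma card_fib:
  assumes "y \<in> F2 n" shows "card (fib y) = 2 ^ t"
proof -
  have "bij_betw (\<lambda>x k. if k < t then x k else y k) (F2 t) (fib y)"
    using assms n by (intro bij_betwI[where g = "\<lambda>x k. if k < t then x k else 0"])
      (auto simp: fib_def F2_def fun_eq_iff)
  from bij_betw_same_card[OF this] show ?thesis by (simp add: card_F2)
qed

lemma fib_self: "y \<in> F2 n \<Longrightarrow> y \<in> fib y"
  by (simp add: fib_def)

lemma basis_vec_F2: "i \<in> {t..<n} \<Longrightarrow> basis_vec i \<in> F2 n"
  by (auto simp: basis_vec_def F2_def)

lemma fib_basis_vec_iff:
  assumes "i \<ge> t"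
  shows "x \<in> fib (y + basis_vec i) \<longleftrightarrow> x \<in> F2 n \<and> x i \<noteq> y i \<and> (\<forall>k\<ge>t. k \<noteq> i \<longrightarrow> x k = y k)"
proof -
  have 1: "x i = (y + basis_vec i) i \<longleftrightarrow> x i \<noteq> y i"
    by (cases "x i"; cases "y i") (auto simp: basis_vec_def)
  have 2: "(y + basis_vec i) k = y k" if "k \<noteq> i" for k
    using that by (simp add: basis_vec_def)
  show ?thesis
    unfolding fib_def mem_Collect_eq using assms 1 2 by metis
qed

lemma fib_disjoint: "i \<ge> t \<Longrightarrow> fib y \<inter> fib (y + basis_vec i) = {}"
  by (auto simp: fib_basis_vec_iff) (auto simp: fib_def)

lemma fib_basis_vec_disjoint: "i \<ge> t \<Longrightarrow> j \<ge> t \<Longrightarrow> i \<noteq> j \<Longrightarrow> fib (y + basis_vec i) \<inter> fib (y + basis_vec j) = {}"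
  by (auto simp: fib_basis_vec_iff)

lemma const_off_fibs: "i \<ge> t \<Longrightarrow> const_off t i (fib y \<union> fib (y + basis_vec i))"
  by (auto simp: const_off_def fib_basis_vec_iff) (auto simp: fib_def)

lemma const_off_fib: "const_off t i (fib y)"
  by (auto simp: const_off_def fib_def)

text \<open>Coordinate \<open>i\<close> has only two values over the two-element field, so freeing
  it leaves the fibre of \<open>x\<close> and one neighbour.\<close>

lemma const_off_subset_fibs:
  assumes "const_off t i \<sigma>" "\<sigma> \<subseteq> F2 n" "x \<in> \<sigma>" "i \<ge> t"
  shows "\<sigma> \<subseteq> fib x \<union> fib (x + basis_vec i)"
proof
  fix y assume y: "y \<in> \<sigma>"
  then have "\<forall>k\<ge>t. k \<noteq> i \<longrightarrow> y k = x k" using assms by (auto simp: const_off_def)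
  then show "y \<in> fib x \<union> fib (x + basis_vec i)"
    using y assms(2,4) by (cases "y i = x i") (auto simp: fib_basis_vec_iff, auto simp: fib_def)
qed

text \<open>A face can absorb the fibre of any of its points without changing direction. Purity and
  the connectivity of links rest on this.\<close>

lemma const_off_Un_fib:
  assumes "const_off t i \<sigma>" "\<sigma> \<subseteq> F2 n" "x \<in> \<sigma>" "i \<ge> t" "A \<subseteq> fib x"
  shows "const_off t i (\<sigma> \<union> A)"
  using const_off_subset_fibs[OF assms(1-4)] assms(4,5) by (intro const_off_mono[OF const_off_fibs[of i x]]) auto

text \<open>A set that meets both fibres varies in coordinate \<open>i\<close>, so \<open>i\<close>
  is its only direction and the sum has one term. Which fibre has value 1 in coordinate
  \<open>i\<close> is immaterial by the symmetry of \<open>om\<close>.\<close>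

lemma wt_two_fibres:
  assumes i: "i \<in> {t..<n}" and A: "A \<subseteq> fib y" "A \<noteq> {}" and B: "B \<subseteq> fib (y + basis_vec i)" "B \<noteq> {}"
    and card: "card A + card B = d + 1"
  shows "wt (A \<union> B) = om (card A)"
proof -
  have fin: "finite A" "finite B" using A(1) B(1) finite_fib by (metis finite_subset)+
  have const_off: "const_off t i (A \<union> B)" using A B i by (intro const_off_mono[OF const_off_fibs[of i y]]) auto
  have "j = i" if "const_off t j (A \<union> B)" for j
  proof (rule ccontr)
    assume "j \<noteq> i"
    obtain a b where "a \<in> A" "b \<in> B" using A(2) B(2) by blast
    then have "a i = y i" using A i by (auto simp: fib_def)
    moreover have "b i \<noteq> y i" using B \<open>b \<in> B\<close> i by (auto simp: fib_basis_vec_iff)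
    ultimately have "a i \<noteq> b i" by simp
    moreover have "i \<ge> t" using i by simp
    ultimately show False
      using that \<open>a \<in> A\<close> \<open>b \<in> B\<close> \<open>j \<noteq> i\<close> unfolding const_off_def by blast
  qed
  then have only: "{j. j \<in> {t..<n} \<and> const_off t j (A \<union> B)} = {i}" using i const_off by blast
  have vals: "a i = y i" if "a \<in> A" for a using that A i by (auto simp: fib_def)
  have vals': "b i \<noteq> y i" if "b \<in> B" for b using that B i by (auto simp: fib_basis_vec_iff)
  have "om (card {x \<in> A \<union> B. x i = 1}) = om (card A)"
  proof (cases "y i = 1")
    case True
    then have "{x \<in> A \<union> B. x i = 1} = A" using vals vals' by fastforce
    then show ?thesis by simp
  next
    case False
    then have "{x \<in> A \<union> B. x i = 1} = B" using vals vals' by fastforce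
    moreover have "card B = d + 1 - card A" using card by simp
    ultimately show ?thesis using card split_weight_sym[of "card A" d "2 ^ t"] by simp
  qed
  then show ?thesis unfolding face_weight_def only by simp
qed

text \<open>Every direction contributes, with 0 or \<open>d + 1\<close> points on the counted side,
  where \<open>om\<close> has the same value. The factor \<open>n - t\<close> balances the number of
  petals in the link.\<close>

lemma wt_one_fibre:
  assumes A: "A \<subseteq> fib y" and card: "card A = d + 1"
  shows "wt A = (n - t) * om 0"
proof -
  have all: "{j. j \<in> {t..<n} \<and> const_off t j A} = {t..<n}"
    using const_off_mono[OF const_off_fib A] by auto
  have "om (card {x \<in> A. x j = 1}) = om 0" if "j \<in> {t..<n}" for j
  proof (cases "y j = 1")
    case True
    then have "{x \<in> A. x j = 1} = A" using A that by (auto simp: fib_def)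
    then show ?thesis using card by (simp add: split_weight_def)
  next
    case False
    then have "{x \<in> A. x j = 1} = {}" using A that by (auto simp: fib_def)
    then show ?thesis by (simp only: card.empty)
  qed
  then have "wt A = (\<Sum>j\<in>{t..<n}. om 0)"
    unfolding face_weight_def all by (rule sum.cong[OF refl])
  then show ?thesis by simp
qed

lemma wt_eq_0: "(\<And>i. i \<in> {t..<n} \<Longrightarrow> \<not> const_off t i \<tau>) \<Longrightarrow> wt \<tau> = 0"
  by (auto simp: face_weight_def)

lemma wt_pos: "\<tau> \<in> X \<Longrightarrow> wt \<tau> > 0"
  using d unfolding face_weight_def edge_blowup_def by (intro sum_pos) (auto simp: split_weight_pos)

text \<open>Purity: a fibre has more than \<open>d\<close> points, so a face can be completed within
  the fibre of one of its points. The empty face has no point and takes any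
  \<open>x\<close>.\<close>

lemma extend_face:
  assumes "\<sigma> \<in> X" "x \<in> F2 n" "\<sigma> \<noteq> {} \<Longrightarrow> x \<in> \<sigma>"
  obtains \<tau> where "\<tau> \<in> faces X d" "\<sigma> \<subseteq> \<tau>" "\<tau> \<subseteq> \<sigma> \<union> fib x"
proof -
  from assms(1) obtain i where i: "i \<in> {t..<n}" "const_off t i \<sigma>" "\<sigma> \<subseteq> F2 n" "card \<sigma> \<le> d + 1"
    by (auto simp: edge_blowup_def)
  have fl: "const_off t i (\<sigma> \<union> fib x)"
  proof (cases "\<sigma> = {}")
    case True
    then show ?thesis by (simp add: const_off_fib)
  next
    case False
    then show ?thesis using i assms(3) by (intro const_off_Un_fib) auto
  qed
  have "d + 1 \<le> card (fib x)" using card_fib[OF assms(2)] d q by linarith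
  also have "\<dots> \<le> card (\<sigma> \<union> fib x)"
    using finite_fib X_finite[OF assms(1)] by (intro card_mono) auto
  finally have "\<exists>\<tau>. \<sigma> \<subseteq> \<tau> \<and> \<tau> \<subseteq> \<sigma> \<union> fib x \<and> card \<tau> = d + 1"
    using i finite_fib X_finite[OF assms(1)] by (intro exists_subset_between) auto
  then obtain \<tau> where \<tau>: "\<sigma> \<subseteq> \<tau>" "\<tau> \<subseteq> \<sigma> \<union> fib x" "card \<tau> = d + 1" by blast
  have "\<tau> \<in> faces X d"
  proof -
    have "\<tau> \<subseteq> F2 n" using \<tau>(2) i(3) fib_subset by blast
    then show ?thesis
      using \<tau> i const_off_mono[OF fl \<tau>(2)] by (auto simp: faces_def edge_blowup_def)
  qed
  with \<tau> that show ?thesis by blast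
qed

lemma empty_in_X: "{} \<in> X"
  using n by (auto simp: edge_blowup_def const_off_def)

lemma subset_in_X: "\<sigma> \<in> X \<Longrightarrow> \<rho> \<subseteq> \<sigma> \<Longrightarrow> \<rho> \<in> X"
proof -
  assume \<sigma>: "\<sigma> \<in> X" "\<rho> \<subseteq> \<sigma>"
  then have "card \<rho> \<le> card \<sigma>" by (intro card_mono X_finite)
  moreover obtain i where "i \<in> {t..<n}" "const_off t i \<sigma>" using \<sigma>(1) by (auto simp: edge_blowup_def)
  moreover from this have "const_off t i \<rho>" using \<sigma>(2) const_off_mono by blast
  ultimately show ?thesis using \<sigma> unfolding edge_blowup_def by auto
qed

lemma pure_X: "pure_complex d X"
  unfolding pure_complex_def
proof (intro conjI ballI allI impI)
  fix \<sigma> assume \<sigma>: "\<sigma> \<in> X"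
  obtain x where x: "x \<in> F2 n" "\<sigma> \<noteq> {} \<Longrightarrow> x \<in> \<sigma>"
    using \<sigma> zero_in_F2[of n] by (cases "\<sigma> = {}") (auto simp: edge_blowup_def)
  from extend_face[OF \<sigma> x] show "\<exists>\<tau>\<in>faces X d. \<sigma> \<subseteq> \<tau>" by metis
  show "card \<sigma> \<le> d + 1" using \<sigma> by (auto simp: edge_blowup_def)
qed (use finite_X empty_in_X X_finite subset_in_X in auto)

lemma Z_pos: "Z > 0"
proof -
  from pure_X empty_in_X have "faces X d \<noteq> {}" by (auto simp: pure_complex_def)
  then show ?thesis unfolding total_weight_def
    using finite_faces wt_pos by (intro sum_pos) (auto simp: faces_def)
qed

lemma pmf_\<mu>: "pmf \<mu> \<tau> = (if \<tau> \<in> faces X d then real (wt \<tau>) / real Z else 0)"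
  unfolding blowup_pmf_def
proof (rule pmf_embed_pmf)
  let ?f = "\<lambda>\<tau>. if \<tau> \<in> faces X d then real (wt \<tau>) / real Z else 0"
  show "0 \<le> ?f x" for x by simp
  have "(\<integral>\<^sup>+ x. ennreal (?f x) \<partial>count_space UNIV) = (\<Sum>x\<in>faces X d. ennreal (?f x))"
    by (rule nn_integral_count_space'[OF finite_faces]) auto
  also have "\<dots> = ennreal (\<Sum>x\<in>faces X d. ?f x)"
    by (rule sum_ennreal) auto
  also have "(\<Sum>x\<in>faces X d. ?f x) = 1"
    using Z_pos by (simp add: total_weight_def flip: sum_divide_distrib of_nat_sum)
  finally show "(\<integral>\<^sup>+ x. ennreal (?f x) \<partial>count_space UNIV) = 1" by simp
qed

text \<open>If no direction fits, \<open>wt\<close> is an empty sum and both sides vanish. Thus the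
  formula also covers the non-edges of links.\<close>

lemma pmf_\<mu>_wt: "\<tau> \<subseteq> F2 n \<Longrightarrow> card \<tau> = d + 1 \<Longrightarrow> pmf \<mu> \<tau> = real (wt \<tau>) / real Z"
  unfolding pmf_\<mu> using wt_eq_0[of \<tau>] by (auto simp: faces_def edge_blowup_def)

lemma set_pmf_\<mu>: "set_pmf \<mu> = faces X d"
  using wt_pos Z_pos by (auto simp: set_pmf_eq pmf_\<mu> faces_def)

lemma weighted_X: "weighted_complex d X \<mu>"
  by (simp add: weighted_complex_def pure_X set_pmf_\<mu>)

end

section \<open>Connectivity and translation invariance\<close>

context blowup
begin

lemma vertices_link: "F \<in> X \<Longrightarrow> vertices (link X F) = {v. v \<notin> F \<and> insert v F \<in> X}"
proof -
  assume "F \<in> X"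
  have "{v} \<in> link X F \<longleftrightarrow> v \<notin> F \<and> insert v F \<in> X" for v
  proof
    assume "{v} \<in> link X F"
    then obtain T where T: "T \<in> X" "F \<subseteq> T" "{v} = T - F" by (auto simp: link_def)
    then have "T = insert v F" "v \<notin> F" by auto
    with T show "v \<notin> F \<and> insert v F \<in> X" by simp
  next
    assume "v \<notin> F \<and> insert v F \<in> X"
    then show "{v} \<in> link X F" by (auto simp: link_def intro!: exI[of _ "insert v F"])
  qed
  then show ?thesis by (simp add: vertices_def)
qed

lemma edge_in_link:
  assumes "u \<notin> F" "v \<notin> F" "u \<noteq> v" "insert u (insert v F) \<in> X"
  shows "{u, v} \<in> faces (link X F) 1"
proof -
  have "{u, v} = insert u (insert v F) - F" using assms by auto
  then have "{u, v} \<in> link X F" unfolding link_def using assms(4) by blast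
  then show ?thesis using assms(3) by (simp add: faces_def)
qed

text \<open>The fibre of a point of \<open>F\<close> is larger than \<open>F\<close>, and any of its
  points outside \<open>F\<close> is adjacent to all other vertices of the link.\<close>

lemma connected_link:
  assumes F: "F \<in> X" "F \<noteq> {}" "card F < d"
  shows "connected_complex (link X F)"
proof -
  obtain x where x: "x \<in> F" using F by auto
  then have xF2: "x \<in> F2 n" using F by (auto simp: edge_blowup_def)
  have finF: "finite F" using F X_finite by auto
  have "\<not> fib x \<subseteq> F"
  proof
    assume "fib x \<subseteq> F"
    then have "card (fib x) \<le> card F" using finF by (intro card_mono)
    then show False using card_fib[OF xF2] q F(3) by linarith
  qed
  then obtain z where z: "z \<in> fib x" "z \<notin> F" by auto
  have face: "insert u (insert z F) \<in> X" if u: "insert u F \<in> X" for u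
  proof -
    obtain i where i: "i \<in> {t..<n}" "const_off t i (insert u F)" "insert u F \<subseteq> F2 n"
      using u by (auto simp: edge_blowup_def)
    have "const_off t i (insert u F \<union> {z})"
      using i x z by (intro const_off_Un_fib[of _ _ x]) auto
    moreover have "z \<in> F2 n" using z fib_subset by auto
    moreover have "card (insert u (insert z F)) \<le> d + 1"
      using finF F(3) card_insert_le_m1[of "d+1" "insert z F" u] card_insert_le_m1[of d F z] by simp
    ultimately show ?thesis using i by (auto simp: edge_blowup_def insert_commute)
  qed
  let ?E = "{(a, b). {a, b} \<in> faces (link X F) 1}"
  have step: "(u, z) \<in> ?E\<^sup>* \<and> (z, u) \<in> ?E\<^sup>*" if "u \<in> vertices (link X F)" for u
  proof (cases "u = z")
    case False
    have "u \<notin> F" "insert u F \<in> X" using that by (auto simp: vertices_link F)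
    from edge_in_link[OF this(1) z(2) False face[OF this(2)]]
    have "(u, z) \<in> ?E" "(z, u) \<in> ?E" by (auto simp: insert_commute)
    then show ?thesis by auto
  qed auto
  show ?thesis
    unfolding connected_complex_def connected_graph_def one_skeleton_def fst_conv snd_conv
    using step by (meson rtrancl_trans)
qed

lemma pair_in_X: "u \<in> F2 n \<Longrightarrow> v \<in> F2 n \<Longrightarrow> i \<in> {t..<n} \<Longrightarrow> const_off t i {u, v} \<Longrightarrow> {u, v} \<in> X"
proof -
  have "card {u, v} \<le> 2" by (cases "u = v") auto
  then have "card {u, v} \<le> d + 1" using d by linarith
  then show "u \<in> F2 n \<Longrightarrow> v \<in> F2 n \<Longrightarrow> i \<in> {t..<n} \<Longrightarrow> const_off t i {u, v} \<Longrightarrow> ?thesis"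
    by (auto simp: edge_blowup_def)
qed

lemma vertices_X: "vertices X = F2 n"
proof -
  have "{v} \<in> X" if "v \<in> F2 n" for v
    using that n by (auto simp: edge_blowup_def const_off_def)
  then show ?thesis by (auto simp: vertices_def edge_blowup_def)
qed

lemma connected_X: "connected_complex X"
proof -
  let ?E = "{(a, b). {a, b} \<in> faces X 1}"
  have step: "(u, v) \<in> ?E\<^sup>*"
    if "u \<in> F2 n" "v \<in> F2 n" "i \<in> {t..<n}" "const_off t i {u, v}" for u v i
  proof (cases "u = v")
    case False
    then show ?thesis using pair_in_X[OF that] by (auto simp: faces_def)
  qed auto
  \<comment> \<open>Cube coordinates are corrected one at a time, from the highest on. In the base
    case both points lie in one fibre, where every direction fits; \<open>t\<close> is one of them
    because \<open>t < n\<close>.\<close>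
  have "(u, v) \<in> ?E\<^sup>*" if "u \<in> F2 n" "v \<in> F2 n" "\<forall>k\<ge>t + j. u k = v k" for u v j
    using that
  proof (induction j arbitrary: u)
    case 0
    then show ?case using n by (intro step[of u v t]) (auto simp: const_off_def)
  next
    case (Suc j)
    show ?case
    proof (cases "t + j < n")
      case True
      let ?u = "u(t + j := v (t + j))"
      have "?u \<in> F2 n" using Suc.prems by (auto simp: F2_def)
      moreover have "?u k = v k" if "k \<ge> t + j" for k
        using Suc.prems that by (cases "k = t + j") auto
      ultimately have "(?u, v) \<in> ?E\<^sup>*" using Suc by blast
      moreover have "(u, ?u) \<in> ?E\<^sup>*"
        using Suc.prems(1) \<open>?u \<in> F2 n\<close> True by (intro step[of u ?u "t + j"]) (auto simp: const_off_def)
      ultimately show ?thesis by (meson rtrancl_trans)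
    next
      case False
      then have "u k = v k" if "k \<ge> t + j" for k
        using Suc.prems that by (auto simp: F2_def)
      then show ?thesis using Suc by blast
    qed
  qed
  from this[of _ _ n] show ?thesis
    unfolding connected_complex_def connected_graph_def one_skeleton_def fst_conv snd_conv vertices_X
    by (auto simp: F2_def)
qed

lemma link_empty: "link X {} = X"
  by (simp add: link_def)

text \<open>The link has dimension \<open>d - card F\<close>, so \<open>card F < d\<close> singles
  out the links of positive dimension.\<close>

lemma connected_links: "F \<in> X \<Longrightarrow> card F < d \<Longrightarrow> connected_complex (link X F)"
  using connected_link connected_X by (cases "F = {}") (auto simp: link_empty)

lemma wt_translate:
  assumes x: "x \<in> F2 n" and \<tau>: "card \<tau> = d + 1"
  shows "wt ((+) x ` \<tau>) = wt \<tau>"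
proof -
  have fin: "finite \<tau>" using \<tau> card.infinite by fastforce
  have "om (card {z \<in> (+) x ` \<tau>. z i = 1}) = om (card {z \<in> \<tau>. z i = 1})" for i
  proof (cases "x i = 0")
    case True
    then have "{z \<in> (+) x ` \<tau>. z i = 1} = (+) x ` {z \<in> \<tau>. z i = 1}" by auto
    then show ?thesis by (simp add: card_image)
  next
    case False
    then have "x i = 1" by simp
    then have "{z \<in> (+) x ` \<tau>. z i = 1} = (+) x ` {z \<in> \<tau>. z i = 0}" by auto
    then have "card {z \<in> (+) x ` \<tau>. z i = 1} = card {z \<in> \<tau>. z i = 0}" by (simp add: card_image)
    also have "{z \<in> \<tau>. z i = 0} = \<tau> - {z \<in> \<tau>. z i = 1}" by auto
    also have "card \<dots> = d + 1 - card {z \<in> \<tau>. z i = 1}" using fin \<tau> by (subst card_Diff_subset) auto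
    finally have compl: "card {z \<in> (+) x ` \<tau>. z i = 1} = d + 1 - card {z \<in> \<tau>. z i = 1}" .
    have "card {z \<in> \<tau>. z i = 1} \<le> d + 1" using card_mono[OF fin, of "{z \<in> \<tau>. z i = 1}"] \<tau> by auto
    then show ?thesis unfolding compl by (rule split_weight_sym)
  qed
  then show ?thesis by (simp add: face_weight_def const_off_image_add)
qed

lemma translate_F2: "x \<in> F2 n \<Longrightarrow> (+) x ` \<tau> \<subseteq> F2 n \<longleftrightarrow> \<tau> \<subseteq> F2 n"
proof -
  have "(+) x ` A \<subseteq> F2 n" if "A \<subseteq> F2 n" "x \<in> F2 n" for A
    using that by (auto intro: F2_add)
  from this[of \<tau>] this[of "(+) x ` \<tau>"] show "x \<in> F2 n \<Longrightarrow> ?thesis" by (auto simp: vec_image_cancel)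
qed

lemma translate_faces: "x \<in> F2 n \<Longrightarrow> (+) x ` \<tau> \<in> faces X k \<longleftrightarrow> \<tau> \<in> faces X k"
  by (simp add: faces_def edge_blowup_def card_image const_off_image_add translate_F2)

lemma pmf_translate: "x \<in> F2 n \<Longrightarrow> pmf \<mu> ((+) x ` \<tau>) = pmf \<mu> \<tau>"
  using wt_translate[of x \<tau>] by (cases "\<tau> \<in> faces X d") (simp_all add: pmf_\<mu> translate_faces, simp add: faces_def)

lemma translation_invariant_\<mu>: "translation_invariant (F2 n) \<mu>"
  unfolding translation_invariant_def
proof (intro ballI pmf_eqI)
  fix x \<tau> assume x: "x \<in> F2 n"
  have "inj ((`) ((+) x))" by (rule inj_on_inverseI) (rule vec_image_cancel)
  \<comment> \<open>Translations are involutions, so \<open>\<tau>\<close> is the image of its own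
    translate.\<close>
  then have "pmf (map_pmf ((`) ((+) x)) \<mu>) ((+) x ` ((+) x ` \<tau>)) = pmf \<mu> ((+) x ` \<tau>)"
    by (rule pmf_map_inj')
  then show "pmf (map_pmf ((`) ((+) x)) \<mu>) \<tau> = pmf \<mu> \<tau>"
    by (simp add: vec_image_cancel pmf_translate x)
qed

section \<open>Generators, edge weights and the distribution on links\<close>

definition gens :: "(nat \<Rightarrow> bit) set" where
  "gens = {s \<in> F2 n. s \<noteq> 0 \<and> (\<exists>i\<in>{t..<n}. \<forall>k\<ge>t. k \<noteq> i \<longrightarrow> s k = 0)}"

lemma const_off_pair: "const_off t i {x, x + s} \<longleftrightarrow> (\<forall>k\<ge>t. k \<noteq> i \<longrightarrow> s k = 0)"
  by (auto simp: const_off_def)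

lemma one_skeleton_X: "one_skeleton X = Cay (F2 n) gens"
proof -
  have "faces X 1 = {{x, x + s} | x s. x \<in> F2 n \<and> s \<in> gens}"
  proof (intro equalityI subsetI)
    fix \<sigma> assume \<sigma>: "\<sigma> \<in> faces X 1"
    then obtain x y where xy: "\<sigma> = {x, y}" "x \<noteq> y" by (auto simp: faces_def card_2_iff numeral_2_eq_2[symmetric])
    define s where "s = x + y"
    have y: "y = x + s" by (simp add: s_def vec_add_cancel)
    have "s \<noteq> 0" using xy y by auto
    moreover have "x \<in> F2 n" "s \<in> F2 n" using \<sigma> F2_add by (auto simp: faces_def edge_blowup_def xy s_def)
    moreover have "\<exists>i\<in>{t..<n}. \<forall>k\<ge>t. k \<noteq> i \<longrightarrow> s k = 0"
      using \<sigma> by (simp add: faces_def edge_blowup_def xy(1) y const_off_pair)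
    ultimately have "x \<in> F2 n \<and> s \<in> gens" by (simp add: gens_def)
    then show "\<sigma> \<in> {{x, x + s} | x s. x \<in> F2 n \<and> s \<in> gens}" using xy y by blast
  next
    fix \<sigma> assume "\<sigma> \<in> {{x, x + s} | x s. x \<in> F2 n \<and> s \<in> gens}"
    then obtain x s where xs: "\<sigma> = {x, x + s}" "x \<in> F2 n" "s \<in> gens" by blast
    then obtain i where "i \<in> {t..<n}" "const_off t i {x, x + s}" by (auto simp: gens_def const_off_pair)
    moreover have "x + s \<in> F2 n" using xs by (auto simp: gens_def intro: F2_add)
    ultimately have "\<sigma> \<in> X" using xs pair_in_X by simp
    moreover have "x \<noteq> x + s" using xs(3) by (auto simp: gens_def)
    ultimately show "\<sigma> \<in> faces X 1" using xs(1) by (simp add: faces_def)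
  qed
  then show ?thesis by (simp add: one_skeleton_def Cay_def vertices_X)
qed

lemma induced_weight_translate:
  assumes x: "x \<in> F2 n"
  shows "induced_weight d X \<mu> k ((+) x ` \<sigma>) = induced_weight d X \<mu> k \<sigma>"
proof -
  have sub: "(+) x ` \<sigma> \<subseteq> (+) x ` \<tau> \<longleftrightarrow> \<sigma> \<subseteq> \<tau>" for \<tau>
    by (rule inj_image_subset_iff) simp
  have "(\<Sum>\<tau> | \<tau> \<in> faces X d \<and> (+) x ` \<sigma> \<subseteq> \<tau>. pmf \<mu> \<tau>) = (\<Sum>\<tau> | \<tau> \<in> faces X d \<and> \<sigma> \<subseteq> \<tau>. pmf \<mu> \<tau>)"
  proof (rule sum.reindex_bij_witness[of _ "(`) ((+) x)" "(`) ((+) x)"])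
    show "(+) x ` \<tau> \<in> {\<tau>. \<tau> \<in> faces X d \<and> \<sigma> \<subseteq> \<tau>}"
      if "\<tau> \<in> {\<tau>. \<tau> \<in> faces X d \<and> (+) x ` \<sigma> \<subseteq> \<tau>}" for \<tau>
      using that sub[of "(+) x ` \<tau>"] by (simp add: translate_faces x vec_image_cancel)
  qed (auto simp: vec_image_cancel translate_faces pmf_translate x sub)
  then show ?thesis by (simp add: induced_weight_def)
qed

lemma cayley_X: "cayley_complex (F2 n) gens d X \<mu>"
  unfolding cayley_complex_def
proof (intro conjI ballI)
  fix s
  \<comment> \<open>The edge \<open>{x, x + s}\<close> is the translate by \<open>x\<close> of
    \<open>{0, s}\<close>, whose weight is the constant.\<close>
  show "\<exists>c. \<forall>x\<in>F2 n. induced_weight d X \<mu> 1 {x, x + s} = c"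
    using induced_weight_translate[of _ 1 "{0, s}"] by (intro exI[of _ "induced_weight d X \<mu> 1 {0, s}"]) simp
qed (auto simp: weighted_X one_skeleton_X, auto simp: gens_def)

text \<open>Conditioning multiplies all weights by one factor, and the walk does not see the scale;
  so the value of \<open>\<kappa>\<close> stays hidden.\<close>

lemma pmf_link:
  assumes F: "F \<in> X"
  obtains \<kappa> where "\<kappa> > 0"
    "\<And>u v. u \<notin> F \<Longrightarrow> v \<notin> F \<Longrightarrow> pmf (link_pmf \<mu> F) {u, v} = \<kappa> * pmf \<mu> (F \<union> {u, v})"
proof -
  let ?S = "{T. F \<subseteq> T}"
  have ne: "set_pmf \<mu> \<inter> ?S \<noteq> {}"
    using pure_X F by (auto simp: set_pmf_\<mu> pure_complex_def)
  then have pos: "measure \<mu> ?S > 0"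
    by (metis IntE disjoint_iff measure_pmf_posI)
  have "pmf (link_pmf \<mu> F) {u, v} = 1 / measure \<mu> ?S * pmf \<mu> (F \<union> {u, v})" if uv: "u \<notin> F" "v \<notin> F" for u v
  proof -
    have inj: "inj_on (\<lambda>T. T - F) (set_pmf (cond_pmf \<mu> ?S))"
      using ne by (auto simp: inj_on_def)
    have uv_eq: "{u, v} = (F \<union> {u, v}) - F" using uv by auto
    show ?thesis
    proof (cases "F \<union> {u, v} \<in> set_pmf \<mu>")
      case True
      then have "F \<union> {u, v} \<in> set_pmf (cond_pmf \<mu> ?S)" using ne by auto
      from pmf_map_inj[OF inj this] show ?thesis
        unfolding uv_eq[symmetric] link_pmf_def by (auto simp: pmf_cond ne)
    next
      case False
      have "{u, v} \<notin> (\<lambda>T. T - F) ` set_pmf (cond_pmf \<mu> ?S)"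
      proof
        assume "{u, v} \<in> (\<lambda>T. T - F) ` set_pmf (cond_pmf \<mu> ?S)"
        then obtain T where T: "{u, v} = T - F" "T \<in> set_pmf \<mu>" "F \<subseteq> T" using ne by auto
        then have "T = F \<union> {u, v}" by auto
        with T False show False by simp
      qed
      then show ?thesis
        using False by (simp add: link_pmf_def pmf_map_outside pmf_eq_0_set_pmf)
    qed
  qed
  with that[of "1 / measure \<mu> ?S"] pos show ?thesis by simp
qed

end

section \<open>Codimension-two links\<close>

text \<open>Odds of staying in the link of a face within a fibre. By the first equation, staying in
  the centre and leaving it are as \<open>d - 1\<close> to 1, after division by the common factor
  \<open>n - t\<close>; by the second, staying in a petal and leaving it are as 1 to
  \<open>d - 1\<close>.\<close>

lemma split_weight_one_fibre:
  assumes "d \<ge> 2" "d < q"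
  shows "(q - d) * split_weight d q 0 = (d - 1) * (q * split_weight d q d)"
    and "(d - 1) * ((q - 1) * split_weight d q (d - 1)) = (q - (d - 1)) * split_weight d q d"
proof -
  \<comment> \<open>Writing \<open>d\<close> and \<open>q\<close> as successors removes the
    truncated subtractions, so that the factorials unfold.\<close>
  obtain e where e: "d = Suc (Suc e)" using assms(1) by (metis add_2_eq_Suc le_Suc_ex)
  obtain r where r: "q = Suc (d + r)" using assms(2) less_iff_Suc_add by auto
  show "(q - d) * split_weight d q 0 = (d - 1) * (q * split_weight d q d)"
    unfolding r e by (simp add: split_weight_def mult.assoc mult.left_commute mult.commute eval_nat_numeral del: mult_Suc mult_Suc_right)
  show "(d - 1) * ((q - 1) * split_weight d q (d - 1)) = (q - (d - 1)) * split_weight d q d"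
    unfolding r e by (simp add: split_weight_def mult.assoc mult.left_commute mult.commute eval_nat_numeral del: mult_Suc mult_Suc_right)
qed

text \<open>Up to the falling factorials these are A_(j+2) / A_(j+1) = (j+1) / l and A_j / A_(j+1) =
  (l+1) / j. They are the odds of staying against leaving in the fibre with \<open>j\<close> points
  of the face, and in the one with \<open>l\<close> points.\<close>

lemma split_weight_two_fibres:
  assumes "j \<ge> 1" "l \<ge> 1" "d = j + l + 1" "d < q"
  shows "l * ((q - j - 1) * split_weight d q (j + 2)) = (j + 1) * ((q - l) * split_weight d q (j + 1))"
    and "j * ((q - l - 1) * split_weight d q j) = (l + 1) * ((q - j) * split_weight d q (j + 1))"
proof -
  obtain a where a: "j = Suc a" using assms(1) by (metis One_nat_def Suc_le_D)
  obtain b where b: "l = Suc b" using assms(2) by (metis One_nat_def Suc_le_D)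
  obtain r where r: "q = Suc (d + r)" using assms(4) less_iff_Suc_add by auto
  have e: "d = Suc (Suc (Suc (a + b)))" using assms(3) a b by simp
  show "l * ((q - j - 1) * split_weight d q (j + 2)) = (j + 1) * ((q - l) * split_weight d q (j + 1))"
    unfolding r e a b by (simp add: split_weight_def mult.assoc mult.left_commute mult.commute eval_nat_numeral del: mult_Suc mult_Suc_right)
  show "j * ((q - l - 1) * split_weight d q j) = (l + 1) * ((q - j) * split_weight d q (j + 1))"
    unfolding r e a b by (simp add: split_weight_def mult.assoc mult.left_commute mult.commute eval_nat_numeral del: mult_Suc mult_Suc_right)
qed

context blowup
begin

lemma link_weights:
  assumes F: "F \<in> X" "card F = d - 1"
  obtains \<kappa> :: real where "\<kappa> > 0"
    "\<And>u v. u \<in> F2 n \<Longrightarrow> v \<in> F2 n \<Longrightarrow> u \<notin> F \<Longrightarrow> v \<notin> F \<Longrightarrow>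
       pmf (link_pmf \<mu> F) {u, v} = (if u = v then 0 else \<kappa> * real (wt (F \<union> {u, v})))"
proof -
  obtain \<kappa> where \<kappa>: "\<kappa> > 0"
    "\<And>u v. u \<notin> F \<Longrightarrow> v \<notin> F \<Longrightarrow> pmf (link_pmf \<mu> F) {u, v} = \<kappa> * pmf \<mu> (F \<union> {u, v})"
    using pmf_link[OF F(1)] by metis
  have finF: "finite F" using F X_finite by auto
  have FF: "F \<subseteq> F2 n" using F by (auto simp: edge_blowup_def)
  show ?thesis
  proof (rule that[of "\<kappa> / real Z"])
    show "\<kappa> / real Z > 0" using \<kappa> Z_pos by simp
    fix u v assume uv: "u \<in> F2 n" "v \<in> F2 n" "u \<notin> F" "v \<notin> F"
    show "pmf (link_pmf \<mu> F) {u, v} = (if u = v then 0 else \<kappa> / real Z * real (wt (F \<union> {u, v})))"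
    proof (cases "u = v")
      case True
      then have "card (F \<union> {u, v}) = d" using F uv finF d by simp
      then show ?thesis using True uv \<kappa>(2)[of v v] by (simp add: pmf_\<mu> faces_def)
    next
      case False
      then have "card (F \<union> {u, v}) = d + 1" using F uv finF d by simp
      then show ?thesis using False uv \<kappa>(2) pmf_\<mu>_wt[of "F \<union> {u, v}"] FF by simp
    qed
  qed
qed

lemma link_walk_norm_one_fibre:
  assumes F: "F \<in> X" "card F = d - 1" and x: "x \<in> F" "F \<subseteq> fib x"
  shows "link_walk_norm X \<mu> F \<le> 1 / real d"
proof -
  define Q :: nat where "Q = 2 ^ t"
  have Q: "2 * d \<le> Q" using q by (simp add: Q_def)
  have finF: "finite F" using F X_finite by auto
  have FF: "F \<subseteq> F2 n" using F by (auto simp: edge_blowup_def)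
  have xF2: "x \<in> F2 n" using x FF by auto
  define C where "C = fib x - F"
  define B where "B i = fib (x + basis_vec i)" for i
  have disjCB: "fib x \<inter> B i = {}" if "i \<in> {t..<n}" for i using that fib_disjoint by (auto simp: B_def)
  have V: "vertices (link X F) = C \<union> (\<Union>i\<in>{t..<n}. B i)"
    unfolding vertices_link[OF F(1)]
  proof (intro equalityI subsetI)
    fix v assume "v \<in> {v. v \<notin> F \<and> insert v F \<in> X}"
    then obtain i where i: "i \<in> {t..<n}" "const_off t i (insert v F)" "insert v F \<subseteq> F2 n" "v \<notin> F"
      by (auto simp: edge_blowup_def)
    then have "v \<in> fib x \<union> fib (x + basis_vec i)"
      using const_off_subset_fibs[OF i(2,3), of x] x by auto
    then show "v \<in> C \<union> (\<Union>i\<in>{t..<n}. B i)" using i by (auto simp: C_def B_def)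
  next
    fix v assume v: "v \<in> C \<union> (\<Union>i\<in>{t..<n}. B i)"
    then obtain i where i: "i \<in> {t..<n}" "v \<in> fib x \<union> fib (x + basis_vec i)"
      using n by (auto simp: C_def B_def)
    have "v \<notin> F"
    proof (cases "v \<in> C")
      case False
      then obtain k where "k \<in> {t..<n}" "v \<in> B k" using v by auto
      then have "v \<notin> fib x" using disjCB[of k] by auto
      then show ?thesis using x(2) by auto
    qed (simp add: C_def)
    moreover have "const_off t i (insert v F)"
      using i x by (intro const_off_mono[OF const_off_fibs[of i x]]) auto
    moreover have "v \<in> F2 n" using i fib_subset by auto
    moreover have "card (insert v F) \<le> d + 1" using F finF \<open>v \<notin> F\<close> by simp
    ultimately show "v \<in> {v. v \<notin> F \<and> insert v F \<in> X}"
      using i FF by (auto simp: edge_blowup_def)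
  qed
  obtain \<kappa> where \<kappa>: "\<kappa> > 0" and w:
    "\<And>u v. u \<in> F2 n \<Longrightarrow> v \<in> F2 n \<Longrightarrow> u \<notin> F \<Longrightarrow> v \<notin> F \<Longrightarrow>
       pmf (link_pmf \<mu> F) {u, v} = (if u = v then 0 else \<kappa> * real (wt (F \<union> {u, v})))"
    using link_weights[OF F] by metis
  have CF: "u \<in> F2 n" "u \<notin> F" if "u \<in> C" for u using that fib_subset by (auto simp: C_def)
  have BF: "u \<in> F2 n" "u \<notin> F" if "u \<in> B i" "i \<in> {t..<n}" for u i
  proof -
    show "u \<in> F2 n" using that(1) fib_subset by (auto simp: B_def)
    have "u \<notin> fib x" using disjCB[OF that(2)] that(1) by auto
    then show "u \<notin> F" using x(2) by auto
  qed
  have cardC: "card C = Q - (d - 1)"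
    unfolding C_def using x F finF card_fib[OF xF2] by (simp add: card_Diff_subset Q_def)
  have cardB: "card (B i) = Q" if "i \<in> {t..<n}" for i
    unfolding B_def Q_def using that xF2 by (intro card_fib F2_add basis_vec_F2)
  have CB: "pmf (link_pmf \<mu> F) {u, v} = \<kappa> * real (om d)" if u: "u \<in> C" and v: "i \<in> {t..<n}" "v \<in> B i" for u v i
  proof -
    have "wt (insert u F \<union> {v}) = om (card (insert u F))"
      using u v x F finF d by (intro wt_two_fibres[of i _ x]) (auto simp: C_def B_def)
    moreover have "card (insert u F) = d" using CF[OF u] F finF d by simp
    moreover have "u \<noteq> v" using u v disjCB by (auto simp: C_def)
    ultimately show ?thesis using w[of u v] CF[OF u] BF[OF v(2,1)] by (simp add: insert_commute)
  qed
  \<comment> \<open>Two new points in the fibre of \<open>x\<close> give a face within it, one gives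
    the split (d, 1), and none gives (d-1, 2): hence \<open>om 0\<close>, \<open>om d\<close> and
    \<open>om (d - 1)\<close>.\<close>
  have "walk_norm (C \<union> (\<Union>i\<in>{t..<n}. B i)) (\<lambda>u v. pmf (link_pmf \<mu> F) {u, v}) \<le> 1 / real d"
  proof (rule walk_norm_star_of_cliques[where C = C and I = "{t..<n}" and B = B
      and \<alpha> = "\<kappa> * real ((n - t) * om 0)" and \<beta> = "\<kappa> * real (om d)" and \<gamma> = "\<kappa> * real (om (d - 1))"
      and b = "real Q" and c = "real Q - (real d - 1)" and pC = "(real d - 1) / real d" and pB = "1 / real d"])
    show "finite C" "\<And>i. i \<in> {t..<n} \<Longrightarrow> finite (B i)" "finite {t..<n}"
      using finite_fib by (auto simp: C_def B_def)
    show "{t..<n} \<noteq> {}" using n by simp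
    show "real (card C) = real Q - (real d - 1)" using cardC Q d by (simp add: of_nat_diff)
    show "real (card (B i)) = real Q" if "i \<in> {t..<n}" for i using cardB that by simp
    show "1 < real Q - (real d - 1)" "1 < real Q" using Q d by linarith+
    show "disjoint_family_on B {t..<n}"
      using fib_basis_vec_disjoint by (auto simp: disjoint_family_on_def B_def)
    show "C \<inter> B i = {}" if "i \<in> {t..<n}" for i using disjCB that by (auto simp: C_def)
    show "pmf (link_pmf \<mu> F) {u, v} = (if u = v then 0 else \<kappa> * real ((n - t) * om 0))"
      if "u \<in> C" "v \<in> C" for u v
    proof (cases "u = v")
      case False
      have "wt (F \<union> {u, v}) = (n - t) * om 0"
        using that False x F finF d CF[OF that(1)] CF[OF that(2)]
        by (intro wt_one_fibre[of _ x]) (auto simp: C_def)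
      then show ?thesis using w CF that False by simp
    qed (use w[of u v] CF that in auto)
    show "pmf (link_pmf \<mu> F) {u, v} = \<kappa> * real (om d)" if "u \<in> C" "i \<in> {t..<n}" "v \<in> B i" for u i v
      using CB that by simp
    show "pmf (link_pmf \<mu> F) {v, u} = \<kappa> * real (om d)" if "u \<in> C" "i \<in> {t..<n}" "v \<in> B i" for u i v
      using CB[OF that] by (simp add: insert_commute)
    show "pmf (link_pmf \<mu> F) {u, v} = (if u = v then 0 else \<kappa> * real (om (d - 1)))"
      if "i \<in> {t..<n}" "u \<in> B i" "v \<in> B i" for u v i
    proof (cases "u = v")
      case False
      have "wt (F \<union> {u, v}) = om (card F)"
        using that False x F finF d by (intro wt_two_fibres[of i _ x]) (auto simp: B_def)
      then show ?thesis using w[of u v] BF that False F by simp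
    qed (use w[of u v] BF[OF _ that(1)] that in auto)
    show "pmf (link_pmf \<mu> F) {u, v} = 0"
      if ij: "i \<in> {t..<n}" "j \<in> {t..<n}" "i \<noteq> j" "u \<in> B i" "v \<in> B j" for u v i j
    proof -
      \<comment> \<open>Relative to \<open>x\<close>, the point \<open>u\<close> forces direction
        \<open>i\<close> and \<open>v\<close> forces direction \<open>j\<close>, so no edge joins
        two petals.\<close>
      have vals: "u i \<noteq> x i" "u j = x j" "v j \<noteq> x j" "v i = x i"
        using ij by (auto simp: B_def fib_basis_vec_iff)
      have "\<not> const_off t k (F \<union> {u, v})" if "k \<in> {t..<n}" for k
      proof
        assume "const_off t k (F \<union> {u, v})"
        then have "\<forall>l\<ge>t. l \<noteq> k \<longrightarrow> u l = x l" "\<forall>l\<ge>t. l \<noteq> k \<longrightarrow> v l = x l"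
          using x(1) unfolding const_off_def by blast+
        with vals ij show False by (metis atLeastLessThan_iff)
      qed
      then have "wt (F \<union> {u, v}) = 0" by (rule wt_eq_0)
      then show ?thesis using w[of u v] BF[OF ij(4,1)] BF[OF ij(5,2)] by simp
    qed
    show "0 \<le> \<kappa> * real ((n - t) * om 0)" "0 < \<kappa> * real (om d)" "0 \<le> \<kappa> * real (om (d - 1))" "0 \<le> 1 / real d"
      using \<kappa> split_weight_pos[OF d] by auto
    have dQ: "d < Q" using Q d by linarith
    have e1: "(real Q - real d) * real (om 0) = (real d - 1) * (real Q * real (om d))"
      using arg_cong[OF split_weight_one_fibre(1)[OF d dQ], of real] d dQ by (simp add: of_nat_diff Q_def)
    have e2: "(real d - 1) * ((real Q - 1) * real (om (d - 1))) = (real Q - (real d - 1)) * real (om d)"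
      using arg_cong[OF split_weight_one_fibre(2)[OF d dQ], of real] d dQ by (simp add: of_nat_diff Q_def)
    have dpos: "real d > 0" using d by simp
    show "(real Q - (real d - 1) - 1) * (\<kappa> * real ((n - t) * om 0)) =
        (real d - 1) / real d * ((real Q - (real d - 1) - 1) * (\<kappa> * real ((n - t) * om 0)) +
          real (card {t..<n}) * real Q * (\<kappa> * real (om d)))"
    proof -
      have "(real Q - (real d - 1) - 1) * (\<kappa> * real ((n - t) * om 0)) =
          \<kappa> * real (n - t) * ((real Q - real d) * real (om 0))" by simp
      also have "\<dots> = \<kappa> * real (n - t) * ((real d - 1) * (real Q * real (om d)))" by (simp only: e1)
      finally have 1: "(real Q - (real d - 1) - 1) * (\<kappa> * real ((n - t) * om 0)) =
          \<kappa> * real (n - t) * ((real d - 1) * (real Q * real (om d)))" .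
      show ?thesis unfolding 1 using dpos by (simp add: divide_simps) (simp add: algebra_simps)
    qed
    show "(real Q - 1) * (\<kappa> * real (om (d - 1))) = 1 / real d *
        ((real Q - (real d - 1)) * (\<kappa> * real (om d)) + (real Q - 1) * (\<kappa> * real (om (d - 1))))"
    proof -
      have "(real Q - (real d - 1)) * (\<kappa> * real (om d)) = \<kappa> * ((real Q - (real d - 1)) * real (om d))" by simp
      also have "\<dots> = \<kappa> * ((real d - 1) * ((real Q - 1) * real (om (d - 1))))" by (simp only: e2)
      finally have 2: "(real Q - (real d - 1)) * (\<kappa> * real (om d)) =
         \<kappa> * ((real d - 1) * ((real Q - 1) * real (om (d - 1))))" .
      show ?thesis unfolding 2 using dpos by (simp add: divide_simps) (simp add: algebra_simps)
    qed
    have "real (2 * d) \<le> real Q" using Q by (simp only: of_nat_le_iff)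
    then show "(real d - 1) / real d \<le> 1 / real d * (real Q - (real d - 1) - 1)"
      "1 / real d \<le> 1 / real d * (real Q - 1)"
      using dpos d by (auto simp: divide_simps)
    \<comment> \<open>\<open>pB\<close> has exactly the largest value allowed when there are several
      petals.\<close>
    show "card {t..<n} = 1 \<or> 1 / real d \<le> 1 / real d" by simp
    show "\<bar>(real d - 1) / real d + 1 / real d - 1\<bar> \<le> 1 / real d"
      using dpos by (simp add: divide_simps)
  qed
  then show ?thesis by (simp add: link_walk_norm_def V)
qed

text \<open>The face already meets both fibres, which fixes the direction. With one petal the
  condition \<open>petals\<close> holds although \<open>pB\<close> exceeds 1/d, and the two-state
  eigenvalue (j+1)/d + (l+1)/d - 1 is exactly 1/d because d = j + l + 1.\<close>

lemma link_walk_norm_two_fibres: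
  assumes F: "F \<in> X" "card F = d - 1" and x: "x \<in> F" and i: "i \<in> {t..<n}"
    and sub: "F \<subseteq> fib x \<union> fib (x + basis_vec i)" and y: "y \<in> F" "y \<in> fib (x + basis_vec i)"
  shows "link_walk_norm X \<mu> F \<le> 1 / real d"
proof -
  define Q :: nat where "Q = 2 ^ t"
  have Q: "2 * d \<le> Q" using q by (simp add: Q_def)
  have finF: "finite F" using F X_finite by auto
  have FF: "F \<subseteq> F2 n" using F by (auto simp: edge_blowup_def)
  have xF2: "x \<in> F2 n" using x FF by auto
  define F1 where "F1 = F \<inter> fib x"
  define F2' where "F2' = F \<inter> fib (x + basis_vec i)"
  define j where "j = card F1"
  define l where "l = card F2'"
  have disj: "fib x \<inter> fib (x + basis_vec i) = {}" using i fib_disjoint by auto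
  have F12: "F = F1 \<union> F2'" using sub by (auto simp: F1_def F2'_def)
  have fin12: "finite F1" "finite F2'" using finF by (auto simp: F1_def F2'_def)
  have ne: "F1 \<noteq> {}" "F2' \<noteq> {}" using x y fib_self[OF xF2] by (auto simp: F1_def F2'_def)
  have "card F = j + l" unfolding F12 j_def l_def using fin12 disj
    by (intro card_Un_disjoint) (auto simp: F1_def F2'_def)
  then have jl: "d = j + l + 1" using F d by simp
  have j1: "j \<ge> 1" "l \<ge> 1" using ne fin12 by (auto simp: j_def l_def Suc_le_eq card_gt_0_iff)
  define C where "C = fib x - F"
  \<comment> \<open>A family that ignores its index, to serve as the single petal.\<close>
  define B where "B (k::nat) = fib (x + basis_vec i) - F" for k
  have C': "C = fib x - F1" and B': "B k = fib (x + basis_vec i) - F2'" for k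
    by (auto simp: C_def B_def F1_def F2'_def)
  have V: "vertices (link X F) = C \<union> (\<Union>k\<in>{i}. B k)"
    unfolding vertices_link[OF F(1)]
  proof (intro equalityI subsetI)
    fix v assume "v \<in> {v. v \<notin> F \<and> insert v F \<in> X}"
    then obtain k where k: "k \<in> {t..<n}" "const_off t k (insert v F)" "insert v F \<subseteq> F2 n" "v \<notin> F"
      by (auto simp: edge_blowup_def)
    have "k = i"
    proof (rule ccontr)
      assume "k \<noteq> i"
      then have "x i = y i" using k(2) x y i by (auto simp: const_off_def)
      then show False using y i by (auto simp: fib_basis_vec_iff)
    qed
    then have "v \<in> fib x \<union> fib (x + basis_vec i)"
      using const_off_subset_fibs[OF k(2,3), of x] x k(1) by auto
    then show "v \<in> C \<union> (\<Union>k\<in>{i}. B k)" using k by (auto simp: C_def B_def)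
  next
    fix v assume v: "v \<in> C \<union> (\<Union>k\<in>{i}. B k)"
    then have v': "v \<in> fib x \<union> fib (x + basis_vec i)" "v \<notin> F" by (auto simp: C_def B_def)
    moreover have "const_off t i (insert v F)"
      using i sub v' by (intro const_off_mono[OF const_off_fibs[of i x]]) auto
    moreover have "v \<in> F2 n" using v' fib_subset by auto
    moreover have "card (insert v F) \<le> d + 1" using F finF \<open>v \<notin> F\<close> by simp
    ultimately show "v \<in> {v. v \<notin> F \<and> insert v F \<in> X}"
      using i FF by (auto simp: edge_blowup_def)
  qed
  obtain \<kappa> where \<kappa>: "\<kappa> > 0" and w:
    "\<And>u v. u \<in> F2 n \<Longrightarrow> v \<in> F2 n \<Longrightarrow> u \<notin> F \<Longrightarrow> v \<notin> F \<Longrightarrow>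
       pmf (link_pmf \<mu> F) {u, v} = (if u = v then 0 else \<kappa> * real (wt (F \<union> {u, v})))"
    using link_weights[OF F] by metis
  have CF: "u \<in> F2 n" "u \<notin> F" "u \<notin> F1" if "u \<in> C" for u using that fib_subset by (auto simp: C_def F1_def)
  have BF: "u \<in> F2 n" "u \<notin> F" "u \<notin> F2'" if "u \<in> B k" for u k
    using that fib_subset by (auto simp: B_def F2'_def)
  have wt12: "wt (A1 \<union> A2) = om (card A1)"
    if "A1 \<subseteq> fib x" "F1 \<subseteq> A1" "A2 \<subseteq> fib (x + basis_vec i)" "F2' \<subseteq> A2" "card A1 + card A2 = d + 1" for A1 A2
    using that ne i by (intro wt_two_fibres[of i _ x]) auto
  have CB: "pmf (link_pmf \<mu> F) {u, v} = \<kappa> * real (om (j + 1))" if u: "u \<in> C" and v: "v \<in> B k" for u v k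
  proof -
    have c: "card (insert u F1) = j + 1" "card (insert v F2') = l + 1"
      using CF[OF u] BF[OF v] fin12 by (auto simp: j_def l_def)
    then have "wt (insert u F1 \<union> insert v F2') = om (j + 1)"
      using u v jl by (subst wt12) (auto simp: C_def B_def F1_def F2'_def)
    moreover have "insert u F1 \<union> insert v F2' = F \<union> {u, v}" using F12 by auto
    moreover have "u \<noteq> v" using u v disj by (auto simp: C_def B_def)
    ultimately show ?thesis using w[of u v] CF[OF u] BF[OF v] by simp
  qed
  have "walk_norm (C \<union> (\<Union>k\<in>{i}. B k)) (\<lambda>u v. pmf (link_pmf \<mu> F) {u, v}) \<le> 1 / real d"
  proof (rule walk_norm_star_of_cliques[where C = C and I = "{i}" and B = B
      and \<alpha> = "\<kappa> * real (om (j + 2))" and \<beta> = "\<kappa> * real (om (j + 1))" and \<gamma> = "\<kappa> * real (om j)"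
      and b = "real Q - real l" and c = "real Q - real j"
      and pC = "(real j + 1) / real d" and pB = "(real l + 1) / real d"])
    have lQ: "l \<le> Q" "j \<le> Q" using jl Q by linarith+
    show "finite C" "\<And>k. k \<in> {i} \<Longrightarrow> finite (B k)" "finite {i}" "{i} \<noteq> {}"
      using finite_fib by (auto simp: C_def B_def)
    show "real (card C) = real Q - real j"
      unfolding C' using fin12 lQ card_fib[OF xF2] by (subst card_Diff_subset) (auto simp: F1_def of_nat_diff Q_def j_def)
    show "real (card (B k)) = real Q - real l" for k
      unfolding B' using fin12 lQ card_fib[OF F2_add[OF xF2 basis_vec_F2[OF i]]]
      by (subst card_Diff_subset) (auto simp: F2'_def of_nat_diff Q_def l_def)
    show "1 < real Q - real j" "1 < real Q - real l" using Q jl by linarith+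
    show "disjoint_family_on B {i}" by (auto simp: disjoint_family_on_def)
    show "C \<inter> B k = {}" for k using disj by (auto simp: C_def B_def)
    show "pmf (link_pmf \<mu> F) {u, v} = (if u = v then 0 else \<kappa> * real (om (j + 2)))"
      if uv: "u \<in> C" "v \<in> C" for u v
    proof (cases "u = v")
      case False
      have "card (F1 \<union> {u, v}) = j + 2"
        using CF[OF uv(1)] CF[OF uv(2)] fin12 False by (simp add: j_def)
      moreover from this have "wt ((F1 \<union> {u, v}) \<union> F2') = om (card (F1 \<union> {u, v}))"
        using uv jl by (intro wt12) (auto simp: C_def F1_def F2'_def l_def)
      moreover have "(F1 \<union> {u, v}) \<union> F2' = F \<union> {u, v}" using F12 by auto
      ultimately show ?thesis using w CF uv False by simp
    qed (use w[of u v] CF that in auto)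
    show "pmf (link_pmf \<mu> F) {u, v} = \<kappa> * real (om (j + 1))" if "u \<in> C" "v \<in> B k" for u k v
      using CB that by simp
    show "pmf (link_pmf \<mu> F) {v, u} = \<kappa> * real (om (j + 1))" if "u \<in> C" "v \<in> B k" for u k v
      using CB[OF that] by (simp add: insert_commute)
    show "pmf (link_pmf \<mu> F) {u, v} = (if u = v then 0 else \<kappa> * real (om j))"
      if uv: "u \<in> B k" "v \<in> B k" for u v k
    proof (cases "u = v")
      case False
      have "card (F2' \<union> {u, v}) = l + 2"
        using BF[OF uv(1)] BF[OF uv(2)] fin12 False by (simp add: l_def)
      then have "wt (F1 \<union> (F2' \<union> {u, v})) = om (card F1)"
        using uv jl by (intro wt12) (auto simp: B_def F1_def F2'_def j_def)
      moreover have "F1 \<union> (F2' \<union> {u, v}) = F \<union> {u, v}" using F12 by auto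
      ultimately show ?thesis using w[of u v] BF uv False by (simp add: j_def)
    qed (use w[of u v] BF that in auto)
    show "pmf (link_pmf \<mu> F) {u, v} = 0" if "k \<in> {i}" "k' \<in> {i}" "k \<noteq> k'" for u v k k'
      using that by simp
    show "0 \<le> \<kappa> * real (om (j + 2))" "0 < \<kappa> * real (om (j + 1))" "0 \<le> \<kappa> * real (om j)" "0 \<le> 1 / real d"
      using \<kappa> split_weight_pos[OF d] by auto
    have dQ: "d < Q" using Q d by linarith
    have lt: "j + 1 \<le> Q" "l + 1 \<le> Q" using dQ jl by linarith+
    have coeffs: "real (Q - j - 1) = real Q - real j - 1" "real (Q - l) = real Q - real l"
      "real (Q - l - 1) = real Q - real l - 1" "real (Q - j) = real Q - real j"
      "real (j + 1) = real j + 1" "real (l + 1) = real l + 1"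
      using lt by (simp_all add: of_nat_diff)
    have e1: "real l * ((real Q - real j - 1) * real (om (j + 2))) = (real j + 1) * ((real Q - real l) * real (om (j + 1)))"
      using arg_cong[OF split_weight_two_fibres(1)[OF j1 jl dQ], of real]
      unfolding of_nat_mult coeffs by (simp only: Q_def)
    have e2: "real j * ((real Q - real l - 1) * real (om j)) = (real l + 1) * ((real Q - real j) * real (om (j + 1)))"
      using arg_cong[OF split_weight_two_fibres(2)[OF j1 jl dQ], of real]
      unfolding of_nat_mult coeffs by (simp only: Q_def)
    have dpos: "real d > 0" and dr: "real d = real j + real l + 1" using d jl by auto
    show "(real Q - real j - 1) * (\<kappa> * real (om (j + 2))) = (real j + 1) / real d *
        ((real Q - real j - 1) * (\<kappa> * real (om (j + 2))) +
          real (card {i}) * (real Q - real l) * (\<kappa> * real (om (j + 1))))"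
    proof -
      have "(real j + 1) * ((real Q - real l) * (\<kappa> * real (om (j + 1)))) =
          \<kappa> * ((real j + 1) * ((real Q - real l) * real (om (j + 1))))" by simp
      also have "\<dots> = \<kappa> * (real l * ((real Q - real j - 1) * real (om (j + 2))))" by (simp only: e1)
      finally have 1: "(real j + 1) * ((real Q - real l) * (\<kappa> * real (om (j + 1)))) =
         real l * ((real Q - real j - 1) * (\<kappa> * real (om (j + 2))))" by simp
      have "(real j + 1) * ((real Q - real j - 1) * (\<kappa> * real (om (j + 2))) +
          real (card {i}) * (real Q - real l) * (\<kappa> * real (om (j + 1)))) =
          real d * ((real Q - real j - 1) * (\<kappa> * real (om (j + 2))))"
        using 1 by (simp add: dr distrib_left distrib_right)
      then show ?thesis using dpos by (simp add: field_simps)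
    qed
    show "(real Q - real l - 1) * (\<kappa> * real (om j)) = (real l + 1) / real d *
        ((real Q - real j) * (\<kappa> * real (om (j + 1))) + (real Q - real l - 1) * (\<kappa> * real (om j)))"
    proof -
      have "(real l + 1) * ((real Q - real j) * (\<kappa> * real (om (j + 1)))) =
          \<kappa> * ((real l + 1) * ((real Q - real j) * real (om (j + 1))))" by simp
      also have "\<dots> = \<kappa> * (real j * ((real Q - real l - 1) * real (om j)))" by (simp only: e2)
      finally have 1: "(real l + 1) * ((real Q - real j) * (\<kappa> * real (om (j + 1)))) =
         real j * ((real Q - real l - 1) * (\<kappa> * real (om j)))" by simp
      have "(real l + 1) * ((real Q - real j) * (\<kappa> * real (om (j + 1))) +
          (real Q - real l - 1) * (\<kappa> * real (om j))) =
          real d * ((real Q - real l - 1) * (\<kappa> * real (om j)))"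
        using 1 by (simp add: dr distrib_left distrib_right)
      then show ?thesis using dpos by (simp add: field_simps)
    qed
    have "real (2 * d) \<le> real Q" using Q by (simp only: of_nat_le_iff)
    then show "(real j + 1) / real d \<le> 1 / real d * (real Q - real j - 1)"
      "(real l + 1) / real d \<le> 1 / real d * (real Q - real l - 1)"
      using dpos dr j1 by (auto simp: divide_simps)
    show "card {i} = 1 \<or> (real l + 1) / real d \<le> 1 / real d" by simp
    have "(real j + 1) / real d + (real l + 1) / real d - 1 = (real j + 1 + (real l + 1) - real d) / real d"
      using dpos by (simp add: diff_divide_distrib add_divide_distrib)
    also have "real j + 1 + (real l + 1) - real d = 1" using dr by simp
    finally have "(real j + 1) / real d + (real l + 1) / real d - 1 = 1 / real d" .
    then show "\<bar>(real j + 1) / real d + (real l + 1) / real d - 1\<bar> \<le> 1 / real d" by simp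
  qed
  then show ?thesis by (simp add: link_walk_norm_def V)
qed

lemma link_walk_norm_X:
  assumes "F \<in> faces X (d - 2)"
  shows "link_walk_norm X \<mu> F \<le> 1 / real d"
proof -
  have F: "F \<in> X" "card F = d - 1" using assms d by (auto simp: faces_def)
  then have "F \<noteq> {}" using d by auto
  then obtain x where x: "x \<in> F" by auto
  obtain i where i: "i \<in> {t..<n}" "const_off t i F" "F \<subseteq> F2 n" using F by (auto simp: edge_blowup_def)
  have sub: "F \<subseteq> fib x \<union> fib (x + basis_vec i)" using const_off_subset_fibs[OF i(2,3) x] i(1) by simp
  show ?thesis
  proof (cases "F \<subseteq> fib x")
    case True
    then show ?thesis using link_walk_norm_one_fibre[OF F x] by simp
  next
    case False
    then obtain y where "y \<in> F" "y \<in> fib (x + basis_vec i)" using sub by auto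
    then show ?thesis using link_walk_norm_two_fibres[OF F x i(1) sub] by simp
  qed
qed

end

section \<open>Translation orbits\<close>

text \<open>Two adjacent fibres are modelled by \<open>F2 (t + 1)\<close>; this linear map places
  the model along direction \<open>i\<close>. Generators and orbit representatives found in the
  model, which depends on \<open>t\<close> only, are thus copied into every direction for every
  \<open>n\<close>.\<close>

definition spread :: "nat \<Rightarrow> nat \<Rightarrow> (nat \<Rightarrow> bit) \<Rightarrow> nat \<Rightarrow> bit" where
  "spread t i x = (\<lambda>k. if k < t then x k else if k = i then x t else 0)"

definition unspread :: "nat \<Rightarrow> nat \<Rightarrow> (nat \<Rightarrow> bit) \<Rightarrow> nat \<Rightarrow> bit" where
  "unspread t i y = (\<lambda>k. if k < t then y k else if k = t then y i else 0)"

text \<open>What one direction contributes to the weight of the top faces through 0, computed in the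
  model and hence independent of \<open>n\<close>. Faces within the fibre of 0 are included, since
  \<open>face_weight\<close> counts them in each direction.\<close>

definition rooted_weight :: "nat \<Rightarrow> nat \<Rightarrow> nat" where
  "rooted_weight d t = (\<Sum>\<tau> | \<tau> \<subseteq> F2 (t + 1) \<and> 0 \<in> \<tau> \<and> card \<tau> = d + 1.
     split_weight d (2 ^ t) (card {x \<in> \<tau>. x t = 1}))"

lemma spread_add: "spread t i (x + y) = spread t i x + spread t i y"
  by (auto simp: spread_def fun_eq_iff)

lemma spread_zero: "spread t i 0 = 0"
  by (auto simp: spread_def fun_eq_iff)

lemma spread_F2: "i < n \<Longrightarrow> t \<le> i \<Longrightarrow> spread t i x \<in> F2 n"
  by (auto simp: spread_def F2_def)

lemma unspread_F2: "unspread t i y \<in> F2 (t + 1)"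
  by (auto simp: unspread_def F2_def)

lemma unspread_spread: "t \<le> i \<Longrightarrow> x \<in> F2 (t + 1) \<Longrightarrow> unspread t i (spread t i x) = x"
  by (auto simp: spread_def unspread_def F2_def fun_eq_iff)

lemma spread_unspread:
  "t \<le> i \<Longrightarrow> (\<And>k. t \<le> k \<Longrightarrow> k \<noteq> i \<Longrightarrow> y k = 0) \<Longrightarrow> spread t i (unspread t i y) = y"
  by (auto simp: spread_def unspread_def fun_eq_iff)

lemma spread_low: "x \<in> F2 t \<Longrightarrow> spread t i x = x"
  by (auto simp: spread_def F2_def fun_eq_iff)

lemma inj_on_spread: "t \<le> i \<Longrightarrow> inj_on (spread t i) (F2 (t + 1))"
  by (rule inj_on_inverseI[of _ "unspread t i"]) (rule unspread_spread)

lemma spread_at: "t \<le> i \<Longrightarrow> spread t i x i = x t"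
  by (simp add: spread_def)

lemma spread_off: "t \<le> k \<Longrightarrow> k \<noteq> i \<Longrightarrow> spread t i x k = 0"
  by (simp add: spread_def)

lemma const_off_spread: "const_off t i (spread t i ` A)"
  by (auto simp: const_off_def spread_off)

context blowup
begin

lemma finite_rooted: "finite {\<tau>. \<tau> \<subseteq> F2 m \<and> P \<tau>}"
  by (rule finite_subset[of _ "Pow (F2 m)"]) (auto simp: finite_F2)

lemma rooted_weight_const_off:
  assumes i: "i \<in> {t..<n}"
  shows "(\<Sum>\<tau> | \<tau> \<in> faces X d \<and> 0 \<in> \<tau> \<and> const_off t i \<tau>. om (card {x \<in> \<tau>. x i = 1})) = rooted_weight d t"
  unfolding rooted_weight_def
proof (rule sum.reindex_bij_witness[of _ "(`) (spread t i)" "(`) (unspread t i)"])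
  have ti: "t \<le> i" "i < n" using i by auto
  fix \<tau> assume \<tau>: "\<tau> \<in> {\<tau>. \<tau> \<in> faces X d \<and> 0 \<in> \<tau> \<and> const_off t i \<tau>}"
  have zero: "x k = 0" if "x \<in> \<tau>" "t \<le> k" "k \<noteq> i" for x k
  proof -
    have "x k = (0 :: nat \<Rightarrow> bit) k" using \<tau> that unfolding const_off_def by blast
    then show ?thesis by simp
  qed
  have su: "spread t i (unspread t i x) = x" if "x \<in> \<tau>" for x
    using zero[OF that] ti by (intro spread_unspread) auto
  then show "spread t i ` unspread t i ` \<tau> = \<tau>" by (simp add: image_image)
  have inj: "inj_on (unspread t i) \<tau>" by (rule inj_on_inverseI[where g = "spread t i"]) (rule su)
  have z: "unspread t i 0 = 0" by (auto simp: unspread_def fun_eq_iff)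
  show "unspread t i ` \<tau> \<in> {\<tau>. \<tau> \<subseteq> F2 (t + 1) \<and> 0 \<in> \<tau> \<and> card \<tau> = d + 1}"
    using \<tau> unspread_F2 inj z by (auto simp: card_image faces_def intro: image_eqI[of _ _ 0])
  have "{x \<in> unspread t i ` \<tau>. x t = 1} = unspread t i ` {x \<in> \<tau>. x i = 1}"
    by (auto simp: unspread_def)
  moreover have "card (unspread t i ` {x \<in> \<tau>. x i = 1}) = card {x \<in> \<tau>. x i = 1}"
    by (rule card_image) (rule inj_on_subset[OF inj], auto)
  ultimately show "om (card {x \<in> unspread t i ` \<tau>. x t = 1}) = om (card {x \<in> \<tau>. x i = 1})"
    by simp
next
  have ti: "t \<le> i" "i < n" using i by auto
  fix \<tau> assume \<tau>: "\<tau> \<in> {\<tau>. \<tau> \<subseteq> F2 (t + 1) \<and> 0 \<in> \<tau> \<and> card \<tau> = d + 1}"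
  then have "unspread t i (spread t i x) = x" if "x \<in> \<tau>" for x
    using that ti by (intro unspread_spread) auto
  then show "unspread t i ` spread t i ` \<tau> = \<tau>" by (simp add: image_image)
  have "inj_on (spread t i) \<tau>" using \<tau> inj_on_subset[OF inj_on_spread[OF ti(1)]] by auto
  then show "spread t i ` \<tau> \<in> {\<tau>. \<tau> \<in> faces X d \<and> 0 \<in> \<tau> \<and> const_off t i \<tau>}"
    using \<tau> i spread_F2[OF ti(2,1)] const_off_spread[of t i \<tau>] spread_zero[of t i]
    by (auto simp: faces_def edge_blowup_def card_image intro: image_eqI[of _ _ 0])
qed

lemma rooted_total: "(\<Sum>\<tau> | \<tau> \<in> faces X d \<and> 0 \<in> \<tau>. wt \<tau>) = (n - t) * rooted_weight d t"
proof -
  have "(\<Sum>\<tau> | \<tau> \<in> faces X d \<and> 0 \<in> \<tau>. wt \<tau>) =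
      (\<Sum>i\<in>{t..<n}. \<Sum>\<tau> | \<tau> \<in> {\<tau> \<in> faces X d. 0 \<in> \<tau>} \<and> const_off t i \<tau>. om (card {x \<in> \<tau>. x i = 1}))"
    unfolding face_weight_def using finite_faces
    by (intro sum.swap_restrict) auto
  also have "\<dots> = (\<Sum>i\<in>{t..<n}. rooted_weight d t)"
    using rooted_weight_const_off by (intro sum.cong) (auto simp: conj_assoc)
  finally show ?thesis by simp
qed

text \<open>Counts pairs of a top face and one of its \<open>d + 1\<close> vertices, where a
  translation moves the vertex to 0. The closed form of the normalising constant is what allows
  exact weights to be written.\<close>

lemma total_weight_eq: "(d + 1) * Z = 2 ^ n * ((n - t) * rooted_weight d t)"
proof -
  have "(d + 1) * Z = (\<Sum>\<tau>\<in>faces X d. \<Sum>x | x \<in> F2 n \<and> x \<in> \<tau>. wt \<tau>)"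
    unfolding total_weight_def sum_distrib_left
  proof (intro sum.cong refl)
    fix \<tau> assume "\<tau> \<in> faces X d"
    then have "{x. x \<in> F2 n \<and> x \<in> \<tau>} = \<tau>" "card \<tau> = d + 1" by (auto simp: faces_def edge_blowup_def)
    then show "(d + 1) * wt \<tau> = (\<Sum>x | x \<in> F2 n \<and> x \<in> \<tau>. wt \<tau>)" by simp
  qed
  also have "\<dots> = (\<Sum>x\<in>F2 n. \<Sum>\<tau> | \<tau> \<in> faces X d \<and> x \<in> \<tau>. wt \<tau>)"
    using finite_faces finite_F2 by (rule sum.swap_restrict)
  also have "\<dots> = (\<Sum>x\<in>F2 n. (n - t) * rooted_weight d t)"
  proof (intro sum.cong refl)
    fix x assume x: "x \<in> F2 n"
    show "(\<Sum>\<tau> | \<tau> \<in> faces X d \<and> x \<in> \<tau>. wt \<tau>) = (n - t) * rooted_weight d t"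
      unfolding rooted_total[symmetric]
    proof (rule sum.reindex_bij_witness[of _ "(`) ((+) x)" "(`) ((+) x)"])
      show "(+) x ` \<tau> \<in> {\<tau>. \<tau> \<in> faces X d \<and> 0 \<in> \<tau>}" if "\<tau> \<in> {\<tau>. \<tau> \<in> faces X d \<and> x \<in> \<tau>}" for \<tau>
        using that by (auto simp: translate_faces x vec_add_self intro!: image_eqI[of _ _ x])
      show "(+) x ` \<tau> \<in> {\<tau>. \<tau> \<in> faces X d \<and> x \<in> \<tau>}" if "\<tau> \<in> {\<tau>. \<tau> \<in> faces X d \<and> 0 \<in> \<tau>}" for \<tau>
        using that by (auto simp: translate_faces x intro!: image_eqI[of _ _ 0])
      show "wt ((+) x ` \<tau>) = wt \<tau>" if "\<tau> \<in> {\<tau>. \<tau> \<in> faces X d \<and> x \<in> \<tau>}" for \<tau>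
        using that x by (intro wt_translate) (auto simp: faces_def)
    qed (simp_all add: vec_image_cancel)
  qed
  finally show ?thesis by (simp add: card_F2)
qed

lemma rooted_weight_pos: "rooted_weight d t > 0"
  using total_weight_eq Z_pos by (metis add_is_0 mult_is_0 neq0_conv one_neq_zero)

lemma wt_unique:
  assumes i: "i \<in> {t..<n}" "const_off t i \<tau>" and ab: "a \<in> \<tau>" "b \<in> \<tau>" "a i \<noteq> b i"
  shows "wt \<tau> = om (card {x \<in> \<tau>. x i = 1})"
proof -
  have "j = i" if "const_off t j \<tau>" for j
    using that i ab unfolding const_off_def by (metis atLeastLessThan_iff)
  then have "{j. j \<in> {t..<n} \<and> const_off t j \<tau>} = {i}" using i by blast
  then show ?thesis unfolding face_weight_def by simp
qed

end

section \<open>Representatives of translation orbits\<close>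

definition same_orbit :: "nat \<Rightarrow> (nat \<Rightarrow> bit) set \<Rightarrow> (nat \<Rightarrow> bit) set \<Rightarrow> bool" where
  "same_orbit m \<sigma> \<tau> \<longleftrightarrow> (\<exists>x\<in>F2 m. \<tau> = (+) x ` \<sigma>)"

lemma same_orbitI: "x \<in> F2 m \<Longrightarrow> \<tau> = (+) x ` \<sigma> \<Longrightarrow> same_orbit m \<sigma> \<tau>"
  by (auto simp: same_orbit_def)

lemma same_orbit_refl: "same_orbit m \<sigma> \<sigma>"
  by (rule same_orbitI[OF zero_in_F2]) simp

lemma same_orbit_sym:
  assumes "same_orbit m \<sigma> \<tau>" shows "same_orbit m \<tau> \<sigma>"
proof -
  obtain x where "x \<in> F2 m" "\<tau> = (+) x ` \<sigma>" using assms unfolding same_orbit_def by blast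
  then show ?thesis by (intro same_orbitI[of x]) (simp_all only: vec_image_cancel)
qed

lemma same_orbit_trans:
  assumes "same_orbit m \<sigma> \<tau>" "same_orbit m \<tau> \<rho>" shows "same_orbit m \<sigma> \<rho>"
proof -
  obtain x where x: "x \<in> F2 m" "\<tau> = (+) x ` \<sigma>" using assms(1) unfolding same_orbit_def by blast
  obtain y where y: "y \<in> F2 m" "\<rho> = (+) y ` \<tau>" using assms(2) unfolding same_orbit_def by blast
  show ?thesis
    by (rule same_orbitI[OF F2_add[OF y(1) x(1)]]) (simp add: x(2) y(2) image_image add.assoc)
qed

text \<open>Unique representation is expressed by the length of a filtered list: such lengths add up
  along concatenations, and \<open>ex1_index_iff\<close> turns length 1 into a unique index.\<close>

lemma ex_representatives:
  assumes "finite A" and refl: "\<And>a. R a a" and sym: "\<And>a b. R a b \<Longrightarrow> R b a"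
    and trans: "\<And>a b c. R a b \<Longrightarrow> R b c \<Longrightarrow> R a c"
  shows "\<exists>rs. set rs \<subseteq> A \<and> (\<forall>a\<in>A. length (filter (\<lambda>r. R r a) rs) = 1)"
  using assms(1)
proof (induction A rule: finite_induct)
  case (insert x A)
  then obtain rs where rs: "set rs \<subseteq> A" "\<forall>a\<in>A. length (filter (\<lambda>r. R r a) rs) = 1" by blast
  show ?case
  proof (cases "\<exists>r\<in>set rs. R r x")
    case True
    then obtain r where r: "r \<in> set rs" "R r x" by blast
    \<comment> \<open>\<open>x\<close> and \<open>r\<close> are related to the same elements, so
      \<open>x\<close> inherits the count of \<open>r\<close>, which lies in
      \<open>A\<close>.\<close>
    then have "(\<lambda>s. R s x) = (\<lambda>s. R s r)" using sym trans by blast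
    then have "length (filter (\<lambda>s. R s x) rs) = 1" using rs r by auto
    then show ?thesis using rs by (intro exI[of _ rs]) auto
  next
    case False
    have "\<not> R x a" if a: "a \<in> A" for a
    proof
      assume "R x a"
      have "filter (\<lambda>r. R r a) rs \<noteq> []" using rs(2) a by force
      then obtain r where "r \<in> set rs" "R r a" by (auto simp: filter_empty_conv)
      then show False using False \<open>R x a\<close> sym trans by blast
    qed
    moreover have "filter (\<lambda>r. R r x) rs = []" using False by (auto simp: filter_empty_conv)
    ultimately show ?thesis using rs refl by (intro exI[of _ "x # rs"]) auto
  qed
qed auto

text \<open>A mere choice is enough: it is applied to sets that depend on \<open>d\<close> and
  \<open>t\<close> only, so the chosen lists are constants in the text of the program.\<close>

definition orbit_reps :: "nat \<Rightarrow> (nat \<Rightarrow> bit) set set \<Rightarrow> (nat \<Rightarrow> bit) list list" where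
  "orbit_reps m A = (SOME rs. (\<forall>vs\<in>set rs. distinct vs \<and> set vs \<in> A) \<and>
     (\<forall>\<tau>\<in>A. length (filter (\<lambda>vs. same_orbit m (set vs) \<tau>) rs) = 1))"

lemma orbit_reps:
  assumes "finite A" "\<And>\<sigma>. \<sigma> \<in> A \<Longrightarrow> finite \<sigma>"
  shows "\<And>vs. vs \<in> set (orbit_reps m A) \<Longrightarrow> distinct vs \<and> set vs \<in> A"
    and "\<And>\<tau>. \<tau> \<in> A \<Longrightarrow> length (filter (\<lambda>vs. same_orbit m (set vs) \<tau>) (orbit_reps m A)) = 1"
proof -
  have "\<forall>\<sigma>\<in>A. \<exists>vs. set vs = \<sigma> \<and> distinct vs" using assms(2) finite_distinct_list by blast
  then obtain L where L: "\<And>\<sigma>. \<sigma> \<in> A \<Longrightarrow> set (L \<sigma>) = \<sigma> \<and> distinct (L \<sigma>)" by metis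
  obtain rs where rs: "set rs \<subseteq> A" "\<forall>\<tau>\<in>A. length (filter (\<lambda>\<sigma>. same_orbit m \<sigma> \<tau>) rs) = 1"
    using ex_representatives[OF assms(1), of "same_orbit m"] same_orbit_refl same_orbit_sym same_orbit_trans
    by metis
  have "length (filter (\<lambda>vs. same_orbit m (set vs) \<tau>) (map L rs)) = 1" if "\<tau> \<in> A" for \<tau>
  proof -
    have "filter (\<lambda>\<sigma>. same_orbit m (set (L \<sigma>)) \<tau>) rs = filter (\<lambda>\<sigma>. same_orbit m \<sigma> \<tau>) rs"
      using rs(1) L by (intro filter_cong) auto
    then show ?thesis using rs(2) that by (simp add: filter_map comp_def)
  qed
  then have "\<exists>rs. (\<forall>vs\<in>set rs. distinct vs \<and> set vs \<in> A) \<and>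
     (\<forall>\<tau>\<in>A. length (filter (\<lambda>vs. same_orbit m (set vs) \<tau>) rs) = 1)"
    using L rs(1) by (intro exI[of _ "map L rs"]) auto
  from someI_ex[OF this, folded orbit_reps_def] show
    "\<And>vs. vs \<in> set (orbit_reps m A) \<Longrightarrow> distinct vs \<and> set vs \<in> A"
    "\<And>\<tau>. \<tau> \<in> A \<Longrightarrow> length (filter (\<lambda>vs. same_orbit m (set vs) \<tau>) (orbit_reps m A)) = 1"
    by blast+
qed

definition fibre_reps :: "nat \<Rightarrow> nat \<Rightarrow> (nat \<Rightarrow> bit) list list" where
  "fibre_reps d t = orbit_reps t {\<tau>. \<tau> \<subseteq> F2 t \<and> card \<tau> = d + 1}"

text \<open>Only faces that meet both fibres: the others belong to all directions, and copying them
  along each one would list their orbits repeatedly.\<close>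

definition edge_reps :: "nat \<Rightarrow> nat \<Rightarrow> (nat \<Rightarrow> bit) list list" where
  "edge_reps d t = orbit_reps (t + 1)
     {\<tau>. \<tau> \<subseteq> F2 (t + 1) \<and> card \<tau> = d + 1 \<and> (\<exists>x\<in>\<tau>. x t = 0) \<and> (\<exists>x\<in>\<tau>. x t = 1)}"

text \<open>The denominators come from \<open>total_weight_eq\<close>. In the entries within a
  fibre, the factor \<open>n - t\<close> has cancelled against that of the face weight.\<close>

definition orbit_entries :: "nat \<Rightarrow> nat \<Rightarrow> nat \<Rightarrow> orbit_entry list" where
  "orbit_entries d t n =
     map (\<lambda>vs. (vs, split_weight d (2 ^ t) 0 * (d + 1), 2 ^ n * rooted_weight d t)) (fibre_reps d t) @
     concat (map (\<lambda>i. map (\<lambda>vs. (map (spread t i) vs,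
         split_weight d (2 ^ t) (card {x \<in> set vs. x t = 1}) * (d + 1),
         2 ^ n * rooted_weight d t * (n - t))) (edge_reps d t)) [t..<n])"

lemma ex1_index_iff: "(\<exists>!j. j < length xs \<and> P (xs ! j)) \<longleftrightarrow> length (filter P xs) = 1"
  using is_singleton_iff_ex1[of "{j. j < length xs \<and> P (xs ! j)}"]
  unfolding length_filter_conv_card is_singleton_altdef mem_Collect_eq by (rule sym)

context blowup
begin

lemma fibre_reps:
  shows "\<And>vs. vs \<in> set (fibre_reps d t) \<Longrightarrow> distinct vs \<and> set vs \<subseteq> F2 t \<and> card (set vs) = d + 1"
    and "\<And>\<tau>. \<tau> \<subseteq> F2 t \<Longrightarrow> card \<tau> = d + 1 \<Longrightarrow>
      length (filter (\<lambda>vs. same_orbit t (set vs) \<tau>) (fibre_reps d t)) = 1"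
proof -
  let ?A = "{\<tau>. \<tau> \<subseteq> F2 t \<and> card \<tau> = d + 1}"
  have fin: "finite ?A" by (rule finite_rooted)
  have fin': "finite \<sigma>" if "\<sigma> \<in> ?A" for \<sigma>
    using that finite_subset[OF _ finite_F2[of t], of \<sigma>] by simp
  note R = orbit_reps[OF fin fin', of _ t, folded fibre_reps_def]
  show "distinct vs \<and> set vs \<subseteq> F2 t \<and> card (set vs) = d + 1" if "vs \<in> set (fibre_reps d t)" for vs
    using R(1)[OF _ that] by simp
  show "length (filter (\<lambda>vs. same_orbit t (set vs) \<tau>) (fibre_reps d t)) = 1"
    if "\<tau> \<subseteq> F2 t" "card \<tau> = d + 1" for \<tau>
    using R(2)[of \<tau>] that by simp
qed

lemma edge_reps:
  shows "\<And>vs. vs \<in> set (edge_reps d t) \<Longrightarrow> distinct vs \<and> set vs \<subseteq> F2 (t + 1) \<and> card (set vs) = d + 1 \<and>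
      (\<exists>x\<in>set vs. x t = 0) \<and> (\<exists>x\<in>set vs. x t = 1)"
    and "\<And>\<tau>. \<tau> \<subseteq> F2 (t + 1) \<Longrightarrow> card \<tau> = d + 1 \<Longrightarrow> \<exists>x\<in>\<tau>. x t = 0 \<Longrightarrow> \<exists>x\<in>\<tau>. x t = 1 \<Longrightarrow>
      length (filter (\<lambda>vs. same_orbit (t + 1) (set vs) \<tau>) (edge_reps d t)) = 1"
proof -
  let ?A = "{\<tau>. \<tau> \<subseteq> F2 (t + 1) \<and> card \<tau> = d + 1 \<and> (\<exists>x\<in>\<tau>. x t = 0) \<and> (\<exists>x\<in>\<tau>. x t = 1)}"
  have fin: "finite ?A" by (rule finite_rooted)
  have fin': "finite \<sigma>" if "\<sigma> \<in> ?A" for \<sigma>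
    using that finite_subset[OF _ finite_F2[of "t + 1"], of \<sigma>] by simp
  note R = orbit_reps[OF fin fin', of _ "t + 1", folded edge_reps_def]
  show "distinct vs \<and> set vs \<subseteq> F2 (t + 1) \<and> card (set vs) = d + 1 \<and>
      (\<exists>x\<in>set vs. x t = 0) \<and> (\<exists>x\<in>set vs. x t = 1)" if "vs \<in> set (edge_reps d t)" for vs
    using R(1)[OF _ that] by simp
  show "length (filter (\<lambda>vs. same_orbit (t + 1) (set vs) \<tau>) (edge_reps d t)) = 1"
    if "\<tau> \<subseteq> F2 (t + 1)" "card \<tau> = d + 1" "\<exists>x\<in>\<tau>. x t = 0" "\<exists>x\<in>\<tau>. x t = 1" for \<tau>
    using R(2)[of \<tau>] that by simp
qed

end

section \<open>The list of generators and the Cayley degree\<close>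

definition F2_list :: "nat \<Rightarrow> (nat \<Rightarrow> bit) list" where
  "F2_list m = (SOME vs. set vs = F2 m \<and> distinct vs)"

lemma F2_list: "set (F2_list m) = F2 m" "distinct (F2_list m)"
  using someI_ex[OF finite_distinct_list[OF finite_F2[of m]], folded F2_list_def] by auto

definition fibre_gens :: "nat \<Rightarrow> (nat \<Rightarrow> bit) list" where
  "fibre_gens t = filter (\<lambda>v. v \<noteq> 0) (F2_list t)"

definition edge_gens :: "nat \<Rightarrow> (nat \<Rightarrow> bit) list" where
  "edge_gens t = filter (\<lambda>v. v t = 1) (F2_list (t + 1))"

definition gens_list :: "nat \<Rightarrow> nat \<Rightarrow> (nat \<Rightarrow> bit) list" where
  "gens_list t n = fibre_gens t @ concat (map (\<lambda>i. map (spread t i) (edge_gens t)) [t..<n])"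

context blowup
begin

lemma edge_gens: "v \<in> set (edge_gens t) \<longleftrightarrow> v \<in> F2 (t + 1) \<and> v t = 1"
  by (auto simp: edge_gens_def F2_list)

lemma fibre_gens: "v \<in> set (fibre_gens t) \<longleftrightarrow> v \<in> F2 t \<and> v \<noteq> 0"
  by (auto simp: fibre_gens_def F2_list)

lemma set_gens_list: "set (gens_list t n) = gens"
proof (intro equalityI subsetI)
  fix s assume "s \<in> set (gens_list t n)"
  then consider "s \<in> F2 t" "s \<noteq> 0" | i v where "i \<in> {t..<n}" "v \<in> F2 (t + 1)" "v t = 1" "s = spread t i v"
    by (auto simp: gens_list_def fibre_gens edge_gens)
  then show "s \<in> gens"
  proof cases
    case 1
    then show ?thesis using n F2_mono[of t n] by (auto simp: gens_def F2_def)
  next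
    case 2
    then have "s i = 1" by (simp add: spread_at)
    then have "s \<noteq> 0" by auto
    then show ?thesis
      unfolding gens_def using 2 spread_F2[of i n t v]
      by (intro CollectI conjI bexI[of _ i]) (auto simp: spread_off)
  qed
next
  fix s assume "s \<in> gens"
  then obtain i where s: "s \<in> F2 n" "s \<noteq> 0" and i: "i \<in> {t..<n}" and z: "\<And>k. t \<le> k \<Longrightarrow> k \<noteq> i \<Longrightarrow> s k = 0"
    by (auto simp: gens_def)
  show "s \<in> set (gens_list t n)"
  proof (cases "s i = 0")
    case True
    then have "s k = 0" if "t \<le> k" for k using z that by (cases "k = i") auto
    then have "s \<in> F2 t" by (auto simp: F2_def)
    then show ?thesis using s by (simp add: gens_list_def fibre_gens)
  next
    case False
    then have "unspread t i s \<in> set (edge_gens t)"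
      using unspread_F2 by (simp add: edge_gens unspread_def)
    moreover have "s = spread t i (unspread t i s)" using i z spread_unspread by auto
    ultimately show ?thesis using i by (auto simp: gens_list_def intro!: bexI[of _ i])
  qed
qed

text \<open>A copy along \<open>i\<close> of a vector with \<open>v t = 1\<close> has its only
  nonzero cube coordinate at \<open>i\<close>, so the direction can be read off; generators within
  the fibre have none.\<close>

lemma distinct_gens_list: "distinct (gens_list t n)"
proof -
  have inj: "inj_on (spread t i) (set (edge_gens t))" if "t \<le> i" for i
    by (rule inj_on_subset[OF inj_on_spread[OF that]]) (auto simp: edge_gens)
  have val: "spread t i v k = (if k = i then 1 else 0)" if "v \<in> set (edge_gens t)" "t \<le> k" for i k v
    using that by (simp add: edge_gens spread_def)
  have "distinct (concat (map (\<lambda>i. map (spread t i) (edge_gens t)) is))"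
    if "distinct is" "\<forall>i\<in>set is. t \<le> i" for "is"
    using that
  proof (induction "is")
    case (Cons i "is")
    have "spread t i v \<noteq> spread t j u"
      if "v \<in> set (edge_gens t)" "u \<in> set (edge_gens t)" "j \<in> set is" for v u j
    proof
      assume "spread t i v = spread t j u"
      then have "spread t i v i = spread t j u i" by simp
      then show False using val[of v i i] val[of u i j] that Cons.prems by (auto split: if_splits)
    qed
    then have "set (map (spread t i) (edge_gens t)) \<inter>
        set (concat (map (\<lambda>i. map (spread t i) (edge_gens t)) is)) = {}" by auto
    then show ?case
      using Cons inj[of i] by (simp add: distinct_map edge_gens_def F2_list)
  qed simp
  moreover have "set (fibre_gens t) \<inter> set (concat (map (\<lambda>i. map (spread t i) (edge_gens t)) [t..<n])) = {}"
  proof -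
    have "spread t i v \<notin> F2 t" if "v \<in> set (edge_gens t)" "t \<le> i" for v i
      using val[OF that(1) that(2), of i] that(2) by (auto simp: F2_def)
    then show ?thesis by (auto simp: fibre_gens)
  qed
  ultimately show ?thesis
    by (simp add: gens_list_def fibre_gens_def F2_list)
qed

lemma card_gens: "card gens = length (fibre_gens t) + (n - t) * length (edge_gens t)"
proof -
  have "card gens = length (gens_list t n)"
    using distinct_card[OF distinct_gens_list] by (simp add: set_gens_list)
  also have "length (concat (map (\<lambda>i. map (spread t i) (edge_gens t)) [t..<n])) = (n - t) * length (edge_gens t)"
    by (simp add: length_concat comp_def sum_list_triv)
  then have "length (gens_list t n) = length (fibre_gens t) + (n - t) * length (edge_gens t)"
    by (simp add: gens_list_def)
  finally show ?thesis .
qed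

lemma edge_gens_nonempty: "length (edge_gens t) > 0"
proof -
  have "basis_vec t \<in> set (edge_gens t)" by (simp add: edge_gens basis_vec_def F2_def)
  then show ?thesis by (cases "edge_gens t") auto
qed

section \<open>Correctness of the list of orbits\<close>

lemma pmf_orbit:
  assumes "\<tau> \<in> faces X d" "x \<in> F2 n"
  shows "pmf \<mu> ((+) x ` \<tau>) = real (wt \<tau> * (d + 1)) / real (2 ^ n * rooted_weight d t * (n - t))"
proof -
  \<comment> \<open>Expanded by \<open>d + 1\<close>, since the closed form is for
    \<open>(d + 1) * Z\<close>.\<close>
  have "real (wt \<tau>) / real Z = real (wt \<tau> * (d + 1)) / real ((d + 1) * Z)"
    unfolding of_nat_mult mult.commute[of "real (d + 1)" "real Z"]
    by (rule nonzero_mult_divide_mult_cancel_right[symmetric]) simp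
  also have "(d + 1) * Z = 2 ^ n * rooted_weight d t * (n - t)"
    using total_weight_eq by (simp only: ac_simps)
  finally show ?thesis unfolding pmf_translate[OF assms(2)] pmf_\<mu>[of \<tau>] if_P[OF assms(1)] .
qed

lemma fibre_face:
  assumes "\<sigma> \<subseteq> F2 t" "card \<sigma> = d + 1"
  shows "\<sigma> \<in> faces X d" "wt \<sigma> = (n - t) * om 0"
proof -
  have F2: "\<sigma> \<subseteq> F2 n" using assms(1) F2_mono[of t n] n by auto
  have "\<sigma> \<subseteq> fib 0" using F2 assms(1) by (auto simp: fib_def F2_def)
  then show "wt \<sigma> = (n - t) * om 0" using assms(2) by (rule wt_one_fibre)
  have "const_off t t \<sigma>" using const_off_mono[OF const_off_fib \<open>\<sigma> \<subseteq> fib 0\<close>] .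
  then show "\<sigma> \<in> faces X d" using F2 assms n by (auto simp: faces_def edge_blowup_def)
qed

lemma edge_face:
  assumes i: "i \<in> {t..<n}" and \<sigma>: "\<sigma> \<subseteq> F2 (t + 1)" "card \<sigma> = d + 1" "x \<in> \<sigma>" "x t = 0" "y \<in> \<sigma>" "y t = 1"
  shows "spread t i ` \<sigma> \<in> faces X d" "wt (spread t i ` \<sigma>) = om (card {x \<in> \<sigma>. x t = 1})"
proof -
  have ti: "t \<le> i" "i < n" using i by auto
  have inj: "inj_on (spread t i) \<sigma>" by (rule inj_on_subset[OF inj_on_spread[OF ti(1)] \<sigma>(1)])
  show "spread t i ` \<sigma> \<in> faces X d"
    using i \<sigma>(2) const_off_spread[of t i \<sigma>] spread_F2[OF ti(2,1)] card_image[OF inj]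
    by (auto simp: faces_def edge_blowup_def)
  have "wt (spread t i ` \<sigma>) = om (card {x \<in> spread t i ` \<sigma>. x i = 1})"
    using i const_off_spread \<sigma> by (intro wt_unique[of i _ "spread t i x" "spread t i y"]) (auto simp: spread_at)
  also have "{x \<in> spread t i ` \<sigma>. x i = 1} = spread t i ` {x \<in> \<sigma>. x t = 1}"
    using ti by (auto simp: spread_at)
  also have "card (spread t i ` {x \<in> \<sigma>. x t = 1}) = card {x \<in> \<sigma>. x t = 1}"
    by (rule card_image) (rule inj_on_subset[OF inj], auto)
  finally show "wt (spread t i ` \<sigma>) = om (card {x \<in> \<sigma>. x t = 1})" .
qed

lemma entries_sound:
  assumes "(vs, a, b) \<in> set (orbit_entries d t n)"
  shows "distinct vs \<and> set vs \<in> faces X d \<and> b > 0 \<and> (\<forall>x\<in>F2 n. pmf \<mu> ((+) x ` set vs) = real a / real b)"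
  using assms unfolding orbit_entries_def set_append
proof (elim UnE)
  assume "(vs, a, b) \<in> set (map (\<lambda>vs. (vs, om 0 * (d + 1), 2 ^ n * rooted_weight d t)) (fibre_reps d t))"
  then have vs: "vs \<in> set (fibre_reps d t)" and ab: "a = om 0 * (d + 1)" "b = 2 ^ n * rooted_weight d t" by auto
  note R = fibre_reps(1)[OF vs]
  have F: "set vs \<in> faces X d" "wt (set vs) = (n - t) * om 0" using fibre_face R by auto
  have "pmf \<mu> ((+) x ` set vs) = real a / real b" if "x \<in> F2 n" for x
  proof -
    have e: "(n - t) * om 0 * (d + 1) = om 0 * (d + 1) * (n - t)" by (simp only: ac_simps)
    show ?thesis
      unfolding pmf_orbit[OF F(1) that] F(2) e ab of_nat_mult[of _ "n - t"]
      by (rule nonzero_mult_divide_mult_cancel_right) (use n in simp)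
  qed
  then show ?thesis using R F rooted_weight_pos ab by simp
next
  assume "(vs, a, b) \<in> set (concat (map (\<lambda>i. map (\<lambda>vs. (map (spread t i) vs,
         om (card {x \<in> set vs. x t = 1}) * (d + 1),
         2 ^ n * rooted_weight d t * (n - t))) (edge_reps d t)) [t..<n]))"
  then obtain i us where i: "i \<in> {t..<n}" and us: "us \<in> set (edge_reps d t)" and vs: "vs = map (spread t i) us"
    and ab: "a = om (card {x \<in> set us. x t = 1}) * (d + 1)" "b = 2 ^ n * rooted_weight d t * (n - t)"
    by auto
  note R = edge_reps(1)[OF us]
  then obtain x y where xy: "x \<in> set us" "x t = 0" "y \<in> set us" "y t = 1" by blast
  have F: "set vs \<in> faces X d" "wt (set vs) = om (card {x \<in> set us. x t = 1})"
    using edge_face[OF i _ _ xy] R by (auto simp: vs)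
  have "inj_on (spread t i) (set us)"
    using inj_on_subset[OF inj_on_spread[of t i]] i R by auto
  then have "distinct vs" using R by (simp add: vs distinct_map)
  moreover have "pmf \<mu> ((+) x ` set vs) = real a / real b" if "x \<in> F2 n" for x
    unfolding pmf_orbit[OF F(1) that] F(2) ab by simp
  ultimately show ?thesis using F rooted_weight_pos ab n by simp
qed

text \<open>Whether a coordinate is constant on a face is an invariant of its orbit. It separates
  the entries within a fibre from the copies along each direction.\<close>

lemma same_orbit_values:
  assumes "same_orbit n \<sigma> \<tau>"
  shows "(\<exists>x\<in>\<sigma>. \<exists>y\<in>\<sigma>. x k \<noteq> y k) \<longleftrightarrow> (\<exists>x\<in>\<tau>. \<exists>y\<in>\<tau>. x k \<noteq> y k)"
proof -
  obtain z where "\<tau> = (+) z ` \<sigma>" using assms by (auto simp: same_orbit_def)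
  then show ?thesis by simp
qed

text \<open>A translation between nonempty subsets of a subgroup is by a difference of their points,
  hence by an element of the subgroup; enlarging the group does not merge orbits.\<close>

lemma same_orbit_F2:
  assumes "m \<le> n" "\<sigma> \<subseteq> F2 m" "\<rho> \<subseteq> F2 m" "\<rho> \<noteq> {}"
  shows "same_orbit n \<sigma> \<rho> \<longleftrightarrow> same_orbit m \<sigma> \<rho>"
proof
  assume "same_orbit n \<sigma> \<rho>"
  then obtain x where x: "x \<in> F2 n" "\<rho> = (+) x ` \<sigma>" by (auto simp: same_orbit_def)
  then obtain s where s: "s \<in> \<sigma>" using assms(4) by auto
  then have "x + s \<in> \<rho>" using x(2) by blast
  then have "s + (x + s) \<in> F2 m" using s assms(2,3) by (intro F2_add[of s m "x + s"]) auto
  moreover have "s + (x + s) = x" by (metis vec_add_cancel add.commute)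
  ultimately have "x \<in> F2 m" by simp
  then show "same_orbit m \<sigma> \<rho>" using x(2) by (rule same_orbitI)
next
  assume "same_orbit m \<sigma> \<rho>"
  then show "same_orbit n \<sigma> \<rho>" using F2_mono[OF assms(1)] by (auto simp: same_orbit_def)
qed

lemma same_orbit_spread:
  assumes i: "i \<in> {t..<n}" and "\<sigma> \<subseteq> F2 (t + 1)" "\<rho> \<subseteq> F2 (t + 1)" "\<rho> \<noteq> {}"
  shows "same_orbit n (spread t i ` \<sigma>) (spread t i ` \<rho>) \<longleftrightarrow> same_orbit (t + 1) \<sigma> \<rho>"
proof
  have ti: "t \<le> i" "i < n" using i by auto
  have us: "unspread t i ` spread t i ` A = A" if "A \<subseteq> F2 (t + 1)" for A
  proof -
    have "unspread t i (spread t i x) = x" if "x \<in> A" for x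
      using that \<open>A \<subseteq> F2 (t + 1)\<close> ti by (intro unspread_spread) auto
    then show ?thesis by (simp add: image_image)
  qed
  assume "same_orbit n (spread t i ` \<sigma>) (spread t i ` \<rho>)"
  then obtain x where x: "x \<in> F2 n" "spread t i ` \<rho> = (+) x ` spread t i ` \<sigma>" by (auto simp: same_orbit_def)
  have ua: "unspread t i (y + z) = unspread t i y + unspread t i z" for y z
    by (auto simp: unspread_def fun_eq_iff)
  have "\<rho> = unspread t i ` (+) x ` spread t i ` \<sigma>" using us[OF assms(3)] x(2) by simp
  also have "\<dots> = (+) (unspread t i x) ` unspread t i ` spread t i ` \<sigma>" by (simp only: image_image ua)
  also have "\<dots> = (+) (unspread t i x) ` \<sigma>" by (simp only: us[OF assms(2)])
  finally show "same_orbit (t + 1) \<sigma> \<rho>" by (intro same_orbitI[OF unspread_F2])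
next
  have ti: "t \<le> i" "i < n" using i by auto
  assume "same_orbit (t + 1) \<sigma> \<rho>"
  then obtain x where x: "x \<in> F2 (t + 1)" "\<rho> = (+) x ` \<sigma>" by (auto simp: same_orbit_def)
  show "same_orbit n (spread t i ` \<sigma>) (spread t i ` \<rho>)"
    by (rule same_orbitI[OF spread_F2[OF ti(2,1), of x]]) (simp only: x(2) image_image spread_add)
qed

lemma count_entries:
  "length (filter (\<lambda>e. P (fst e)) (orbit_entries d t n)) =
     length (filter P (fibre_reps d t)) + (\<Sum>i=t..<n. length (filter (\<lambda>vs. P (map (spread t i) vs)) (edge_reps d t)))"
proof -
  have "length (filter (\<lambda>e. P (fst e)) (concat (map (\<lambda>i. map (\<lambda>vs. (map (spread t i) vs, f vs)) (edge_reps d t)) is)))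
      = sum_list (map (\<lambda>i. length (filter (\<lambda>vs. P (map (spread t i) vs)) (edge_reps d t))) is)"
    for f :: "(nat \<Rightarrow> bit) list \<Rightarrow> nat \<times> nat" and "is"
    by (induction "is") (auto simp: filter_map comp_def)
  then show ?thesis
    by (simp add: orbit_entries_def filter_map comp_def interv_sum_list_conv_sum_set_nat)
qed

text \<open>Counts the matching entries. A face within a fibre matches one fibre representative and
  no copy of an edge representative; any other face matches one copy along its own direction and
  nothing else.\<close>

lemma entries_complete:
  assumes \<tau>: "\<tau> \<in> faces X d"
  shows "\<exists>!j. j < length (orbit_entries d t n) \<and> (\<exists>x\<in>F2 n. \<tau> = (+) x ` set (fst (orbit_entries d t n ! j)))"
proof -
  obtain i where i: "i \<in> {t..<n}" "const_off t i \<tau>" and \<tau>F: "\<tau> \<subseteq> F2 n" "card \<tau> = d + 1"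
    using \<tau> by (auto simp: faces_def edge_blowup_def)
  have ti: "t \<le> i" "i < n" using i by auto
  have "\<tau> \<noteq> {}" using \<tau>F by auto
  then obtain x0 where x0: "x0 \<in> \<tau>" by auto
  then have x0F: "x0 \<in> F2 n" using \<tau>F by auto
  \<comment> \<open>Translating by one of its points puts 0 into the face, so all cube coordinates
    except \<open>i\<close> vanish and the face can be compared with the model.\<close>
  define \<sigma> where "\<sigma> = (+) x0 ` \<tau>"
  have \<sigma>: "same_orbit n \<tau> \<sigma>" "card \<sigma> = d + 1" "\<sigma> \<subseteq> F2 n" "\<sigma> \<noteq> {}"
    using x0F \<tau>F \<open>\<tau> \<noteq> {}\<close> by (auto simp: \<sigma>_def card_image intro: same_orbitI F2_add)
  have swap: "same_orbit n \<rho> \<tau> \<longleftrightarrow> same_orbit n \<rho> \<sigma>" for \<rho>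
    using \<sigma>(1) same_orbit_sym same_orbit_trans by blast
  have \<sigma>0: "y k = 0" if "y \<in> \<sigma>" "t \<le> k" "k \<noteq> i" for y k
  proof -
    obtain z where z: "z \<in> \<tau>" "y = x0 + z" using \<open>y \<in> \<sigma>\<close> unfolding \<sigma>_def by blast
    then have "z k = x0 k" using i(2) x0 that unfolding const_off_def by blast
    then show ?thesis using z by (simp add: bit_add_self_eq_0)
  qed
  let ?P = "\<lambda>vs. same_orbit n (set vs) \<tau>"
  have edge0: "\<not> same_orbit n (spread t j ` set vs) \<tau>"
    if vs: "vs \<in> set (edge_reps d t)" and j: "j \<in> {t..<n}" and const: "\<And>x y. x \<in> \<tau> \<Longrightarrow> y \<in> \<tau> \<Longrightarrow> x j = y j" for vs j
  proof
    assume "same_orbit n (spread t j ` set vs) \<tau>"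
    moreover obtain x y where "x \<in> set vs" "x t = 0" "y \<in> set vs" "y t = 1" using edge_reps(1)[OF vs] by blast
    moreover from this have "spread t j x j \<noteq> spread t j y j" using j by (simp add: spread_at)
    ultimately have "\<exists>x\<in>\<tau>. \<exists>y\<in>\<tau>. x j \<noteq> y j"
      using same_orbit_values by blast
    then show False using const by blast
  qed
  have "length (filter ?P (fibre_reps d t)) +
      (\<Sum>j=t..<n. length (filter (\<lambda>vs. same_orbit n (spread t j ` set vs) \<tau>) (edge_reps d t))) = 1"
  proof (cases "\<forall>x\<in>\<tau>. \<forall>y\<in>\<tau>. x i = y i")
    case True
    have const: "x j = y j" if "x \<in> \<tau>" "y \<in> \<tau>" "j \<in> {t..<n}" for x y j
      using that True i(2) unfolding const_off_def by (cases "j = i") auto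
    have "y k = 0" if "y \<in> \<sigma>" "t \<le> k" for y k
    proof (cases "k = i")
      case True
      obtain z where z: "z \<in> \<tau>" "y = x0 + z" using \<open>y \<in> \<sigma>\<close> unfolding \<sigma>_def by blast
      then show ?thesis using const[OF z(1) x0 i(1)] True by (simp add: bit_add_self_eq_0)
    qed (use \<sigma>0 that in auto)
    then have "\<sigma> \<subseteq> F2 t" by (auto simp: F2_def)
    moreover have "?P vs = same_orbit t (set vs) \<sigma>" if "vs \<in> set (fibre_reps d t)" for vs
      unfolding swap using fibre_reps(1)[OF that] \<sigma>(4) \<open>\<sigma> \<subseteq> F2 t\<close> n by (intro same_orbit_F2) auto
    ultimately have "length (filter ?P (fibre_reps d t)) = 1"
      using fibre_reps(2)[of \<sigma>] \<sigma>(2) by (simp cong: filter_cong)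
    moreover have "filter (\<lambda>vs. same_orbit n (spread t j ` set vs) \<tau>) (edge_reps d t) = []" if "j \<in> {t..<n}" for j
      using edge0[OF _ that] const that by (auto simp: filter_empty_conv)
    ultimately show ?thesis by simp
  next
    case False
    then obtain y where y: "y \<in> \<tau>" "y i \<noteq> x0 i" using x0 by metis
    have "filter ?P (fibre_reps d t) = []"
    proof -
      have "\<not> ?P vs" if "vs \<in> set (fibre_reps d t)" for vs
      proof
        assume "?P vs"
        then have "\<exists>x\<in>set vs. \<exists>y\<in>set vs. x i \<noteq> y i"
          using y x0 by (subst same_orbit_values[of _ \<tau>]) auto
        moreover have "x i = 0" if "x \<in> set vs" for x
          using fibre_reps(1)[OF \<open>vs \<in> set (fibre_reps d t)\<close>] that ti by (auto simp: F2_def)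
        ultimately show False by metis
      qed
      then show ?thesis by (auto simp: filter_empty_conv)
    qed
    moreover have "length (filter (\<lambda>vs. same_orbit n (spread t j ` set vs) \<tau>) (edge_reps d t)) = (if j = i then 1 else 0)"
      if j: "j \<in> {t..<n}" for j
    proof (cases "j = i")
      case True
      define \<rho> where "\<rho> = unspread t i ` \<sigma>"
      have su: "spread t i (unspread t i x) = x" if "x \<in> \<sigma>" for x
        using \<sigma>0[OF that] ti by (intro spread_unspread) auto
      have \<sigma>\<rho>: "\<sigma> = spread t i ` \<rho>" using su by (simp add: \<rho>_def image_image)
      have "inj_on (unspread t i) \<sigma>" by (rule inj_on_inverseI[where g = "spread t i"]) (rule su)
      then have \<rho>: "\<rho> \<subseteq> F2 (t + 1)" "card \<rho> = d + 1" "\<rho> \<noteq> {}"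
        using \<sigma> unspread_F2 by (auto simp: \<rho>_def card_image)
      have "unspread t i (x0 + x0) \<in> \<rho>" "unspread t i (x0 + y) \<in> \<rho>" using x0 y by (auto simp: \<rho>_def \<sigma>_def)
      moreover have "unspread t i (x0 + x0) t = 0" by (simp add: unspread_def vec_add_self bit_add_self_eq_0)
      moreover have "unspread t i (x0 + y) t = 1"
        using y(2) by (cases "x0 i"; cases "y i") (auto simp: unspread_def)
      ultimately have "\<exists>x\<in>\<rho>. x t = 0" "\<exists>x\<in>\<rho>. x t = 1" by blast+
      note one = edge_reps(2)[OF \<rho>(1,2) this]
      have "same_orbit n (spread t i ` set vs) \<tau> = same_orbit (t + 1) (set vs) \<rho>" if "vs \<in> set (edge_reps d t)" for vs
        unfolding swap \<sigma>\<rho> using edge_reps(1)[OF that] \<rho> i by (intro same_orbit_spread) auto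
      then show ?thesis using one True by (simp cong: filter_cong)
    next
      case False
      have "x j = y j" if "x \<in> \<tau>" "y \<in> \<tau>" for x y
        using that i(2) j False unfolding const_off_def by auto
      then have "filter (\<lambda>vs. same_orbit n (spread t j ` set vs) \<tau>) (edge_reps d t) = []"
        using edge0[OF _ j] by (auto simp: filter_empty_conv)
      then show ?thesis using False by simp
    qed
    ultimately show ?thesis using i by simp
  qed
  then have "length (filter (\<lambda>e. ?P (fst e)) (orbit_entries d t n)) = 1"
    using count_entries[of ?P] by simp
  then show ?thesis
    unfolding ex1_index_iff[symmetric] same_orbit_def by simp
qed

lemma lists_orbits_entries: "lists_orbits n d X \<mu> (orbit_entries d t n)"
  unfolding lists_orbits_def using entries_sound entries_complete by auto

end

section \<open>Programs with polynomial cost\<close>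

lemma floorlog_le_self: "floorlog 2 k \<le> k"
  by (rule floorlog_leI) (auto simp: less_exp)

lemma floorlog_0: "floorlog b 0 = 0"
  by (simp add: floorlog_def)

lemma floorlog_1: "floorlog 2 (Suc 0) = 1"
  by (simp add: compute_floorlog floorlog_eq_zero_iff)

text \<open>The memory must be restored and the bound must not depend on earlier output; then
  programs compose by appending outputs and adding bounds.\<close>

definition emits :: "com \<Rightarrow> memory \<Rightarrow> nat list \<Rightarrow> nat \<Rightarrow> bool" where
  "emits c r xs T \<longleftrightarrow> (\<forall>out. \<exists>t\<le>T. exec c (r, out) t (r, out @ xs))"

lemma emits_Write: "acost r a < T \<Longrightarrow> xs = [aval r a] \<Longrightarrow> emits (Write a) r xs T"
  unfolding emits_def by (auto intro!: exI[of _ "acost r a + 1"] exec.Write)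

lemma emits_Seq: "emits c r xs T \<Longrightarrow> emits c' r ys T' \<Longrightarrow> emits (Seq c c') r (xs @ ys) (T + T')"
  unfolding emits_def by (metis add_mono append.assoc exec.Seq)

text \<open>Unrolls a list that is fixed in the program text; loops at run time are left for what
  depends on the index.\<close>

fun seq_list :: "com list \<Rightarrow> com" where
  "seq_list [] = Skip"
| "seq_list (c # cs) = Seq c (seq_list cs)"

lemma emits_seq_list:
  "(\<And>p. p \<in> set ps \<Longrightarrow> emits (f p) r (g p) (T p)) \<Longrightarrow>
    emits (seq_list (map f ps)) r (concat (map g ps)) ((\<Sum>p\<leftarrow>ps. T p) + 1)"
proof (induction ps)
  case Nil
  then show ?case by (auto simp: emits_def intro!: exI[of _ 1] exec.Skip)
next
  case (Cons p ps)
  then have "emits (Seq (f p) (seq_list (map f ps))) r (g p @ concat (map g ps)) (T p + ((\<Sum>p\<leftarrow>ps. T p) + 1))"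
    by (intro emits_Seq) auto
  then show ?case by (simp add: add.assoc)
qed

text \<open>Counting down returns the counter to its initial value 0, so that a loop can restore the
  memory.\<close>

definition count_down :: "nat \<Rightarrow> com \<Rightarrow> com" where
  "count_down a body = While (Reg (Const a)) (Seq body (Assign (Const a) (Minus (Reg (Const a)) (Const 1))))"

definition for_loop :: "nat \<Rightarrow> aexp \<Rightarrow> com \<Rightarrow> com" where
  "for_loop a e body = Seq (Assign (Const a) e) (count_down a body)"

definition loop_cost :: "nat \<Rightarrow> nat \<Rightarrow> nat \<Rightarrow> nat \<Rightarrow> nat" where
  "loop_cost a K N T = K + a + 2 + (N + 1) * (T + 3 * a + 3 * N + 12)"

text \<open>States are functions of the counter, which covers loops that write as well as the one
  that changes a register. \<open>M\<close> bounds the counter throughout, so the cost of a round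
  stays fixed during the induction on \<open>N\<close>.\<close>

lemma exec_count_down:
  assumes body: "\<And>k. k < N \<Longrightarrow> \<exists>t\<le>T. exec body (rs (Suc k), os (Suc k)) t ((rs k)(a := Suc k), os k)"
    and ctr: "\<And>k. k \<le> N \<Longrightarrow> rs k a = k" and "N \<le> M"
  shows "\<exists>t\<le>(N + 1) * (T + 3 * a + 3 * M + 12). exec (count_down a body) (rs N, os N) t (rs 0, os 0)"
  using assms
proof (induction N)
  case 0
  then have "rs 0 a = 0" by simp
  then have "exec (count_down a body) (rs 0, os 0) (acost (rs 0) (Reg (Const a)) + 1) (rs 0, os 0)"
    using exec.WhileFalse[of "(rs 0, os 0)" "Reg (Const a)"] by (simp add: count_down_def)
  moreover have "acost (rs 0) (Reg (Const a)) + 1 \<le> T + 3 * a + 3 * M + 12"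
    using \<open>rs 0 a = 0\<close> floorlog_le_self[of a] by (simp add: floorlog_0)
  ultimately show ?case by (intro exI[of _ "acost (rs 0) (Reg (Const a)) + 1"]) simp
next
  case (Suc N)
  obtain t0 where t0: "t0 \<le> T" "exec body (rs (Suc N), os (Suc N)) t0 ((rs N)(a := Suc N), os N)"
    using Suc.prems(1)[OF lessI] by blast
  obtain t1 where t1: "t1 \<le> (N + 1) * (T + 3 * a + 3 * M + 12)" "exec (count_down a body) (rs N, os N) t1 (rs 0, os 0)"
    using Suc.IH Suc.prems by (metis Suc_leD le_SucI less_SucI)
  let ?r = "(rs N)(a := Suc N)"
  let ?e = "Minus (Reg (Const a)) (Const 1)"
  have "exec (Assign (Const a) ?e) (?r, os N) (acost ?r (Const a) + acost ?r ?e + 1)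
      (?r(aval ?r (Const a) := aval ?r ?e), os N)"
    by (rule exec.Assign)
  moreover have "?r(aval ?r (Const a) := aval ?r ?e) = rs N" using Suc.prems(2)[of N] by (auto simp: fun_eq_iff)
  ultimately have step: "exec (Assign (Const a) ?e) (?r, os N) (acost ?r (Const a) + acost ?r ?e + 1) (rs N, os N)"
    by simp
  have "rs (Suc N) a = Suc N" using Suc.prems(2) by simp
  then have "exec (count_down a body) (rs (Suc N), os (Suc N))
      (acost (rs (Suc N)) (Reg (Const a)) + 1 + (t0 + (acost ?r (Const a) + acost ?r ?e + 1)) + t1) (rs 0, os 0)"
    using exec.WhileTrue[of "(rs (Suc N), os (Suc N))", OF _ exec.Seq[OF t0(2) step] t1(2)[unfolded count_down_def]]
    by (simp add: count_down_def)
  moreover have "acost (rs (Suc N)) (Reg (Const a)) + 1 + (t0 + (acost ?r (Const a) + acost ?r ?e + 1)) + t1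
      \<le> (Suc N + 1) * (T + 3 * a + 3 * M + 12)"
  proof -
    have "acost (rs (Suc N)) (Reg (Const a)) + 1 + (t0 + (acost ?r (Const a) + acost ?r ?e + 1))
      \<le> T + 3 * a + 3 * M + 12"
      using \<open>rs (Suc N) a = Suc N\<close> t0(1) Suc.prems(3) floorlog_le_self[of a] floorlog_le_self[of "Suc N"] floorlog_le_self[of N]
      by (simp add: floorlog_1)
    then show ?thesis using t1(1) by simp
  qed
  ultimately show ?case by blast
qed

lemma emits_for_loop:
  assumes "r a = 0" and N: "aval r e = N" and K: "acost r e \<le> K"
    and body: "\<And>k. 1 \<le> k \<Longrightarrow> k \<le> N \<Longrightarrow> emits body (r(a := k)) (g k) T"
  shows "emits (for_loop a e body) r (concat (map g (rev [1..<Suc N]))) (loop_cost a K N T)"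
  unfolding emits_def
proof
  fix out
  define rs where "rs k = r(a := k)" for k
  define os where "os k = out @ concat (map g (rev [Suc k..<Suc N]))" for k
  have os: "os k = os (Suc k) @ g (Suc k)" if "k < N" for k
    using that upt_conv_Cons[of "Suc k" "Suc N"] by (simp add: os_def del: upt_Suc)
  have "\<exists>t\<le>T. exec body (rs (Suc k), os (Suc k)) t ((rs k)(a := Suc k), os k)" if "k < N" for k
    using body[of "Suc k"] that unfolding emits_def os[OF that] by (simp add: rs_def)
  then obtain t where t: "t \<le> (N + 1) * (T + 3 * a + 3 * N + 12)"
      "exec (count_down a body) (rs N, os N) t (rs 0, os 0)"
    using exec_count_down[of N T body rs os a N] by (auto simp: rs_def)
  have "exec (Assign (Const a) e) (r, out) (acost r (Const a) + acost r e + 1) (r(aval r (Const a) := aval r e), out)"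
    by (rule exec.Assign)
  then have "exec (Assign (Const a) e) (r, out) (acost r (Const a) + acost r e + 1) (rs N, os N)"
    by (simp add: N rs_def os_def)
  from exec.Seq[OF this t(2)]
  have "exec (for_loop a e body) (r, out) (acost r (Const a) + acost r e + 1 + t) (rs 0, os 0)"
    by (simp add: for_loop_def)
  moreover have "rs 0 = r" using assms(1) by (auto simp: rs_def)
  moreover have "acost r (Const a) + acost r e + 1 + t \<le> loop_cost a K N T"
    using K t(1) floorlog_le_self[of a] by (simp add: loop_cost_def)
  ultimately show "\<exists>t\<le>loop_cost a K N T. exec (for_loop a e body) (r, out) t (r, out @ concat (map g (rev [1..<Suc N])))"
    by (auto simp: os_def)
qed

text \<open>Counters run down while coordinates and directions are listed upwards: the value
  \<open>k\<close> stands for coordinate \<open>t + M - k\<close>.\<close>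

lemma rev_upt_1: "rev [1..<Suc M] = map (\<lambda>i. t + M - i) [t..<t + M]"
  by (rule nth_equalityI) (auto simp: rev_nth simp del: upt_Suc)

section \<open>Programs that write vectors and orbit entries\<close>

definition edge_count :: aexp where
  "edge_count = Plus (Reg (Const 0)) (Const 1)"

lemma edge_count: "aval r edge_count = Suc (r 0)" "acost r edge_count \<le> 2 * r 0 + 6"
  using floorlog_le_self[of "r 0"] floorlog_le_self[of "Suc (r 0)"]
  by (simp_all add: edge_count_def floorlog_1 floorlog_0)

text \<open>
  The truncated subtractions in \<open>counters_agree\<close> test registers 1 and 2 for equality.
  Coordinate \<open>k \<ge> t\<close> is written when register 2 holds \<open>t + M - k\<close>, where \<open>M\<close> is the
  value of \<open>edge_count\<close>.
\<close>

definition counters_agree :: aexp where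
  "counters_agree = Minus (Minus (Const 1) (Minus (Reg (Const 1)) (Reg (Const 2)))) (Minus (Reg (Const 2)) (Reg (Const 1)))"

lemma aval_counters_agree: "aval r counters_agree = (if r 1 = r 2 then 1 else 0)"
  by (auto simp: counters_agree_def)

lemma acost_counters_agree:
  assumes "r 1 \<le> M" "r 2 \<le> M" shows "acost r counters_agree \<le> 6 * M + 40"
proof -
  have fl: "floorlog 2 (r 1) \<le> M" "floorlog 2 (r 2) \<le> M" "floorlog 2 (r 1 - r 2) \<le> M" "floorlog 2 (r 2 - r 1) \<le> M"
    using assms floorlog_le_self[of "r 1"] floorlog_le_self[of "r 2"]
      floorlog_le_self[of "r 1 - r 2"] floorlog_le_self[of "r 2 - r 1"] by linarith+
  have "floorlog 2 (Suc 0 - (r 1 - r 2)) \<le> 1" "floorlog 2 (Suc 0 - (r 1 - r 2) - (r 2 - r 1)) \<le> 1"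
    using floorlog_le_self[of "Suc 0 - (r 1 - r 2)"] floorlog_le_self[of "Suc 0 - (r 1 - r 2) - (r 2 - r 1)"] by linarith+
  then show ?thesis
    using fl floorlog_le_self[of 2] by (simp add: counters_agree_def floorlog_1)
qed

text \<open>Writes the copy of \<open>v\<close> along the direction encoded in register 1. The low
  bits are constants of the program. The comparison of counters is present only if
  \<open>v t = 1\<close>, so vectors of the fibre can be written while register 1 is 0.\<close>

definition emit_vec :: "nat \<Rightarrow> (nat \<Rightarrow> bit) \<Rightarrow> com" where
  "emit_vec t v = Seq (seq_list (map (\<lambda>k. Write (Const (if v k = 1 then 1 else 0))) [0..<t]))
     (for_loop 2 edge_count (Write (if v t = 1 then counters_agree else Const 0)))"

definition vec_cost :: "nat \<Rightarrow> nat \<Rightarrow> nat" where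
  "vec_cost t m = (\<Sum>k\<leftarrow>[0..<t]. 4) + 1 + loop_cost 2 (2 * m + 6) (Suc m) (6 * Suc m + 41)"

lemma emits_emit_vec:
  assumes r: "r 0 = m" "r 2 = 0" "r 1 \<le> Suc m" "v t = 1 \<Longrightarrow> 1 \<le> r 1"
  shows "emits (emit_vec t v) r (vec_code (t + Suc m) (spread t (t + Suc m - r 1) v)) (vec_cost t m)"
proof -
  define n where "n = t + Suc m"
  define h where "h k = (if v t = 1 \<and> r 1 = k then 1 else 0 :: nat)" for k
  have low: "emits (seq_list (map (\<lambda>k. Write (Const (if v k = 1 then 1 else 0))) [0..<t])) r
      (concat (map (\<lambda>k. [if v k = 1 then 1 else 0]) [0..<t])) ((\<Sum>k\<leftarrow>[0..<t]. 4) + 1)"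
    by (intro emits_seq_list emits_Write) (auto simp: floorlog_1 floorlog_0)
  have high: "emits (for_loop 2 edge_count (Write (if v t = 1 then counters_agree else Const 0))) r
      (concat (map (\<lambda>k. [h k]) (rev [1..<Suc (Suc m)]))) (loop_cost 2 (2 * m + 6) (Suc m) (6 * Suc m + 41))"
  proof (rule emits_for_loop)
    show "acost r edge_count \<le> 2 * m + 6" "aval r edge_count = Suc m" using edge_count[of r] r by auto
    fix k assume k: "1 \<le> k" "k \<le> Suc m"
    show "emits (Write (if v t = 1 then counters_agree else Const 0)) (r(2 := k)) [h k] (6 * Suc m + 41)"
    proof (rule emits_Write)
      have "acost (r(2 := k)) counters_agree \<le> 6 * Suc m + 40"
        using r k by (intro acost_counters_agree) auto
      then show "acost (r(2 := k)) (if v t = 1 then counters_agree else Const 0) < 6 * Suc m + 41"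
        by (simp add: floorlog_0)
      show "[h k] = [aval (r(2 := k)) (if v t = 1 then counters_agree else Const 0)]"
        by (simp add: aval_counters_agree h_def)
    qed
  qed (use r in auto)
  have "vec_code n (spread t (n - r 1) v) =
      map (\<lambda>k. if v k = 1 then 1 else 0) [0..<t] @ map (\<lambda>k. h (n - k)) [t..<n]"
  proof -
    have "[0..<n] = [0..<t] @ [t..<n]" using upt_add_eq_append[of 0 t "Suc m"] by (simp add: n_def)
    moreover have "map (\<lambda>k. if spread t (n - r 1) v k = 1 then 1 else 0 :: nat) [0..<t] = map (\<lambda>k. if v k = 1 then 1 else 0) [0..<t]"
      by (auto simp: spread_def)
    moreover have "map (\<lambda>k. if spread t (n - r 1) v k = 1 then 1 else 0 :: nat) [t..<n] = map (\<lambda>k. h (n - k)) [t..<n]"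
    proof (rule map_cong[OF refl])
      fix k assume "k \<in> set [t..<n]"
      then show "(if spread t (n - r 1) v k = 1 then 1 else 0 :: nat) = h (n - k)"
        using r by (auto simp: spread_def h_def n_def)
    qed
    ultimately show ?thesis by (simp only: vec_code_def map_append)
  qed
  moreover have "concat (map (\<lambda>k. [h k]) (rev [1..<Suc (Suc m)])) = map (\<lambda>k. h (n - k)) [t..<n]"
    unfolding rev_upt_1[of "Suc m" t] by (simp add: n_def comp_def del: upt_Suc)
  ultimately show ?thesis
    using emits_Seq[OF low high] by (simp add: emit_vec_def vec_cost_def n_def)
qed

definition emit_orbit :: "nat \<Rightarrow> (nat \<Rightarrow> bit) list \<Rightarrow> nat \<Rightarrow> aexp \<Rightarrow> com" where
  "emit_orbit t vs a e = Seq (seq_list (map (emit_vec t) vs)) (Seq (Write (Const a)) (Write e))"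

lemma emits_emit_orbit:
  assumes r: "r 0 = m" "r 2 = 0" "r 1 \<le> Suc m" "\<And>v. v \<in> set vs \<Longrightarrow> v t = 1 \<Longrightarrow> 1 \<le> r 1"
    and e: "aval r e = b" "acost r e < T"
  shows "emits (emit_orbit t vs a e) r
    (orbit_code (t + Suc m) (map (spread t (t + Suc m - r 1)) vs, a, b))
    ((\<Sum>v\<leftarrow>vs. vec_cost t m) + 1 + (a + 2 + T))"
proof -
  have "emits (seq_list (map (emit_vec t) vs)) r
      (concat (map (\<lambda>v. vec_code (t + Suc m) (spread t (t + Suc m - r 1) v)) vs)) ((\<Sum>v\<leftarrow>vs. vec_cost t m) + 1)"
    using r by (intro emits_seq_list emits_emit_vec) auto
  moreover have "emits (Seq (Write (Const a)) (Write e)) r ([a] @ [b]) (a + 2 + T)"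
    using e floorlog_le_self[of a] by (intro emits_Seq emits_Write) auto
  ultimately show ?thesis
    using emits_Seq by (fastforce simp: emit_orbit_def orbit_code_def comp_def)
qed

lemma emits_edge_loop:
  assumes r: "r 0 = m" "r 1 = 0"
    and body: "\<And>i. t \<le> i \<Longrightarrow> i < t + Suc m \<Longrightarrow> emits body (r(1 := t + Suc m - i)) (g i) T"
  shows "emits (for_loop 1 edge_count body) r (concat (map g [t..<t + Suc m])) (loop_cost 1 (2 * m + 6) (Suc m) T)"
proof -
  have "emits (for_loop 1 edge_count body) r
      (concat (map (\<lambda>k. g (t + Suc m - k)) (rev [1..<Suc (Suc m)]))) (loop_cost 1 (2 * m + 6) (Suc m) T)"
  proof (rule emits_for_loop)
    show "acost r edge_count \<le> 2 * m + 6" "aval r edge_count = Suc m" "r 1 = 0" using edge_count[of r] r by auto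
    fix k assume "1 \<le> k" "k \<le> Suc m"
    then show "emits body (r(1 := k)) (g (t + Suc m - k)) T"
      using body[of "t + Suc m - k"] by simp
  qed
  also have "map (\<lambda>k. g (t + Suc m - k)) (rev [1..<Suc (Suc m)]) = map g [t..<t + Suc m]"
    unfolding rev_upt_1[of "Suc m" t] by (auto simp del: upt_Suc)
  finally show ?thesis .
qed

definition size_exp :: "nat \<Rightarrow> nat \<Rightarrow> aexp" where
  "size_exp a b = Plus (Const a) (Times edge_count (Const b))"

lemma size_exp:
  assumes "r 0 = m"
  shows "aval r (size_exp a b) = a + Suc m * b"
    and "acost r (size_exp a b) < 2 * a + b + 2 * (Suc m * b) + 2 * m + 15"
  using edge_count[of r] assms floorlog_le_self[of a] floorlog_le_self[of b]
    floorlog_le_self[of "Suc m * b"] floorlog_le_self[of "a + Suc m * b"]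
  by (simp_all add: size_exp_def)

text \<open>For \<open>2 ^ n * K\<close> the length must be read off the exponent; the crude bound
  \<open>floorlog_le_self\<close> would make the cost exponential.\<close>

lemma floorlog_scaled_le:
  assumes "x \<le> 2 ^ n * K" shows "floorlog 2 x \<le> n + K"
proof (rule floorlog_leI)
  have "2 ^ n * K < (2 ^ n * 2 ^ K :: nat)" by (simp add: less_exp)
  then show "x < 2 ^ (n + K)" unfolding power_add by (rule le_less_trans[OF assms])
qed auto

text \<open>\<open>Suc m\<close> doublings of numbers whose length is linear in \<open>m\<close> for
  fixed \<open>K\<close>, hence polynomial logarithmic cost.\<close>

definition double_loop :: "nat \<Rightarrow> com" where
  "double_loop K = Seq (Assign (Const 3) (Const K))
     (for_loop 2 edge_count (Assign (Const 3) (Plus (Reg (Const 3)) (Reg (Const 3)))))"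

definition double_cost :: "nat \<Rightarrow> nat \<Rightarrow> nat" where
  "double_cost K m = K + 10 + loop_cost 2 (2 * m + 6) (Suc m) (3 * (Suc m + K) + 40)"

lemma exec_double_loop:
  assumes r: "r 0 = m" "r 2 = 0"
  shows "\<exists>t\<le>double_cost K m. exec (double_loop K) (r, out) t (r(3 := 2 ^ Suc m * K), out)"
proof -
  let ?N = "Suc m"
  let ?e = "Plus (Reg (Const 3)) (Reg (Const 3))"
  define rs where "rs k = r(2 := k, 3 := 2 ^ (?N - k) * K)" for k
  have c3: "acost s (Const 3) \<le> 4" for s using floorlog_le_self[of 3] by simp
  have "\<exists>t\<le>3 * (?N + K) + 40. exec (Assign (Const 3) ?e) (rs (Suc k), out) t ((rs k)(2 := Suc k), out)"
    if k: "k < ?N" for k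
  proof -
    let ?s = "rs (Suc k)"
    have val: "?s 3 + ?s 3 = 2 ^ (?N - k) * K"
      using k by (simp add: rs_def Suc_diff_le)
    have le: "2 ^ (?N - k) * K \<le> 2 ^ ?N * K"
      by (intro mult_right_mono power_increasing) auto
    have le': "?s 3 \<le> 2 ^ ?N * K" "?s 3 + ?s 3 \<le> 2 ^ ?N * K" using le val by linarith+
    from le'[THEN floorlog_scaled_le] have "acost ?s (Const 3) + acost ?s ?e + 1 \<le> 3 * (?N + K) + 40"
      using floorlog_le_self[of 3] by simp
    moreover have "exec (Assign (Const 3) ?e) (?s, out) (acost ?s (Const 3) + acost ?s ?e + 1)
        (?s(aval ?s (Const 3) := aval ?s ?e), out)"
      by (rule exec.Assign)
    moreover have "?s(aval ?s (Const 3) := aval ?s ?e) = (rs k)(2 := Suc k)"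
      using val by (auto simp: rs_def fun_eq_iff)
    ultimately show ?thesis by (intro exI[of _ "acost ?s (Const 3) + acost ?s ?e + 1"]) simp
  qed
  then obtain t2 where t2: "t2 \<le> (?N + 1) * (3 * (?N + K) + 40 + 3 * 2 + 3 * ?N + 12)"
    "exec (count_down 2 (Assign (Const 3) ?e)) (rs ?N, out) t2 (rs 0, out)"
    using exec_count_down[of ?N "3 * (?N + K) + 40" "Assign (Const 3) ?e" rs "\<lambda>_. out" 2 ?N]
    by (auto simp: rs_def)
  let ?r1 = "r(3 := K)"
  have e1: "exec (Assign (Const 3) (Const K)) (r, out) (acost r (Const 3) + acost r (Const K) + 1) (?r1, out)"
    using exec.Assign[of "Const 3" "Const K" r out] by simp
  have e2: "exec (Assign (Const 2) edge_count) (?r1, out) (acost ?r1 (Const 2) + acost ?r1 edge_count + 1) (rs ?N, out)"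
    using exec.Assign[of "Const 2" edge_count ?r1 out] edge_count(1)[of ?r1] r
    by (simp add: rs_def fun_upd_twist)
  have "rs 0 = r(3 := 2 ^ ?N * K)" using r by (auto simp: rs_def fun_eq_iff)
  then have "exec (double_loop K) (r, out) (acost r (Const 3) + acost r (Const K) + 1 +
      (acost ?r1 (Const 2) + acost ?r1 edge_count + 1 + t2)) (r(3 := 2 ^ ?N * K), out)"
    using exec.Seq[OF e1 exec.Seq[OF e2 t2(2)]] by (simp add: double_loop_def for_loop_def)
  moreover have "acost r (Const 3) + acost r (Const K) + 1 + (acost ?r1 (Const 2) + acost ?r1 edge_count + 1 + t2)
      \<le> double_cost K m"
    using t2(1) edge_count(2)[of ?r1] r floorlog_le_self[of 3] floorlog_le_self[of K] floorlog_le_self[of 2]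
    by (simp add: double_cost_def loop_cost_def)
  ultimately show ?thesis by blast
qed

text \<open>\<open>s\<close> will be the dimension, in which the running time is measured. The
  closure rules below yield the final polynomial without computing its coefficients.\<close>

definition poly_bounded :: "(nat \<Rightarrow> nat) \<Rightarrow> (nat \<Rightarrow> nat) \<Rightarrow> bool" where
  "poly_bounded s f \<longleftrightarrow> (\<exists>q :: nat poly. \<forall>m. f m \<le> poly q (s m))"

lemma poly_bounded_const: "poly_bounded s (\<lambda>_. c)"
  unfolding poly_bounded_def by (intro exI[of _ "[:c:]"]) simp

lemma poly_bounded_self: "(\<And>m. m \<le> s m) \<Longrightarrow> poly_bounded s (\<lambda>m. m)"
  unfolding poly_bounded_def by (intro exI[of _ "[:0, 1:]"]) simp

lemma poly_bounded_add: "poly_bounded s f \<Longrightarrow> poly_bounded s g \<Longrightarrow> poly_bounded s (\<lambda>m. f m + g m)"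
  unfolding poly_bounded_def by (metis add_mono poly_add)

lemma poly_bounded_mult: "poly_bounded s f \<Longrightarrow> poly_bounded s g \<Longrightarrow> poly_bounded s (\<lambda>m. f m * g m)"
  unfolding poly_bounded_def by (metis mult_le_mono poly_mult)

lemma poly_bounded_Suc: "poly_bounded s f \<Longrightarrow> poly_bounded s (\<lambda>m. Suc (f m))"
  using poly_bounded_add[OF _ poly_bounded_const[of s 1]] by simp

lemma poly_bounded_sum_list:
  "(\<And>p. p \<in> set ps \<Longrightarrow> poly_bounded s (\<lambda>m. f p m)) \<Longrightarrow> poly_bounded s (\<lambda>m. \<Sum>p\<leftarrow>ps. f p m)"
  by (induction ps) (auto intro: poly_bounded_const poly_bounded_add)

lemmas poly_bounded_intros =
  poly_bounded_const poly_bounded_add poly_bounded_mult poly_bounded_Suc poly_bounded_sum_list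

lemma poly_bounded_loop_cost:
  "poly_bounded s K \<Longrightarrow> poly_bounded s N \<Longrightarrow> poly_bounded s T \<Longrightarrow> poly_bounded s (\<lambda>m. loop_cost a (K m) (N m) (T m))"
  unfolding loop_cost_def by (intro poly_bounded_intros)

text \<open>
  Register 0 holds the index \<open>m\<close>, register 1 counts down the directions, register 2 is the
  counter of the inner loops, and register 3 holds \<open>2\<^sup>n * rooted_weight d t\<close>.
\<close>

definition blowup_program :: "nat \<Rightarrow> nat \<Rightarrow> com" where
  "blowup_program d t =
     Seq (Write (Plus (Reg (Const 0)) (Const (t + 1))))
    (Seq (Write (size_exp (length (fibre_gens t)) (length (edge_gens t))))
    (Seq (seq_list (map (emit_vec t) (fibre_gens t)))
    (Seq (for_loop 1 edge_count (seq_list (map (emit_vec t) (edge_gens t))))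
    (Seq (Write (size_exp (length (fibre_reps d t)) (length (edge_reps d t))))
    (Seq (double_loop (2 ^ t * rooted_weight d t))
    (Seq (seq_list (map (\<lambda>vs. emit_orbit t vs (split_weight d (2 ^ t) 0 * (d + 1)) (Reg (Const 3))) (fibre_reps d t)))
         (for_loop 1 edge_count (seq_list (map (\<lambda>vs. emit_orbit t vs
            (split_weight d (2 ^ t) (card {x \<in> set vs. x t = 1}) * (d + 1))
            (Times (Reg (Const 3)) edge_count)) (edge_reps d t))))))))))"

lemma concat_vec_code_edges:
  "concat (map f (concat (map (\<lambda>i. map (h i) ws) is))) = concat (map (\<lambda>i. concat (map (\<lambda>w. f (h i w)) ws)) is)"
  by (induction "is") (auto simp: comp_def)

lemma length_edges: "length (concat (map (\<lambda>i. map (h i) ws) is)) = length is * length ws"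
  by (induction "is") auto

lemma blowup_program_correct:
  assumes d: "d \<ge> 2" "2 * d \<le> 2 ^ t"
  shows "\<exists>q :: nat poly. \<forall>m. \<exists>T\<le>poly q (t + Suc m). \<exists>r.
     exec (blowup_program d t) (init_config m) T
       (r, output_code (t + Suc m) (gens_list t (t + Suc m)) (orbit_entries d t (t + Suc m)))"
proof -
  let ?G0 = "fibre_gens t" and ?G1 = "edge_gens t" and ?R0 = "fibre_reps d t" and ?R1 = "edge_reps d t"
  let ?W = "\<lambda>k. split_weight d (2 ^ t) k * (d + 1)"
  let ?wt = "\<lambda>vs :: (nat \<Rightarrow> bit) list. ?W (card {x \<in> set vs. x t = 1})"
  define K where "K = rooted_weight d t"
  \<comment> \<open>Costs by phase: \<open>C1\<close> for the dimension, \<open>C2\<close> for a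
    list length, \<open>C3\<close> for a list of vectors, \<open>D0\<close> and \<open>D1\<close>
    for evaluating the two kinds of denominators, \<open>C4\<close> for one orbit entry,
    \<open>L\<close> for a loop over the directions, \<open>O0\<close> for all entries within a
    fibre, \<open>O1\<close> for the edge entries of one direction.\<close>
  define C1 where "C1 m = 2 * m + 2 * t + 20" for m
  define C2 where "C2 a b m = 2 * a + b + 2 * (Suc m * b) + 2 * m + 15" for a b m :: nat
  define C3 where "C3 vs m = (\<Sum>v\<leftarrow>vs. vec_cost t m) + 1" for vs :: "(nat \<Rightarrow> bit) list" and m
  define D0 where "D0 m = t + Suc m + K + 10" for m
  define D1 where "D1 m = t + Suc m + K + 10 + (2 * m + 6) + (t + Suc m + K * Suc m) + 10" for m
  define C4 where "C4 a D vs m = (\<Sum>v\<leftarrow>vs. vec_cost t m) + 1 + (a vs + 2 + D m)"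
    for a :: "_ \<Rightarrow> nat" and D and vs :: "(nat \<Rightarrow> bit) list" and m
  define L where "L T m = loop_cost 1 (2 * m + 6) (Suc m) (T m)" for T :: "nat \<Rightarrow> nat" and m
  define O0 where "O0 m = (\<Sum>vs\<leftarrow>?R0. C4 (\<lambda>_. ?W 0) D0 vs m) + 1" for m
  define O1 where "O1 m = (\<Sum>vs\<leftarrow>?R1. C4 ?wt D1 vs m) + 1" for m
  define total where "total m = C1 m + (C2 (length ?G0) (length ?G1) m + (C3 ?G0 m + (L (C3 ?G1) m +
    (C2 (length ?R0) (length ?R1) m + (double_cost (2 ^ t * K) m + (O0 m + L O1 m))))))" for m
  have run: "\<exists>T\<le>total m. \<exists>r. exec (blowup_program d t) (init_config m) T
       (r, output_code (t + Suc m) (gens_list t (t + Suc m)) (orbit_entries d t (t + Suc m)))" for m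
  proof -
    let ?n = "t + Suc m"
    interpret blowup d t ?n using d by unfold_locales auto
    define r :: memory where "r = (\<lambda>_. 0)(0 := m)"
    define r' :: memory where "r' = r(3 := 2 ^ Suc m * (2 ^ t * K))"
    have r: "r 0 = m" "r 1 = 0" "r 2 = 0" by (auto simp: r_def)
    \<comment> \<open>The doubling starts from \<open>2 ^ t * K\<close>, so after
      \<open>Suc m\<close> rounds the exponent is the dimension.\<close>
    have r': "r' 0 = m" "r' 1 = 0" "r' 2 = 0" "r' 3 = 2 ^ ?n * K"
      by (auto simp: r'_def r_def power_add)
    have low: "v t = 0" if "v \<in> F2 t" for v using that by (simp add: F2_def)
    have fibre_spread: "map (spread t i) vs = vs" if "set vs \<subseteq> F2 t" for vs i
      using that by (intro map_idI) (auto intro: spread_low)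

    have 1: "emits (Write (Plus (Reg (Const 0)) (Const (t + 1)))) r [?n] (C1 m)"
      using floorlog_le_self[of m] floorlog_le_self[of "Suc t"] floorlog_le_self[of "m + Suc t"]
      by (intro emits_Write) (simp_all add: r C1_def floorlog_0)
    have 2: "emits (Write (size_exp a b)) s [a + Suc m * b] (C2 a b m)" if "s 0 = m" for a b s
      using size_exp[of s m a b, OF that] by (intro emits_Write) (simp_all add: C2_def)
    have G0F: "v \<in> F2 t" if "v \<in> set ?G0" for v using that fibre_gens by simp
    have 3: "emits (seq_list (map (emit_vec t) ?G0)) r (concat (map (vec_code ?n) ?G0)) (C3 ?G0 m)"
      unfolding C3_def
    proof (rule emits_seq_list)
      fix v assume "v \<in> set ?G0"
      then have v: "v \<in> F2 t" by (rule G0F)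
      show "emits (emit_vec t v) r (vec_code ?n v) (vec_cost t m)"
        using emits_emit_vec[of r m v t] r low[OF v] spread_low[OF v] by simp
    qed
    have 4: "emits (for_loop 1 edge_count (seq_list (map (emit_vec t) ?G1))) r
        (concat (map (\<lambda>i. concat (map (\<lambda>v. vec_code ?n (spread t i v)) ?G1)) [t..<?n])) (L (C3 ?G1) m)"
      unfolding L_def
    proof (rule emits_edge_loop)
      fix i assume i: "t \<le> i" "i < ?n"
      have "emits (emit_vec t v) (r(1 := ?n - i)) (vec_code ?n (spread t i v)) (vec_cost t m)" for v
        using emits_emit_vec[of "r(1 := ?n - i)" m v t] r i by simp
      then show "emits (seq_list (map (emit_vec t) ?G1)) (r(1 := ?n - i))
          (concat (map (\<lambda>v. vec_code ?n (spread t i v)) ?G1)) (C3 ?G1 m)"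
        unfolding C3_def by (intro emits_seq_list)
    qed (use r in auto)
    have 6: "emits (seq_list (map (\<lambda>vs. emit_orbit t vs (?W 0) (Reg (Const 3))) ?R0)) r'
        (concat (map (\<lambda>vs. orbit_code ?n (vs, ?W 0, 2 ^ ?n * K)) ?R0)) (O0 m)"
      unfolding O0_def
    proof (rule emits_seq_list)
      fix vs assume "vs \<in> set ?R0"
      then have vs: "set vs \<subseteq> F2 t" using fibre_reps(1) by blast
      have "acost r' (Reg (Const 3)) < D0 m"
        using floorlog_scaled_le[of "2 ^ ?n * K" ?n K] floorlog_le_self[of 3] by (simp add: r' D0_def)
      then show "emits (emit_orbit t vs (?W 0) (Reg (Const 3))) r'
          (orbit_code ?n (vs, ?W 0, 2 ^ ?n * K)) (C4 (\<lambda>_. ?W 0) D0 vs m)"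
        using emits_emit_orbit[of r' m vs t "Reg (Const 3)" "2 ^ ?n * K" "D0 m" "?W 0"] r' vs low fibre_spread[OF vs]
        unfolding C4_def by fastforce
    qed
    have 7: "emits (for_loop 1 edge_count (seq_list (map (\<lambda>vs. emit_orbit t vs (?wt vs) (Times (Reg (Const 3)) edge_count)) ?R1))) r'
        (concat (map (\<lambda>i. concat (map (\<lambda>vs. orbit_code ?n (map (spread t i) vs, ?wt vs, 2 ^ ?n * K * Suc m)) ?R1)) [t..<?n])) (L O1 m)"
      unfolding L_def
    proof (rule emits_edge_loop)
      fix i assume i: "t \<le> i" "i < ?n"
      let ?s = "r'(1 := ?n - i)"
      let ?e = "Times (Reg (Const 3)) edge_count"
      have val: "?s 0 = m" "?s 3 = 2 ^ ?n * K" using r' by simp_all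
      have "acost ?s ?e = 1 + floorlog 2 3 + 1 + floorlog 2 (2 ^ ?n * K) + acost ?s edge_count + 1 +
          floorlog 2 (2 ^ ?n * K * Suc m)"
        unfolding acost.simps aval.simps edge_count(1) val by simp
      moreover have "floorlog 2 (2 ^ ?n * K) \<le> ?n + K" by (rule floorlog_scaled_le) simp
      moreover have "floorlog 2 (2 ^ ?n * K * Suc m) \<le> ?n + K * Suc m"
        by (rule floorlog_scaled_le) (simp only: mult.assoc order_refl)
      moreover have "acost ?s edge_count \<le> 2 * m + 6" using edge_count(2)[of ?s] val by simp
      ultimately have "acost ?s ?e < D1 m"
        unfolding D1_def using floorlog_le_self[of 3] by linarith
      moreover have "aval ?s ?e = 2 ^ ?n * K * Suc m" using edge_count(1)[of ?s] by (simp add: r')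
      ultimately have "emits (emit_orbit t vs (?wt vs) ?e) ?s
          (orbit_code ?n (map (spread t i) vs, ?wt vs, 2 ^ ?n * K * Suc m)) (C4 ?wt D1 vs m)" for vs
        using emits_emit_orbit[of ?s m vs t ?e "2 ^ ?n * K * Suc m" "D1 m" "?wt vs"] r' i unfolding C4_def by simp
      then show "emits (seq_list (map (\<lambda>vs. emit_orbit t vs (?wt vs) ?e) ?R1)) ?s
          (concat (map (\<lambda>vs. orbit_code ?n (map (spread t i) vs, ?wt vs, 2 ^ ?n * K * Suc m)) ?R1)) (O1 m)"
        unfolding O1_def by (intro emits_seq_list)
    qed (use r' in auto)
    let ?out = "output_code ?n (gens_list t ?n) (orbit_entries d t ?n)"
    let ?x1 = "[?n]" and ?x2 = "[length ?G0 + Suc m * length ?G1]" and ?x3 = "concat (map (vec_code ?n) ?G0)"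
      and ?x4 = "concat (map (\<lambda>i. concat (map (\<lambda>v. vec_code ?n (spread t i v)) ?G1)) [t..<?n])"
      and ?x5 = "[length ?R0 + Suc m * length ?R1]"
      and ?x6 = "concat (map (\<lambda>vs. orbit_code ?n (vs, ?W 0, 2 ^ ?n * K)) ?R0)"
      and ?x7 = "concat (map (\<lambda>i. concat (map (\<lambda>vs. orbit_code ?n (map (spread t i) vs, ?wt vs, 2 ^ ?n * K * Suc m)) ?R1)) [t..<?n])"
    \<comment> \<open>Bracketed to the left, so that each prefix is the output after one phase of
      the run.\<close>
    have out: "?out = ((((((?x1 @ ?x2) @ ?x3) @ ?x4) @ ?x5) @ ?x6) @ ?x7)"
      by (simp add: output_code_def gens_list_def orbit_entries_def concat_vec_code_edges length_edges K_def comp_def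
          del: upt_Suc)
    obtain t1 where t1: "t1 \<le> C1 m" "exec (Write (Plus (Reg (Const 0)) (Const (t + 1)))) (r, []) t1 (r, ?x1)"
      using 1 unfolding emits_def by (metis append_Nil)
    obtain t2 where t2: "t2 \<le> C2 (length ?G0) (length ?G1) m"
      "exec (Write (size_exp (length ?G0) (length ?G1))) (r, ?x1) t2 (r, ?x1 @ ?x2)"
      using 2[of r, OF r(1)] unfolding emits_def by blast
    obtain t3 where t3: "t3 \<le> C3 ?G0 m"
      "exec (seq_list (map (emit_vec t) ?G0)) (r, ?x1 @ ?x2) t3 (r, (?x1 @ ?x2) @ ?x3)"
      using 3 unfolding emits_def by blast
    obtain t4 where t4: "t4 \<le> L (C3 ?G1) m"
      "exec (for_loop 1 edge_count (seq_list (map (emit_vec t) ?G1))) (r, (?x1 @ ?x2) @ ?x3) t4 (r, ((?x1 @ ?x2) @ ?x3) @ ?x4)"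
      using 4 unfolding emits_def by blast
    obtain t5 where t5: "t5 \<le> C2 (length ?R0) (length ?R1) m"
      "exec (Write (size_exp (length ?R0) (length ?R1))) (r, ((?x1 @ ?x2) @ ?x3) @ ?x4) t5 (r, (((?x1 @ ?x2) @ ?x3) @ ?x4) @ ?x5)"
      using 2[of r, OF r(1)] unfolding emits_def by blast
    obtain td where td: "td \<le> double_cost (2 ^ t * K) m"
      "exec (double_loop (2 ^ t * K)) (r, (((?x1 @ ?x2) @ ?x3) @ ?x4) @ ?x5) td (r', (((?x1 @ ?x2) @ ?x3) @ ?x4) @ ?x5)"
      using exec_double_loop[OF r(1,3)] unfolding r'_def by blast
    obtain t6 where t6: "t6 \<le> O0 m"
      "exec (seq_list (map (\<lambda>vs. emit_orbit t vs (?W 0) (Reg (Const 3))) ?R0))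
        (r', (((?x1 @ ?x2) @ ?x3) @ ?x4) @ ?x5) t6 (r', ((((?x1 @ ?x2) @ ?x3) @ ?x4) @ ?x5) @ ?x6)"
      using 6 unfolding emits_def by blast
    obtain t7 where t7: "t7 \<le> L O1 m"
      "exec (for_loop 1 edge_count (seq_list (map (\<lambda>vs. emit_orbit t vs (?wt vs) (Times (Reg (Const 3)) edge_count)) ?R1)))
        (r', ((((?x1 @ ?x2) @ ?x3) @ ?x4) @ ?x5) @ ?x6) t7 (r', ?out)"
      using 7 unfolding emits_def out by blast
    note ex = exec.Seq[OF t1(2) exec.Seq[OF t2(2) exec.Seq[OF t3(2) exec.Seq[OF t4(2)
      exec.Seq[OF t5(2) exec.Seq[OF td(2) exec.Seq[OF t6(2) t7(2)]]]]]]]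
    have "exec (blowup_program d t) (init_config m) (t1 + (t2 + (t3 + (t4 + (t5 + (td + (t6 + t7))))))) (r', ?out)"
      using ex unfolding blowup_program_def init_config_def r_def[symmetric] K_def .
    moreover have "t1 + (t2 + (t3 + (t4 + (t5 + (td + (t6 + t7)))))) \<le> total m"
      unfolding total_def using t1(1) t2(1) t3(1) t4(1) t5(1) td(1) t6(1) t7(1) by (intro add_mono)
    ultimately show ?thesis by blast
  qed
  have self: "poly_bounded (\<lambda>m. t + Suc m) (\<lambda>m. m)" by (rule poly_bounded_self) simp
  have "poly_bounded (\<lambda>m. t + Suc m) total"
    unfolding total_def[abs_def] L_def O0_def O1_def C1_def C2_def C3_def C4_def D0_def D1_def double_cost_def vec_cost_def
    by (intro poly_bounded_intros poly_bounded_loop_cost self)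
  then show ?thesis unfolding poly_bounded_def using run by (meson order_trans)
qed

theorem theorem1p3:
  fixes d :: nat
  assumes "d \<ge> 2"
  shows "\<exists>(n :: nat \<Rightarrow> nat) (S :: nat \<Rightarrow> (nat \<Rightarrow> bit) set)
            (X :: nat \<Rightarrow> (nat \<Rightarrow> bit) set set) (\<mu> :: nat \<Rightarrow> (nat \<Rightarrow> bit) set pmf).
    filterlim n at_top sequentially \<and>
    explicit_family d n S X \<mu> \<and>
    (\<forall>m. weighted_complex d (X m) (\<mu> m) \<and>
         cayley_complex (F2 (n m)) (S m) d (X m) (\<mu> m) \<and>
         translation_invariant (F2 (n m)) (\<mu> m) \<and>
         connected_complex (X m) \<and>
         (\<forall>F\<in>X m. card F < d \<longrightarrow> connected_complex (link (X m) F)) \<and>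
         (\<forall>F\<in>faces (X m) (d - 2). link_walk_norm (X m) (\<mu> m) F \<le> 1 / real d)) \<and>
    (\<exists>(c :: real) (C :: real). 0 < c \<and>
         (\<forall>m. c * real (n m) \<le> real (card (S m)) \<and> real (card (S m)) \<le> C * real (n m)))"
proof -
  \<comment> \<open>\<open>2 ^ (d + 1) = 2 * 2 ^ d\<close> exceeds \<open>2 * d\<close>. As
    \<open>t\<close> depends on \<open>d\<close> only, all lists attached to the model are constants
    of the family.\<close>
  define t where "t = d + 1"
  have q: "2 * d \<le> 2 ^ t"
    using less_exp[of d] by (simp add: t_def)
  define n where "n m = t + Suc m" for m
  define S where "S m = set (gens_list t (n m))" for m
  define X where "X m = edge_blowup d t (n m)" for m
  define \<mu> where "\<mu> m = blowup_pmf d t (n m)" for m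
  have loc: "blowup d t (n m)" for m
    using assms q by unfold_locales (auto simp: n_def)
  have S: "S m = blowup.gens t (n m)" for m
    by (simp add: S_def blowup.set_gens_list[OF loc])
  have "filterlim n at_top sequentially"
    by (rule filterlim_subseq) (auto simp: strict_mono_def n_def)
  moreover have "explicit_family d n S X \<mu>"
  proof -
    obtain p :: "nat poly" where p: "\<forall>m. \<exists>T\<le>poly p (t + Suc m). \<exists>r. exec (blowup_program d t) (init_config m) T
       (r, output_code (t + Suc m) (gens_list t (t + Suc m)) (orbit_entries d t (t + Suc m)))"
      using blowup_program_correct[OF assms q] by blast
    show ?thesis
      unfolding explicit_family_def
    proof (rule exI, rule exI, rule allI)
      fix m
      show "\<exists>gs os r T. distinct gs \<and> set gs = S m \<and> lists_orbits (n m) d (X m) (\<mu> m) os \<and>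
        exec (blowup_program d t) (init_config m) T (r, output_code (n m) gs os) \<and> T \<le> poly p (n m)"
        using p[rule_format, of m] blowup.distinct_gens_list[OF loc, of m] blowup.lists_orbits_entries[OF loc, of m]
        unfolding S_def X_def \<mu>_def n_def by blast
    qed
  qed
  moreover have "\<exists>(c :: real) C. 0 < c \<and>
      (\<forall>m. c * real (n m) \<le> real (card (S m)) \<and> real (card (S m)) \<le> C * real (n m))"
  proof (intro exI conjI allI)
    let ?a = "length (fibre_gens t)" and ?b = "length (edge_gens t)"
    have b: "?b \<ge> 1" using blowup.edge_gens_nonempty[OF loc] by (simp add: Suc_le_eq)
    \<comment> \<open>The lower constant comes from
      \<open>n m = t + Suc m <= (t + 1) * Suc m\<close> and at least one generator per direction;
      the upper one is the total length of the two model lists.\<close>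
    show "0 < 1 / real (t + 1)" by simp
    fix m
    have card: "card (S m) = ?a + Suc m * ?b"
      unfolding S blowup.card_gens[OF loc] by (simp add: n_def)
    have "n m \<le> (t + 1) * Suc m" by (simp add: n_def)
    also have "\<dots> \<le> (t + 1) * card (S m)"
      unfolding card using b by (intro mult_le_mono2) (metis le_add2 mult_le_mono2 mult.right_neutral order_trans)
    finally have "real (n m) \<le> real (t + 1) * real (card (S m))" unfolding of_nat_mult[symmetric] by (simp only: of_nat_le_iff)
    then show "1 / real (t + 1) * real (n m) \<le> real (card (S m))" by (simp add: field_simps)
    have "card (S m) \<le> (?a + ?b) * n m"
    proof -
      have "?a \<le> ?a * n m" "Suc m * ?b \<le> ?b * n m" by (simp_all add: n_def)
      then show ?thesis unfolding card distrib_right by (rule add_mono)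
    qed
    then show "real (card (S m)) \<le> real (?a + ?b) * real (n m)"
      unfolding of_nat_mult[symmetric] by (simp only: of_nat_le_iff)
  qed
  moreover have "weighted_complex d (X m) (\<mu> m) \<and>
         cayley_complex (F2 (n m)) (S m) d (X m) (\<mu> m) \<and>
         translation_invariant (F2 (n m)) (\<mu> m) \<and>
         connected_complex (X m) \<and>
         (\<forall>F\<in>X m. card F < d \<longrightarrow> connected_complex (link (X m) F)) \<and>
         (\<forall>F\<in>faces (X m) (d - 2). link_walk_norm (X m) (\<mu> m) F \<le> 1 / real d)" for m
    unfolding S X_def \<mu>_def
    using blowup.weighted_X[OF loc] blowup.cayley_X[OF loc] blowup.translation_invariant_\<mu>[OF loc]
      blowup.connected_X[OF loc] blowup.connected_links[OF loc] blowup.link_walk_norm_X[OF loc] by blast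
  ultimately show ?thesis by blast
qed

end
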